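(* Let $k\ge 2$ be an integer. For (Lebesgue-)almost every real $\alpha>4k^{2}-4k-1$, the $k$-level correlation function of the sequence $(\{n^{\alpha}\})_{n\ge 1}$ is Poissonian, that is, $$\lim_{N\to\infty}R_k(f,\alpha,N)=\int_{\mathbb{R}^{k-1}}f(\mathbf{x})\,\mathrm{d}\mathbf{x}\qquad\text{for all } f\in C_c^\infty(\mathbb{R}^{k-1}).$$ In particular, the pair correlation function (the case $k=2$) of $(\{n^{\alpha}\})_{n\ge1}$ is Poissonian for almost every $\alpha>7$.
   Context: $C_c^\infty(\mathbb{R}^{k-1})$ is the class of $C^\infty$ functions $\mathbb{R}^{k-1}\to\mathbb{R}$ with compact support. For $N\ge 1$ let $\mathcal{X}_k=\mathcal{X}_k(N)$ be the set of $k$-tuples $(x_1,\dots,x_k)$ of pairwise distinct integers with $1\le x_i\le N$. For $\mathbf{x}\in\mathcal{X}_k$ put $\Delta(\mathbf{x},\alpha)=(x_1^\alpha-x_2^\alpha,\,x_2^\alpha-x_3^\alpha,\dots,x_{k-1}^\alpha-x_k^\alpha)\in\mathbb{R}^{k-1}$. The $k$-level correlation sum is $$R_k(f,\alpha,N)=\frac1N\sum_{\mathbf{x}\in\mathcal{X}_k}\ \sum_{\mathbf{m}\in\mathbb{Z}^{k-1}}f\bigl(N(\Delta(\mathbf{x},\alpha)-\mathbf{m})\bigr).$$ *)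

theory Defs
  imports "HOL-Analysis.Analysis"
begin

text \<open>
  The space of \<open>(k - 1)\<close>-dimensional real vectors is \<open>real ^ 'n\<close> with \<open>CARD('n) = k - 1\<close>.
  The index type is linearly ordered, so that its elements can be read as the positions
  \<open>1, \<dots>, k - 1\<close>; the numeral types \<open>1, 2, 3, \<dots>\<close> provide such an index type for every \<open>k \<ge> 2\<close>.
\<close>

definition index_pos :: "'n::{finite,linorder} \<Rightarrow> nat" where
  "index_pos i = card {j. j \<le> i}"

lemma bij_betw_index_pos:
  "bij_betw index_pos (UNIV :: 'n::{finite,linorder} set) {1..CARD('n)}"
proof -
  have less: "index_pos i < index_pos j" if "i < j" for i j :: 'n
    unfolding index_pos_def using that by (intro psubset_card_mono) (auto simp: psubset_eq set_eq_iff not_le intro: exI[of _ j])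
  have inj: "inj (index_pos :: 'n \<Rightarrow> nat)"
    by (rule injI) (metis less less_irrefl linorder_less_linear)
  have "range (index_pos :: 'n \<Rightarrow> nat) \<subseteq> {1..CARD('n)}"
  proof
    fix m assume "m \<in> range (index_pos :: 'n \<Rightarrow> nat)"
    then obtain i :: 'n where m: "m = card {j. j \<le> i}" by (auto simp: index_pos_def)
    have "0 < card {j. j \<le> i}" by (subst card_gt_0_iff) auto
    moreover have "card {j. j \<le> i} \<le> CARD('n)" by (rule card_mono) auto
    ultimately show "m \<in> {1..CARD('n)}" using m by auto
  qed
  then have "range (index_pos :: 'n \<Rightarrow> nat) = {1..CARD('n)}"
    by (intro card_subset_eq) (auto simp: card_image[OF inj])
  with inj show ?thesis by (simp add: bij_betw_def)
qed

text \<open>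
  Class \<open>C\<^sup>r\<close> on the whole space: all directional derivatives up to order \<open>r\<close> exist
  (as Frechet derivatives) and are continuous.
\<close>

primrec class_C :: "nat \<Rightarrow> ('a::euclidean_space \<Rightarrow> real) \<Rightarrow> bool" where
  "class_C 0 f \<longleftrightarrow> continuous_on UNIV f"
| "class_C (Suc r) f \<longleftrightarrow>
     f differentiable_on UNIV \<and> (\<forall>v. class_C r (\<lambda>x. frechet_derivative f (at x) v))"

definition smooth_compact_support :: "('a::euclidean_space \<Rightarrow> real) \<Rightarrow> bool" where
  "smooth_compact_support f \<longleftrightarrow> (\<forall>r. class_C r f) \<and> compact (closure {x. f x \<noteq> 0})"

definition distinct_tuples :: "nat \<Rightarrow> nat \<Rightarrow> (nat \<Rightarrow> nat) set" where
  "distinct_tuples k N = {x \<in> {1..k} \<rightarrow>\<^sub>E {1..N}. inj_on x {1..k}}"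

definition power_diffs :: "(nat \<Rightarrow> nat) \<Rightarrow> real \<Rightarrow> real ^ 'n::{finite,linorder}" where
  "power_diffs x \<alpha> =
     (\<chi> i. real (x (index_pos i)) powr \<alpha> - real (x (index_pos i + 1)) powr \<alpha>)"

text \<open>
  Meaningful for \<open>CARD('n) = k - 1\<close>. If \<open>f\<close> has compact support, then the sum over
  the integer vectors has only finitely many nonzero terms.
\<close>

definition correlation_sum ::
  "nat \<Rightarrow> (real ^ 'n::{finite,linorder} \<Rightarrow> real) \<Rightarrow> real \<Rightarrow> nat \<Rightarrow> real" where
  "correlation_sum k f \<alpha> N =
     1 / real N * (\<Sum>x\<in>distinct_tuples k N. \<Sum>\<^sub>\<infinity>m::int ^ 'n::{finite,linorder}.
       f (real N *\<^sub>R (power_diffs x \<alpha> - (\<chi> i. real_of_int (m $ i)))))"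

end

theory Submission
  imports Defs "HOL-Library.Real_Mod"
begin

text \<open>
  Testing the correlation sum against products of Fejer kernels of width \<open>1 / (K N)\<close> turns it
  into an exponential sum in \<open>\<alpha>\<close>, whose zero frequency gives the expected main term. The mean square
  of the rest over a short interval of \<open>\<alpha>\<close> is controlled by oscillatory integrals with phase
  \<open>\<Sum>\<^sub>p z\<^sub>p p\<^sup>\<alpha>\<close>, where \<open>p\<close> runs over at most \<open>2 k\<close> integers. Let \<open>q\<close> be the largest \<open>p\<close> with
  \<open>z\<^sub>p \<noteq> 0\<close>. The operators \<open>d/d\<alpha> - ln p\<close> with \<open>p \<noteq> q\<close> remove from the derivative of the phase all
  terms but \<open>z\<^sub>q ln q q\<^sup>\<alpha> \<Prod>\<^sub>p (ln q - ln p)\<close>, and the argument of van der Corput bounds the integral by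
  the power \<open>- 1 / (2 k)\<close> of this term. On average over the \<open>p\<close> the small differences \<open>ln q - ln p\<close>
  cost nothing, since \<open>1 / (2 k) < 1\<close>, and the average over \<open>z\<^sub>q\<close> gains a factor \<open>N\<close> to the power
  \<open>- 1 / (2 k)\<close>. There are about \<open>N\<close> to the power \<open>2 k - 2\<close> frequencies to be summed against the
  normalization, so the condition is \<open>(\<alpha> + 1) / (2 k) > 2 k - 2\<close>, that is, \<open>\<alpha> > 4 k\<^sup>2 - 4 k - 1\<close>.
  This yields convergence for almost every \<open>\<alpha>\<close> along \<open>N = (m + 1)\<^sup>r\<close> for a large \<open>r\<close>. For nonnegative
  test functions the correlation sum at \<open>N\<close> is squeezed between its values at neighbouring
  points of this sequence, because their quotient tends to \<open>1\<close>.
\<close>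

subsection \<open>Oscillatory integrals\<close>

text \<open>The null set of exponents must not depend on the test function. Fejer kernels make this
  possible: for each \<open>N\<close> they involve only frequencies up to \<open>K * N\<close>, and
  the pairs of a width parameter \<open>K\<close> and a grid shift form a countable family, so one
  null set serves all of them. A general test function is then reached without any further
  exceptional set, by interpolation. The interpolation error is small relative to a majorant of the
  form 1 / (1 + (N t)^2) in each coordinate, and it is the mean of this majorant that has to stay
  bounded. The intervals of \<alpha> are short because the varying size of
  \<open>p powr \<alpha>\<close> costs a power of \<open>N powr (b - a)\<close> in the argument of
  van der Corput; a length proportional to the available saving in the exponent makes this loss
  harmless. Coefficients of size N^(1 - k) and the outer factor 1 / N, both squared, amount to
  N^(-2k), so any power saved over N^(2k) in the sum of oscillatory integrals is enough.\<close>

text \<open>A first derivative test in which \<open>exp (- \<mu> * t) * g t\<close> takes the role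
  of the monotone function, since its derivative is \<open>exp (- \<mu> * t) * g1 t\<close> and
  \<open>g1\<close> has constant sign \<sigma>. Integration by parts leaves an integrand of size at
  most \<open>\<bar>g1\<bar> / g^2 + \<mu> / \<bar>g\<bar>\<close>; the first term is dominated by
  the derivative of \<open>- \<sigma> * exp (\<mu> * (t - c)) / g t\<close>, the second by
  \<open>\<mu> / \<kappa>\<close>.\<close>

lemma van_der_corput_base:
  fixes \<phi> g g1 :: "real \<Rightarrow> real"
  assumes \<phi>: "\<And>t. (\<phi> has_real_derivative g t) (at t)"
    and g: "\<And>t. (g has_real_derivative g1 t + \<mu> * g t) (at t)"
    and \<mu>: "0 \<le> \<mu>" "exp (\<mu> * (d - c)) \<le> W"
    and cd: "c \<le> d" and \<kappa>: "\<kappa> > 0"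
    and glow: "\<And>t. t \<in> {c..d} \<Longrightarrow> \<kappa> \<le> \<bar>g t\<bar>"
    and \<sigma>: "\<bar>\<sigma>\<bar> = 1" "\<And>t. t \<in> {c..d} \<Longrightarrow> \<bar>g1 t\<bar> = \<sigma> * g1 t"
  shows "norm (integral {c..d} (\<lambda>t. cis (\<phi> t))) \<le> 4 * W / \<kappa>"
proof (cases "c = d")
  case True
  have "W \<ge> 1" using True \<mu> by simp
  then show ?thesis using True \<kappa> by simp
next
  case False
  then have cd: "c < d" using cd by simp
  have gnz: "g t \<noteq> 0" if "t \<in> {c..d}" for t using glow[OF that] \<kappa> by auto
  have cont_cis: "continuous_on A (\<lambda>t. cis (\<phi> t))" for A
    by (intro continuous_on_cis continuous_at_imp_continuous_on ballI DERIV_isCont[OF \<phi>])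
  \<comment> \<open>\<open>F\<close> is the integral minus the boundary term of the integration by
    parts, so only the term with \<open>1 / g\<close> differentiated survives in \<open>F'\<close>.
    \<open>b\<close> is a primitive of the bound for \<open>norm (F' t)\<close>, and the mean value
    inequality compares the increments of \<open>F\<close> and \<open>b\<close>.\<close>
  define F where "F = (\<lambda>t. integral {c..t} (\<lambda>t. cis (\<phi> t)) - cis (\<phi> t) / (\<i> * of_real (g t)))"
  define b where "b = (\<lambda>t. \<mu> / \<kappa> * t - \<sigma> * (exp (\<mu> * (t - c)) / g t))"
  define F' where "F' = (\<lambda>t. cis (\<phi> t) * of_real ((g1 t + \<mu> * g t) / (g t)\<^sup>2) / \<i>)"
  define b' where "b' = (\<lambda>t. \<mu> / \<kappa> + \<sigma> * (exp (\<mu> * (t - c)) * g1 t / (g t)\<^sup>2))"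
  have Fd: "(F has_vector_derivative F' t) (at t within {c..d})" if t: "t \<in> {c..d}" for t
  proof -
    have 1: "((\<lambda>t. integral {c..t} (\<lambda>t. cis (\<phi> t))) has_vector_derivative cis (\<phi> t)) (at t within {c..d})"
      by (rule integral_has_vector_derivative[OF cont_cis t])
    have 2: "((\<lambda>t. cis (\<phi> t)) has_vector_derivative g t *\<^sub>R (\<i> * cis (\<phi> t))) (at t within {c..d})"
    proof -
      have "((\<lambda>t. exp (\<i> * of_real (\<phi> t))) has_vector_derivative (\<i> * of_real (g t)) * exp (\<i> * of_real (\<phi> t))) (at t within {c..d})"
      proof -
        have "((\<lambda>t. \<i> * of_real (\<phi> t)) has_vector_derivative \<i> * of_real (g t)) (at t within {c..d})"
          using has_field_derivative_at_within[OF \<phi>[of t], of "{c..d}"]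
          by (intro has_vector_derivative_mult_right has_vector_derivative_of_real)
             (simp add: has_real_derivative_iff_has_vector_derivative)
        from field_vector_diff_chain_within[OF this DERIV_subset[OF DERIV_exp subset_UNIV]]
        show ?thesis by (simp add: o_def)
      qed
      then show ?thesis by (simp add: cis_conv_exp scaleR_conv_of_real mult_ac)
    qed
    have 3: "((\<lambda>t. 1 / g t) has_vector_derivative - ((g1 t + \<mu> * g t) / (g t)\<^sup>2)) (at t within {c..d})"
      unfolding has_real_derivative_iff_has_vector_derivative[symmetric]
      using gnz[OF t] by (auto intro!: derivative_eq_intros has_field_derivative_at_within[OF g] simp: power2_eq_square minus_divide_left)
    have 4: "((\<lambda>t. (1 / g t) *\<^sub>R (cis (\<phi> t) / \<i>)) has_vector_derivative
        (1 / g t) *\<^sub>R ((g t *\<^sub>R (\<i> * cis (\<phi> t))) / \<i>) + (- ((g1 t + \<mu> * g t) / (g t)\<^sup>2)) *\<^sub>R (cis (\<phi> t) / \<i>)) (at t within {c..d})"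
      by (intro has_vector_derivative_scaleR 3[folded has_real_derivative_iff_has_vector_derivative] has_vector_derivative_divide 2)
    have eq: "(1 / g t) *\<^sub>R ((g t *\<^sub>R (\<i> * cis (\<phi> t))) / \<i>) = cis (\<phi> t)"
      using gnz[OF t] by (simp add: scaleR_conv_of_real field_simps)
    have "((\<lambda>t. integral {c..t} (\<lambda>t. cis (\<phi> t)) - (1 / g t) *\<^sub>R (cis (\<phi> t) / \<i>)) has_vector_derivative
        cis (\<phi> t) - (cis (\<phi> t) + (- ((g1 t + \<mu> * g t) / (g t)\<^sup>2)) *\<^sub>R (cis (\<phi> t) / \<i>))) (at t within {c..d})"
      using has_vector_derivative_diff[OF 1 4] unfolding eq by simp
    moreover have "(\<lambda>t. integral {c..t} (\<lambda>t. cis (\<phi> t)) - (1 / g t) *\<^sub>R (cis (\<phi> t) / \<i>)) = F"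
      by (simp add: F_def fun_eq_iff scaleR_conv_of_real divide_divide_eq_left mult.commute[of \<i>] del: divide_i)
    moreover have "cis (\<phi> t) - (cis (\<phi> t) + (- ((g1 t + \<mu> * g t) / (g t)\<^sup>2)) *\<^sub>R (cis (\<phi> t) / \<i>)) = F' t"
      by (simp add: F'_def scaleR_conv_of_real mult_ac del: of_real_divide of_real_add)
    ultimately show ?thesis by simp
  qed
  have bd: "(b has_vector_derivative b' t) (at t within {c..d})" if t: "t \<in> {c..d}" for t
    unfolding b_def b'_def has_real_derivative_iff_has_vector_derivative[symmetric]
    using gnz[OF t] \<kappa>
    by (auto intro!: derivative_eq_intros has_field_derivative_at_within[OF g] simp: field_simps power2_eq_square)
  have le: "norm (F' t) \<le> b' t" if t: "t \<in> {c..d}" for t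
  proof -
    have "norm (F' t) = \<bar>g1 t + \<mu> * g t\<bar> / (g t)\<^sup>2"
      by (simp add: F'_def norm_divide norm_mult del: of_real_add of_real_divide)
    also have "\<dots> \<le> (\<bar>g1 t\<bar> + \<mu> * \<bar>g t\<bar>) / (g t)\<^sup>2"
      using \<mu>(1) abs_triangle_ineq[of "g1 t" "\<mu> * g t"] by (intro divide_right_mono) (auto simp: abs_mult)
    also have "\<dots> = \<bar>g1 t\<bar> / (g t)\<^sup>2 + \<mu> / \<bar>g t\<bar>"
      using gnz[OF t] by (simp add: field_simps power2_eq_square abs_if)
    also have "\<bar>g1 t\<bar> / (g t)\<^sup>2 \<le> exp (\<mu> * (t - c)) * \<bar>g1 t\<bar> / (g t)\<^sup>2"
      using t \<mu>(1) mult_right_mono[of 1 "exp (\<mu> * (t - c))" "\<bar>g1 t\<bar>"] by (intro divide_right_mono) auto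
    also have "\<mu> / \<bar>g t\<bar> \<le> \<mu> / \<kappa>" using glow[OF t] \<kappa> \<mu>(1) by (intro divide_left_mono) auto
    also have "exp (\<mu> * (t - c)) * \<bar>g1 t\<bar> / (g t)\<^sup>2 + \<mu> / \<kappa> = b' t"
      unfolding b'_def \<sigma>(2)[OF t] by simp
    finally show ?thesis by simp
  qed
  have "norm (F d - F c) \<le> b d - b c"
  proof (rule differentiable_bound_general[OF cd])
    show "continuous_on {c..d} F" "continuous_on {c..d} b"
      by (rule continuous_on_vector_derivative[OF Fd], assumption) (rule continuous_on_vector_derivative[OF bd])
    show "(F has_vector_derivative F' t) (at t)" if "c < t" "t < d" for t
      using Fd[of t] that at_within_interior[of t "{c..d}"] by simp
    show "(b has_vector_derivative b' t) (at t)" if "c < t" "t < d" for t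
      using bd[of t] that at_within_interior[of t "{c..d}"] by simp
    show "norm (F' t) \<le> b' t" if "c < t" "t < d" for t using le that by simp
  qed
  moreover have "b d - b c \<le> (W - 1) / \<kappa> + (W / \<kappa> + 1 / \<kappa>)"
  proof -
    have "\<mu> * (d - c) \<le> W - 1" using \<mu>(2) exp_ge_add_one_self[of "\<mu> * (d - c)"] by linarith
    then have "\<mu> * (d - c) / \<kappa> \<le> (W - 1) / \<kappa>" using \<kappa> by (intro divide_right_mono) auto
    then have 1: "\<mu> / \<kappa> * d - \<mu> / \<kappa> * c \<le> (W - 1) / \<kappa>" by (simp add: right_diff_distrib diff_divide_distrib)
    have 2: "\<bar>\<sigma> * (exp (\<mu> * (d - c)) / g d)\<bar> \<le> W / \<kappa>"
      using \<sigma>(1) \<mu>(2) order_trans[OF exp_ge_zero \<mu>(2)] glow[of d] cd \<kappa> by (auto simp: abs_mult intro!: frac_le)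
    have 3: "\<bar>\<sigma> * (exp (\<mu> * (c - c)) / g c)\<bar> \<le> 1 / \<kappa>"
      using \<sigma>(1) glow[of c] cd \<kappa> by (auto simp: abs_mult intro!: frac_le)
    show ?thesis using 1 2 3 unfolding b_def by linarith
  qed
  moreover have "norm (integral {c..d} (\<lambda>t. cis (\<phi> t))) \<le> norm (F d - F c) + 1 / \<kappa> + 1 / \<kappa>"
  proof -
    have "integral {c..d} (\<lambda>t. cis (\<phi> t)) = (F d - F c) + cis (\<phi> d) / (\<i> * of_real (g d)) - cis (\<phi> c) / (\<i> * of_real (g c))"
      by (simp add: F_def)
    also have "norm \<dots> \<le> norm (F d - F c) + norm (cis (\<phi> d) / (\<i> * of_real (g d))) + norm (cis (\<phi> c) / (\<i> * of_real (g c)))"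
      using norm_triangle_ineq4[of "F d - F c + cis (\<phi> d) / (\<i> * of_real (g d))" "cis (\<phi> c) / (\<i> * of_real (g c))"]
        norm_triangle_ineq[of "F d - F c" "cis (\<phi> d) / (\<i> * of_real (g d))"] by linarith
    also have "norm (cis (\<phi> d) / (\<i> * of_real (g d))) \<le> 1 / \<kappa>"
      using glow[of d] cd \<kappa> by (auto simp: norm_divide norm_mult intro!: frac_le)
    also have "norm (cis (\<phi> c) / (\<i> * of_real (g c))) \<le> 1 / \<kappa>"
      using glow[of c] cd \<kappa> by (auto simp: norm_divide norm_mult intro!: frac_le)
    finally show ?thesis by simp
  qed
  moreover have "(W - 1) / \<kappa> + (W / \<kappa> + 1 / \<kappa>) + 1 / \<kappa> + 1 / \<kappa> \<le> 4 * W / \<kappa>"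
  proof -
    have "1 \<le> exp (\<mu> * (d - c))" using \<mu>(1) cd by simp
    then have "W \<ge> 1" using \<mu>(2) by linarith
    then show ?thesis using \<kappa> by (simp add: field_simps)
  qed
  ultimately show ?thesis by linarith
qed

text \<open>The weighted function \<open>h\<close> has a derivative of size at least
  \<open>\<kappa> / W\<close>, so it can be small only near one point. Off the
  \<delta>-neighbourhood of that point the hypothesis on \<open>B\<close> applies to the two
  remaining intervals; the neighbourhood itself is estimated by its length, at most
  \<open>2 * \<delta>\<close>.\<close>

lemma oscillatory_split:
  fixes \<phi> g g1 :: "real \<Rightarrow> real"
  assumes cont: "continuous_on {c..d} \<phi>"
    and g: "\<And>t. (g has_real_derivative g1 t + \<mu> * g t) (at t)"
    and \<mu>: "0 \<le> \<mu>" "exp (\<mu> * (d - c)) \<le> W"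
    and cd: "c \<le> d" and \<kappa>: "\<kappa> > 0" and \<delta>: "\<delta> > 0"
    and low: "\<And>t. t \<in> {c..d} \<Longrightarrow> \<kappa> \<le> \<bar>g1 t\<bar>"
    and B: "\<And>c' d'. c \<le> c' \<Longrightarrow> c' \<le> d' \<Longrightarrow> d' \<le> d \<Longrightarrow>
              (\<And>t. t \<in> {c'..d'} \<Longrightarrow> \<kappa> * \<delta> / (2 * W) \<le> \<bar>g t\<bar>) \<Longrightarrow>
              norm (integral {c'..d'} (\<lambda>t. cis (\<phi> t))) \<le> B"
    and B0: "B \<ge> 0"
  shows "norm (integral {c..d} (\<lambda>t. cis (\<phi> t))) \<le> 2 * B + 2 * \<delta>"
proof -
  have "1 \<le> exp (\<mu> * (d - c))" using \<mu>(1) cd by simp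
  then have W: "W \<ge> 1" using \<mu>(2) by linarith
  define h where "h = (\<lambda>t. exp (- \<mu> * (t - c)) * g t)"
  have h': "(h has_real_derivative exp (- \<mu> * (t - c)) * g1 t) (at t)" for t
    unfolding h_def by (auto intro!: derivative_eq_intros g simp: algebra_simps)
  have conth: "continuous_on {c..d} (\<lambda>t. \<bar>h t\<bar>)"
    by (intro continuous_intros continuous_at_imp_continuous_on ballI DERIV_isCont[OF h'])
  \<comment> \<open>Taking the minimum of \<open>\<bar>h\<bar>\<close> avoids asking for a zero:
    \<open>\<bar>h t - h t0\<bar> \<le> 2 * \<bar>h t\<bar>\<close> holds in any case, and this is
    the origin of the 2 in \<open>\<kappa> * \<delta> / (2 * W)\<close>.\<close>
  obtain t0 where t0: "t0 \<in> {c..d}" "\<And>t. t \<in> {c..d} \<Longrightarrow> \<bar>h t0\<bar> \<le> \<bar>h t\<bar>"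
    using continuous_attains_inf[OF _ _ conth] cd by auto
  have lip: "\<kappa> / W * (t - s) \<le> \<bar>h t - h s\<bar>" if "s \<in> {c..d}" "t \<in> {c..d}" "s < t" for s t
  proof -
    obtain \<xi> where \<xi>: "s < \<xi>" "\<xi> < t" "h t - h s = (t - s) * (exp (- \<mu> * (\<xi> - c)) * g1 \<xi>)"
      using MVT2[OF \<open>s < t\<close>, of h "\<lambda>x. exp (- \<mu> * (x - c)) * g1 x"] h' by blast
    have \<xi>': "\<xi> \<in> {c..d}" using \<xi> that by auto
    have "exp (\<mu> * (\<xi> - c)) \<le> exp (\<mu> * (d - c))" using \<xi>' \<mu>(1) by (auto intro!: mult_left_mono)
    then have "exp (\<mu> * (\<xi> - c)) \<le> W" using \<mu>(2) by linarith
    then have "1 / W \<le> 1 / exp (\<mu> * (\<xi> - c))" by (intro divide_left_mono) (use W in auto)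
    then have "1 / W \<le> exp (- \<mu> * (\<xi> - c))" by (simp only: minus_mult_left[symmetric] exp_minus inverse_eq_divide)
    then have "1 / W * \<kappa> \<le> exp (- \<mu> * (\<xi> - c)) * \<bar>g1 \<xi>\<bar>"
      using low[OF \<xi>'] \<kappa> W by (intro mult_mono) auto
    then have "(t - s) * (\<kappa> / W) \<le> (t - s) * (exp (- \<mu> * (\<xi> - c)) * \<bar>g1 \<xi>\<bar>)"
      using \<open>s < t\<close> by (intro mult_left_mono) auto
    then show ?thesis using \<open>s < t\<close> by (simp add: \<xi>(3) abs_mult mult.commute)
  qed
  have key: "\<kappa> * \<delta> / (2 * W) \<le> \<bar>g t\<bar>" if t: "t \<in> {c..d}" "\<delta> \<le> \<bar>t - t0\<bar>" for t
  proof -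
    have "t \<noteq> t0" using t \<delta> by auto
    then have "\<kappa> / W * \<bar>t - t0\<bar> \<le> \<bar>h t - h t0\<bar>"
      using lip[of t t0] lip[of t0 t] t0(1) t(1) by (cases "t < t0") (auto simp: abs_minus_commute)
    also have "\<dots> \<le> 2 * \<bar>h t\<bar>" using t0(2)[OF t(1)] by linarith
    also have "\<bar>h t\<bar> \<le> 1 * \<bar>g t\<bar>"
      unfolding h_def abs_mult using t \<mu>(1) by (intro mult_right_mono) (auto simp: mult_nonneg_nonneg)
    finally have 1: "\<kappa> / W * \<bar>t - t0\<bar> \<le> 2 * \<bar>g t\<bar>" by simp
    have "\<kappa> / W * \<delta> \<le> \<kappa> / W * \<bar>t - t0\<bar>" using t \<kappa> W by (intro mult_left_mono) auto
    with 1 show ?thesis using W by (simp add: field_simps)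
  qed
  define c' where "c' = max c (t0 - \<delta>)"
  define d' where "d' = min d (t0 + \<delta>)"
  have ord: "c \<le> c'" "c' \<le> t0" "t0 \<le> d'" "d' \<le> d" using t0(1) \<delta> by (auto simp: c'_def d'_def)
  have int: "(\<lambda>t. cis (\<phi> t)) integrable_on {x..y}" if "c \<le> x" "y \<le> d" for x y
    using that by (intro integrable_continuous_interval continuous_on_cis continuous_on_subset[OF cont]) auto
  have 1: "norm (integral {c..c'} (\<lambda>t. cis (\<phi> t))) \<le> B"
  proof (cases "c' = c")
    case False
    then show ?thesis using ord by (intro B key) (auto simp: c'_def)
  qed (use B0 in simp)
  have 2: "norm (integral {d'..d} (\<lambda>t. cis (\<phi> t))) \<le> B"
  proof (cases "d' = d")
    case False
    then show ?thesis using ord by (intro B key) (auto simp: d'_def)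
  qed (use B0 in simp)
  have 3: "norm (integral {c'..d'} (\<lambda>t. cis (\<phi> t))) \<le> 2 * \<delta>"
  proof -
    have "norm (integral {c'..d'} (\<lambda>t. cis (\<phi> t))) \<le> 1 * (d' - c')"
      using ord by (intro integral_bound continuous_on_cis continuous_on_subset[OF cont]) auto
    then show ?thesis by (auto simp: c'_def d'_def)
  qed
  have "integral {c..d} (\<lambda>t. cis (\<phi> t)) = integral {c..c'} (\<lambda>t. cis (\<phi> t)) + integral {c'..d'} (\<lambda>t. cis (\<phi> t)) + integral {d'..d} (\<lambda>t. cis (\<phi> t))"
  proof -
    have "integral {c..c'} (\<lambda>t. cis (\<phi> t)) + integral {c'..d'} (\<lambda>t. cis (\<phi> t)) = integral {c..d'} (\<lambda>t. cis (\<phi> t))"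
      using ord by (intro Henstock_Kurzweil_Integration.integral_combine int) auto
    moreover have "integral {c..d'} (\<lambda>t. cis (\<phi> t)) + integral {d'..d} (\<lambda>t. cis (\<phi> t)) = integral {c..d} (\<lambda>t. cis (\<phi> t))"
      using ord by (intro Henstock_Kurzweil_Integration.integral_combine int) auto
    ultimately show ?thesis by simp
  qed
  then show ?thesis using 1 2 3 norm_triangle_ineq
    by (smt (verit))
qed

text \<open>
  Here \<open>g j\<close> arises from the derivative of \<open>\<phi>\<close> by the operators \<open>d/dt - \<mu> i\<close> with \<open>i < j\<close>. The usual
  induction of van der Corput goes through, since \<open>t \<mapsto> exp (- \<mu> j * t) * g j t\<close> has derivative
  \<open>exp (- \<mu> j * t) * g (Suc j) t\<close> and \<open>W\<close> bounds the variation of the exponential factors.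
\<close>

lemma oscillatory_bound:
  fixes \<phi> :: "real \<Rightarrow> real" and g :: "nat \<Rightarrow> real \<Rightarrow> real"
  assumes \<phi>: "\<And>t. (\<phi> has_real_derivative g 0 t) (at t)"
    and g: "\<And>j t. (g j has_real_derivative g (Suc j) t + \<mu> j * g j t) (at t)"
    and \<mu>: "\<And>j. 0 \<le> \<mu> j" "\<And>j. exp (\<mu> j * (b - a)) \<le> W"
  shows "a \<le> c \<Longrightarrow> c \<le> d \<Longrightarrow> d \<le> b \<Longrightarrow> \<kappa> > 0 \<Longrightarrow> (\<And>t. t \<in> {c..d} \<Longrightarrow> \<kappa> \<le> \<bar>g (Suc p) t\<bar>) \<Longrightarrow>
    norm (integral {c..d} (\<lambda>t. cis (\<phi> t))) \<le> (6 * W) ^ (p + 2) * \<kappa> powr (- 1 / real (p + 2))"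
proof (induction p arbitrary: c d \<kappa>)
  case 0
  have mono: "exp (\<mu> j * (y - x)) \<le> W" if "a \<le> x" "y \<le> b" for j x y
    using \<mu>(1)[of j] that by (intro order_trans[OF _ \<mu>(2)[of j]]) (auto intro!: mult_left_mono)
  have "1 \<le> exp (\<mu> 0 * (b - a))" using \<mu>(1) 0 by auto
  then have W: "W \<ge> 1" using \<mu>(2)[of 0] by linarith
  \<comment> \<open>This \<delta> balances the outer intervals, which contribute a multiple of
    \<open>1 / (\<kappa> * \<delta>)\<close>, against the inner one of length
    \<open>2 * \<delta>\<close>.\<close>
  define \<delta> where "\<delta> = \<kappa> powr (- 1 / 2)"
  have \<delta>: "\<delta> > 0" using 0 by (simp add: \<delta>_def)
  have contg1: "continuous_on A (g (Suc 0))" for A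
    by (intro continuous_at_imp_continuous_on ballI DERIV_isCont[OF g])
  have "\<exists>\<sigma>. \<bar>\<sigma>\<bar> = 1 \<and> (\<forall>t \<in> {c..d}. \<bar>g (Suc 0) t\<bar> = \<sigma> * g (Suc 0) t)"
  proof (rule ccontr)
    assume *: "\<not> ?thesis"
    have nz: "g (Suc 0) t \<noteq> 0" if "t \<in> {c..d}" for t using 0(5)[OF that] 0(4) by auto
    from * have "\<not> (\<forall>t \<in> {c..d}. \<bar>g (Suc 0) t\<bar> = 1 * g (Suc 0) t)" "\<not> (\<forall>t \<in> {c..d}. \<bar>g (Suc 0) t\<bar> = -1 * g (Suc 0) t)"
      by (metis abs_1, metis abs_1 abs_minus_cancel)
    then obtain s t where st: "s \<in> {c..d}" "t \<in> {c..d}" "g (Suc 0) s < 0" "g (Suc 0) t > 0"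
      by (auto simp: abs_if split: if_splits)
    have "connected (g (Suc 0) ` {c..d})" by (intro connected_continuous_image contg1) auto
    then have "0 \<in> g (Suc 0) ` {c..d}"
      using st by (auto intro: connectedD_interval[of "g (Suc 0) ` {c..d}" "g (Suc 0) s" "g (Suc 0) t"] less_imp_le)
    then show False using nz by auto
  qed
  then obtain \<sigma> where \<sigma>: "\<bar>\<sigma>\<bar> = 1" "\<And>t. t \<in> {c..d} \<Longrightarrow> \<bar>g (Suc 0) t\<bar> = \<sigma> * g (Suc 0) t" by auto
  have "norm (integral {c..d} (\<lambda>t. cis (\<phi> t))) \<le> 2 * (4 * W / (\<kappa> * \<delta> / (2 * W))) + 2 * \<delta>"
  proof (rule oscillatory_split[where g = "g 0" and ?g1.0 = "g (Suc 0)" and \<mu> = "\<mu> 0" and \<kappa> = \<kappa> and W = W])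
    show "continuous_on {c..d} \<phi>"
      by (intro continuous_at_imp_continuous_on ballI DERIV_isCont[OF \<phi>])
    fix c' d' assume *: "c \<le> c'" "c' \<le> d'" "d' \<le> d" "\<And>t. t \<in> {c'..d'} \<Longrightarrow> \<kappa> * \<delta> / (2 * W) \<le> \<bar>g 0 t\<bar>"
    show "norm (integral {c'..d'} (\<lambda>t. cis (\<phi> t))) \<le> 4 * W / (\<kappa> * \<delta> / (2 * W))"
      using * 0 W \<delta> \<sigma>
      by (intro van_der_corput_base[where g = "g 0" and ?g1.0 = "g (Suc 0)" and \<mu> = "\<mu> 0" and \<sigma> = \<sigma>] \<phi> g \<mu>(1) mono) auto
  qed (use 0 \<delta> W in \<open>auto intro: g \<mu> mono\<close>)
  also have "2 * (4 * W / (\<kappa> * \<delta> / (2 * W))) + 2 * \<delta> = (16 * W\<^sup>2 + 2) * \<delta>"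
  proof -
    have "\<kappa> * \<delta> * \<delta> = 1"
      using 0 powr_add[of \<kappa> "-1/2" "-1/2"] by (simp add: \<delta>_def mult.assoc powr_minus field_simps)
    then have "1 / (\<kappa> * \<delta>) = \<delta>" using 0 \<delta> by (simp add: field_simps)
    moreover have "4 * W / (\<kappa> * \<delta> / (2 * W)) = 8 * W\<^sup>2 * (1 / (\<kappa> * \<delta>))"
      using W by (simp add: power2_eq_square)
    ultimately have "4 * W / (\<kappa> * \<delta> / (2 * W)) = 8 * W\<^sup>2 * \<delta>" by simp
    then show ?thesis by (simp add: algebra_simps)
  qed
  also have "\<dots> \<le> (6 * W) ^ 2 * \<delta>"
  proof (intro mult_right_mono)
    have "1 \<le> W\<^sup>2" using W by simp
    then show "16 * W\<^sup>2 + 2 \<le> (6 * W) ^ 2" by (simp add: power_mult_distrib)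
  qed (use \<delta> in auto)
  finally show ?case by (simp add: \<delta>_def power2_eq_square)
next
  case (Suc p)
  have mono: "exp (\<mu> j * (y - x)) \<le> W" if "a \<le> x" "y \<le> b" for j x y
    using \<mu>(1)[of j] that by (intro order_trans[OF _ \<mu>(2)[of j]]) (auto intro!: mult_left_mono)
  have "1 \<le> exp (\<mu> 0 * (b - a))" using \<mu>(1) Suc.prems by auto
  then have W: "W \<ge> 1" using \<mu>(2)[of 0] by linarith
  \<comment> \<open>Chosen so that
    \<open>(\<kappa> * \<delta>) powr (- 1 / (p + 2)) = \<delta>\<close>: the outer intervals and
    the inner one again have the same order.\<close>
  define \<delta> where "\<delta> = \<kappa> powr (- 1 / real (Suc p + 2))"
  have \<delta>: "\<delta> > 0" using Suc.prems by (simp add: \<delta>_def)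
  let ?B = "(6 * W) ^ (p + 2) * (\<kappa> * \<delta> / (2 * W)) powr (- 1 / real (p + 2))"
  have "norm (integral {c..d} (\<lambda>t. cis (\<phi> t))) \<le> 2 * ?B + 2 * \<delta>"
  proof (rule oscillatory_split[where g = "g (Suc p)" and ?g1.0 = "g (Suc (Suc p))" and \<mu> = "\<mu> (Suc p)" and \<kappa> = \<kappa> and W = W])
    show "continuous_on {c..d} \<phi>"
      by (intro continuous_at_imp_continuous_on ballI DERIV_isCont[OF \<phi>])
    fix c' d' assume *: "c \<le> c'" "c' \<le> d'" "d' \<le> d" "\<And>t. t \<in> {c'..d'} \<Longrightarrow> \<kappa> * \<delta> / (2 * W) \<le> \<bar>g (Suc p) t\<bar>"
    show "norm (integral {c'..d'} (\<lambda>t. cis (\<phi> t))) \<le> ?B"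
      using * Suc.prems W \<delta> by (intro Suc.IH) auto
  qed (use Suc.prems \<delta> W in \<open>auto intro: g \<mu> mono\<close>)
  also have "(\<kappa> * \<delta> / (2 * W)) powr (- 1 / real (p + 2)) \<le> 2 * W * \<delta>"
  proof -
    have "\<kappa> * \<delta> = \<kappa> powr (real (p + 2) / real (p + 3))"
      using Suc.prems powr_add[of \<kappa> 1 "- 1 / real (Suc p + 2)"]
      by (simp add: \<delta>_def add_divide_distrib[symmetric] field_simps)
    then have "(\<kappa> * \<delta>) powr (- 1 / real (p + 2)) = \<delta>"
      by (simp add: powr_powr \<delta>_def field_simps add_ac)
    moreover have "(1 / (2 * W)) powr (- 1 / real (p + 2)) \<le> 2 * W"
    proof -
      have "(1 / (2 * W)) powr (- 1 / real (p + 2)) = (2 * W) powr (1 / real (p + 2))"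
        using W by (simp add: powr_divide powr_minus_divide)
      also have "\<dots> \<le> (2 * W) powr 1" using W by (intro powr_mono) auto
      finally show ?thesis using W by simp
    qed
    ultimately have "(\<kappa> * \<delta>) powr (- 1 / real (p + 2)) * (1 / (2 * W)) powr (- 1 / real (p + 2)) \<le> \<delta> * (2 * W)"
      using \<delta> by simp
    then show ?thesis using Suc.prems \<delta> W by (subst (asm) powr_mult[symmetric]) (auto simp: mult_ac)
  qed
  also have "2 * ((6 * W) ^ (p + 2) * (2 * W * \<delta>)) + 2 * \<delta> = (4 * W * (6 * W) ^ (p + 2) + 2) * \<delta>"
    by (simp add: algebra_simps)
  also have "\<dots> \<le> (6 * W) ^ (Suc p + 2) * \<delta>"
  proof (intro mult_right_mono)
    have "1 * 1 \<le> W * (6 * W) ^ (p + 2)" using W by (intro mult_mono one_le_power) auto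
    then show "4 * W * (6 * W) ^ (p + 2) + 2 \<le> (6 * W) ^ (Suc p + 2)" by (simp add: algebra_simps)
  qed (use \<delta> in auto)
  finally show ?case using W by (simp add: \<delta>_def mult_left_mono)
qed

lemma ln_diff_lower:
  assumes "0 < p" "p \<le> (q::nat)"
  shows "(real q - real p) / real q \<le> ln (real q) - ln (real p)"
proof -
  have "ln (real p / real q) \<le> real p / real q - 1" using assms by (intro ln_le_minus_one) auto
  then show ?thesis using assms by (simp add: ln_div field_simps)
qed

text \<open>Each \<open>p\<close> in \<open>P\<close> other than \<open>q\<close> has its own
  annihilating operator, so after all of them only the term of \<open>q\<close> is left, of size at
  least \<kappa>; this takes \<open>card P\<close> derivatives in all. The exponent
  \<open>1 / m\<close> in place of \<open>1 / card P\<close> makes the bound uniform over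
  configurations in which some positions coincide.\<close>

lemma power_sum_integral_bound:
  fixes z :: "nat \<Rightarrow> int" and P :: "nat set"
  assumes P: "finite P" "P \<subseteq> {1..N}" "2 \<le> card P" "card P \<le> m"
    and q: "q \<in> P" "\<And>p. p \<in> P \<Longrightarrow> p \<le> q" "z q \<noteq> 0"
    and ab: "0 \<le> a" "a \<le> b" "b - a \<le> 1"
  shows "norm (integral {a..b} (\<lambda>\<alpha>. cis (2 * pi * (\<Sum>p\<in>P. real_of_int (z p) * real p powr \<alpha>))))
    \<le> (6 * real N powr (b - a)) ^ m *
      (\<bar>real_of_int (z q)\<bar> * real q powr a * (\<Prod>p\<in>P - {q}. (real q - real p) / real q)) powr (- 1 / real m)"
proof -
  define W where "W = real N powr (b - a)"
  define \<kappa> where "\<kappa> = \<bar>real_of_int (z q)\<bar> * real q powr a * (\<Prod>p\<in>P - {q}. (real q - real p) / real q)"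
  have N: "N \<ge> 1" using q(1) P(2) by auto
  have W: "W \<ge> 1" using N ab by (auto simp: W_def ge_one_powr_ge_zero)
  have Ppos: "0 < p" "p \<le> N" if "p \<in> P" for p using that P(2) by auto
  have Plt: "p < q" if "p \<in> P - {q}" for p using that q(2)[of p] by auto
  obtain p' where "p' \<in> P" "p' \<noteq> q"
    using P(1,3) q(1) by (metis One_nat_def Suc_1 card_le_Suc0_iff_eq not_less_eq_eq)
  then have q2: "q \<ge> 2" using Plt[of p'] Ppos[of p'] by auto
  have qpos: "0 < real q" using q2 by simp
  have \<kappa>: "\<kappa> > 0"
    unfolding \<kappa>_def using qpos q(3) Plt by (intro mult_pos_pos prod_pos) auto
  define n where "n = card (P - {q})"
  have n: "card P = Suc n" using card_Suc_Diff1[OF P(1) q(1)] by (simp add: n_def)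
  obtain h where h: "bij_betw h {0..<n} (P - {q})"
    using ex_bij_betw_nat_finite[of "P - {q}"] P(1) by (auto simp: n_def)
  \<comment> \<open>\<open>h\<close> enumerates the positions other than \<open>q\<close>. The value
    0 from \<open>n\<close> on keeps \<open>0 \<le> \<mu> j\<close> and the bound by
    \<open>W\<close> true for every \<open>j\<close>.\<close>
  define \<mu> where "\<mu> = (\<lambda>j. if j < n then ln (real (h j)) else 0)"
  \<comment> \<open>On \<open>exp (t * ln p)\<close> the operator with parameter
    \<open>\<mu> i\<close> acts as multiplication by \<open>ln p - \<mu> i\<close>; the first factor
    \<open>ln p\<close> comes from differentiating the phase itself.\<close>
  define g where "g = (\<lambda>j t. \<Sum>p\<in>P. 2 * pi * z p * ln p * (\<Prod>i<j. ln p - \<mu> i) * exp (t * ln (real p)))"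
  define \<phi> where "\<phi> = (\<lambda>t. \<Sum>p\<in>P. 2 * pi * z p * exp (t * ln (real p)))"
  have d1: "(\<phi> has_real_derivative g 0 t) (at t)" for t
    unfolding \<phi>_def g_def by (rule DERIV_sum) (auto intro!: derivative_eq_intros)
  have d2: "(g j has_real_derivative g (Suc j) t + \<mu> j * g j t) (at t)" for j t
  proof -
    have "((\<lambda>t. \<Sum>p\<in>P. 2 * pi * z p * ln p * (\<Prod>i<j. ln p - \<mu> i) * exp (t * ln (real p))) has_real_derivative
       (\<Sum>p\<in>P. 2 * pi * z p * ln p * (\<Prod>i<j. ln p - \<mu> i) * (exp (t * ln (real p)) * ln (real p)))) (at t)"
      by (rule DERIV_sum) (auto intro!: derivative_eq_intros)
    also have "(\<Sum>p\<in>P. 2 * pi * z p * ln p * (\<Prod>i<j. ln p - \<mu> i) * (exp (t * ln (real p)) * ln (real p))) = g (Suc j) t + \<mu> j * g j t"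
      unfolding g_def sum_distrib_left sum.distrib[symmetric] by (intro sum.cong) (auto simp: algebra_simps)
    finally show ?thesis by (simp add: g_def)
  qed
  have hP: "h j \<in> P" if "j < n" for j using h that by (auto dest: bij_betwE)
  have \<mu>0: "0 \<le> \<mu> j" for j using hP[of j] Ppos[of "h j"] by (auto simp: \<mu>_def)
  have \<mu>W: "exp (\<mu> j * (b - a)) \<le> W" for j
  proof (cases "j < n")
    case True
    then have "exp (\<mu> j * (b - a)) = real (h j) powr (b - a)" using Ppos[OF hP[OF True]] by (simp add: \<mu>_def powr_def mult.commute)
    also have "\<dots> \<le> W" unfolding W_def using Ppos[OF hP[OF True]] ab by (intro powr_mono2) auto
    finally show ?thesis .
  qed (use W in \<open>simp add: \<mu>_def\<close>)
  have prodn: "(\<Prod>i<n. ln (real p) - \<mu> i) = (\<Prod>r\<in>P - {q}. ln (real p) - ln (real r))" for p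
  proof -
    have "(\<Prod>r\<in>P - {q}. ln (real p) - ln (real r)) = (\<Prod>i\<in>{0..<n}. ln (real p) - ln (real (h i)))"
      by (rule prod.reindex_bij_betw[OF h, symmetric])
    also have "\<dots> = (\<Prod>i<n. ln (real p) - \<mu> i)" by (intro prod.cong) (auto simp: \<mu>_def)
    finally show ?thesis by simp
  qed
  have gn: "g n t = 2 * pi * z q * ln q * (\<Prod>r\<in>P - {q}. ln (real q) - ln (real r)) * exp (t * ln (real q))" for t
  proof -
    have "g n t = (\<Sum>p\<in>P. if p = q then 2 * pi * z q * ln q * (\<Prod>r\<in>P - {q}. ln (real q) - ln (real r)) * exp (t * ln (real q)) else 0)"
      unfolding g_def
    proof (intro sum.cong refl)
      fix p assume p: "p \<in> P"
      have "(\<Prod>r\<in>P - {q}. ln (real p) - ln (real r)) = 0" if "p \<noteq> q"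
        using p that P(1) by (intro prod_zero) auto
      then show "2 * pi * z p * ln p * (\<Prod>i<n. ln p - \<mu> i) * exp (t * ln (real p)) =
        (if p = q then 2 * pi * z q * ln q * (\<Prod>r\<in>P - {q}. ln (real q) - ln (real r)) * exp (t * ln (real q)) else 0)"
        unfolding prodn by auto
    qed
    then show ?thesis using P(1) q(1) by simp
  qed
  have low: "\<kappa> \<le> \<bar>g n t\<bar>" if "t \<in> {a..b}" for t
  proof -
    have A: "(\<Prod>p\<in>P - {q}. (real q - real p) / real q) \<le> (\<Prod>r\<in>P - {q}. ln (real q) - ln (real r))"
      using Plt Ppos by (intro prod_mono) (auto intro!: ln_diff_lower divide_nonneg_pos simp: less_imp_le)
    have A0: "0 \<le> (\<Prod>p\<in>P - {q}. (real q - real p) / real q)"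
      using Plt by (intro prod_nonneg) (auto simp: less_imp_le)
    \<comment> \<open>The factor \<open>2 * pi * ln q\<close> is at least 1, because
      \<open>P\<close> has a second element below \<open>q\<close> and this forces
      \<open>q \<ge> 2\<close>. It can therefore be left out of \<kappa>.\<close>
    have "1 / 2 \<le> ln (2::real)" using ln_diff_lower[of 1 2] by simp
    also have "\<dots> \<le> ln (real q)" using q2 by simp
    finally have L: "1 / 2 \<le> ln (real q)" .
    have "1 * 1 \<le> (2 * pi) * ln (real q)"
    proof -
      have "2 * (1/2) \<le> (2 * pi) * ln (real q)" using L pi_gt3 by (intro mult_mono) auto
      then show ?thesis by simp
    qed
    then have B: "1 \<le> 2 * pi * ln (real q)" by simp
    have C: "real q powr a \<le> exp (t * ln (real q))"
      using that q2 by (simp add: powr_def mult_right_mono)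
    have "\<kappa> \<le> \<bar>real_of_int (z q)\<bar> * exp (t * ln (real q)) * (\<Prod>r\<in>P - {q}. ln (real q) - ln (real r))"
      unfolding \<kappa>_def using A A0 C by (intro mult_mono) auto
    also have "\<dots> \<le> (2 * pi * ln (real q)) * (\<bar>real_of_int (z q)\<bar> * exp (t * ln (real q)) * (\<Prod>r\<in>P - {q}. ln (real q) - ln (real r)))"
      using mult_right_mono[OF B, of "\<bar>real_of_int (z q)\<bar> * exp (t * ln (real q)) * (\<Prod>r\<in>P - {q}. ln (real q) - ln (real r))"]
        order_trans[OF A0 A] by simp
    also have "\<dots> = \<bar>g n t\<bar>"
      using order_trans[OF A0 A] L unfolding gn by (simp add: abs_mult del: ln_ge_iff)
    finally show ?thesis .
  qed
  have \<phi>eq: "2 * pi * (\<Sum>p\<in>P. real_of_int (z p) * real p powr t) = \<phi> t" for t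
    unfolding \<phi>_def sum_distrib_left using Ppos by (intro sum.cong refl) (auto simp: powr_def)
  have n1: "n \<ge> 1" using n P(3) by simp
  have main: "norm (integral {a..b} (\<lambda>t. cis (\<phi> t))) \<le> (6 * W) ^ (n + 1) * \<kappa> powr (- 1 / real (n + 1))"
    using oscillatory_bound[of \<phi> g \<mu> b a W a b \<kappa> "n - 1", OF d1 d2 \<mu>0 \<mu>W] low \<kappa> ab n1 by simp
  have W1: "1 \<le> (6 * W) ^ m" using W by (intro one_le_power) auto
  have "norm (integral {a..b} (\<lambda>t. cis (\<phi> t))) \<le> (6 * W) ^ m * \<kappa> powr (- 1 / real m)"
  \<comment> \<open>For \<open>\<kappa> \<ge> 1\<close>, lowering the exponent to
    \<open>1 / m\<close> only enlarges the bound. For \<open>\<kappa> < 1\<close> the claimed bound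
    is at least 1, and the trivial estimate by the length of the interval suffices.\<close>
  proof (cases "\<kappa> \<ge> 1")
    case True
    note main
    also have "(6 * W) ^ (n + 1) * \<kappa> powr (- 1 / real (n + 1)) \<le> (6 * W) ^ m * \<kappa> powr (- 1 / real m)"
      using True W n P(4) by (intro mult_mono power_increasing powr_mono) (auto simp: frac_le)
    finally show ?thesis .
  next
    case False
    have "norm (integral {a..b} (\<lambda>t. cis (\<phi> t))) \<le> 1 * (b - a)"
      using ab by (intro integral_bound continuous_on_cis continuous_at_imp_continuous_on ballI DERIV_isCont[OF d1]) auto
    also have "\<dots> \<le> 1 * 1" using ab by simp
    also have "1 * 1 \<le> (6 * W) ^ m * \<kappa> powr (- 1 / real m)"
    proof (intro mult_mono W1)
      have "1 powr (- 1 / real m) \<le> \<kappa> powr (- 1 / real m)" using False \<kappa> by (intro powr_mono2') auto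
      then show "1 \<le> \<kappa> powr (- 1 / real m)" by simp
    qed (use W1 in auto)
    finally show ?thesis by simp
  qed
  then show ?thesis unfolding \<phi>eq W_def \<kappa>_def .
qed

subsection \<open>Counting pairs of tuples and frequencies\<close>

lemma sum_inverse_sqrt_le: "(\<Sum>y=1..n. 1 / sqrt (real y)) \<le> 2 * sqrt (real n)"
proof (induction n)
  case (Suc n)
  have "2 * sqrt (real n) * sqrt (real (Suc n)) + 1 \<le> 2 * real (Suc n)"
  proof -
    have "0 \<le> (sqrt (real (Suc n)) - sqrt (real n))\<^sup>2" by simp
    then show ?thesis by (simp add: power2_diff algebra_simps)
  qed
  then have "2 * sqrt (real n) + 1 / sqrt (real (Suc n)) \<le> 2 * sqrt (real (Suc n))"
    by (simp add: field_simps)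
  then show ?case using Suc by simp
qed simp

text \<open>Splitting off \<open>y powr (1 / 2 - \<beta>)\<close>, which is largest at
  \<open>y = n\<close>, reduces everything to the exponent 1 / 2. This gives the constant 2 for all
  admissible \<beta> at once.\<close>

lemma sum_powr_neg_le:
  assumes "0 \<le> \<beta>" "\<beta> \<le> 1 / 2"
  shows "(\<Sum>y=1..n. real y powr (- \<beta>)) \<le> 2 * real n powr (1 - \<beta>)"
proof (cases "n = 0")
  case False
  have "(\<Sum>y=1..n. real y powr (- \<beta>)) \<le> (\<Sum>y=1..n. real n powr (1 / 2 - \<beta>) * (1 / sqrt (real y)))"
  proof (rule sum_mono)
    fix y assume y: "y \<in> {1..n}"
    have "real y powr (- \<beta>) = real y powr (1 / 2 - \<beta>) * real y powr (- (1 / 2))"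
      by (simp add: powr_add[symmetric])
    also have "\<dots> \<le> real n powr (1 / 2 - \<beta>) * real y powr (- (1 / 2))"
      using y assms by (intro mult_right_mono powr_mono2) auto
    also have "real y powr (- (1 / 2)) = 1 / sqrt (real y)"
      by (simp add: powr_minus powr_half_sqrt field_simps)
    finally show "real y powr (- \<beta>) \<le> real n powr (1 / 2 - \<beta>) * (1 / sqrt (real y))" .
  qed
  also have "\<dots> = real n powr (1 / 2 - \<beta>) * (\<Sum>y=1..n. 1 / sqrt (real y))"
    by (simp add: sum_distrib_left)
  also have "\<dots> \<le> real n powr (1 / 2 - \<beta>) * (2 * real n powr (1 / 2))"
    using sum_inverse_sqrt_le[of n] by (intro mult_left_mono) (auto simp: powr_half_sqrt)
  also have "\<dots> = 2 * real n powr (1 - \<beta>)"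
    using False by (simp add: powr_add[symmetric])
  finally show ?thesis .
qed simp

section \<open>Configurations whose phase vanishes identically\<close>

text \<open>The condition on the fibres of \<open>X\<close> makes the phase carried by these indices
  vanish identically in \<alpha>. \<open>E1\<close> and \<open>E2\<close> are parts of the two
  halves of the index set; by injectivity on each of them at most two indices share a position, one
  from each half.\<close>

definition cancelling :: "'i set \<Rightarrow> 'i set \<Rightarrow> nat \<Rightarrow> int \<Rightarrow> (('i \<Rightarrow> nat) \<times> ('i \<Rightarrow> int)) set" where
  "cancelling E1 E2 N M = {(X, U). X \<in> (E1 \<union> E2) \<rightarrow>\<^sub>E {1..N} \<and> U \<in> (E1 \<union> E2) \<rightarrow>\<^sub>E {-M..M} \<and>
     inj_on X E1 \<and> inj_on X E2 \<and> (\<forall>i\<in>E1 \<union> E2. (\<Sum>j\<in>{j \<in> E1 \<union> E2. X j = X i}. U j) = 0)}"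

lemma finite_cancelling:
  assumes "finite E1" "finite E2"
  shows "finite (cancelling E1 E2 N M)"
proof (rule finite_subset)
  show "cancelling E1 E2 N M \<subseteq> ((E1 \<union> E2) \<rightarrow>\<^sub>E {1..N}) \<times> ((E1 \<union> E2) \<rightarrow>\<^sub>E {-M..M})"
    by (auto simp: cancelling_def)
qed (use assms in \<open>auto intro!: finite_cartesian_product finite_PiE\<close>)

text \<open>
  One number per index is enough: an index without a partner of the same position has frequency
  \<open>0\<close>, and of two partners one carries the common position and the other the frequency.
\<close>

lemma card_cancelling:
  fixes E1 E2 :: "'i set" and G :: nat
  assumes fin: "finite E1" "finite E2" and disj: "E1 \<inter> E2 = {}"
    and G: "N \<le> G" "2 * M + 1 \<le> int G"
  shows "card (cancelling E1 E2 N M) \<le> ((card (E1 \<union> E2) + 1) * G) ^ card (E1 \<union> E2)"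
proof -
  define E where "E = E1 \<union> E2"
  have finE: "finite E" using fin by (simp add: E_def)
  define S where "S = (\<lambda>(X :: 'i \<Rightarrow> nat) i. {j \<in> E. j \<noteq> i \<and> X j = X i})"
  define pt where "pt = (\<lambda>(X :: 'i \<Rightarrow> nat) i. if S X i = {} then None else Some (SOME j. j \<in> S X i))"
  \<comment> \<open>Paired indices of \<open>E2\<close> store their frequency, shifted by
    \<open>M + 1\<close> into \<open>1, ..., 2 * M + 1\<close>; all others store their position. The
    missing positions are read off at the partner, the missing frequencies are 0 or the negative of
    the partner's, and \<open>pt\<close> says which case applies.\<close>
  define code where "code = (\<lambda>(X, U). \<lambda>i\<in>E. (pt X i, if i \<in> E1 \<or> pt X i = None then int (X i) else U i + M + 1))"
  define T where "T = E \<rightarrow>\<^sub>E (insert None (Some ` E)) \<times> {1..int G}"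
  have zero: "(\<Sum>j\<in>{j \<in> E. X j = X i}. U j) = 0" if "(X, U) \<in> cancelling E1 E2 N M" "i \<in> E" for X U i
    using that unfolding cancelling_def E_def by blast
  have ptNone: "U i = 0" if c: "(X, U) \<in> cancelling E1 E2 N M" and i: "i \<in> E" and n: "pt X i = None" for X U i
  proof -
    have "{j \<in> E. X j = X i} = {i}" using i n by (auto simp: pt_def S_def split: if_splits)
    then show ?thesis using zero[OF c i] by simp
  qed
  have ptSome: "j \<in> E \<and> X j = X i \<and> U i = - U j \<and> (i \<in> E1 \<longleftrightarrow> j \<notin> E1)"
    if c: "(X, U) \<in> cancelling E1 E2 N M" and i: "i \<in> E" and n: "pt X i = Some j" for X U i j
  proof -
    have "S X i \<noteq> {}" "j = (SOME j. j \<in> S X i)" using n by (auto simp: pt_def split: if_splits)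
    then have j: "j \<in> S X i" by (metis some_in_eq)
    have inj: "inj_on X E1" "inj_on X E2" using c by (auto simp: cancelling_def)
    \<comment> \<open>Two indices at one position lie in different halves, and a third would collide
      with one of them. So the fibre of \<open>i\<close> is \<open>{i, j}\<close> and the chosen
      partner is the only candidate.\<close>
    have x: "i \<in> E1 \<longleftrightarrow> j \<notin> E1"
      using j i inj by (auto simp: S_def E_def inj_on_def)
    have "l = i \<or> l = j" if "l \<in> E" "X l = X i" for l
      using inj_onD[OF inj(1), of l i] inj_onD[OF inj(2), of l i] inj_onD[OF inj(1), of l j] inj_onD[OF inj(2), of l j]
        that x j i by (auto simp: S_def E_def)
    then have "{l \<in> E. X l = X i} = {i, j}" using i j by (auto simp: S_def)
    then have "U i + U j = 0" using zero[OF c i] j by (auto simp: S_def)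
    then show ?thesis using j x by (auto simp: S_def)
  qed
  have "inj_on code (cancelling E1 E2 N M)"
  proof (rule inj_onI, clarify)
    fix X U X' U' assume c: "(X, U) \<in> cancelling E1 E2 N M" "(X', U') \<in> cancelling E1 E2 N M" and eq: "code (X, U) = code (X', U')"
    have 1: "pt X i = pt X' i" "(if i \<in> E1 \<or> pt X i = None then int (X i) else U i + M + 1) = (if i \<in> E1 \<or> pt X i = None then int (X' i) else U' i + M + 1)"
      if "i \<in> E" for i
      using fun_cong[OF eq, of i] that by (auto simp: code_def split: if_splits)
    have X1: "X i = X' i" if "i \<in> E1" for i using 1(2)[of i] that by (auto simp: E_def)
    have X: "X i = X' i" if i: "i \<in> E" for i
    proof (cases "i \<in> E1 \<or> pt X i = None")
      case True then show ?thesis using 1(2)[OF i] by auto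
    next
      case False
      then obtain j where j: "pt X i = Some j" by auto
      with ptSome[OF c(1) i j] ptSome[OF c(2) i] 1(1)[OF i] False X1[of j] show ?thesis by auto
    qed
    have U2: "U i = U' i" if i: "i \<in> E" "i \<notin> E1" for i
      using 1[OF i(1)] i ptNone[OF c(1) i(1)] ptNone[OF c(2) i(1)] by (auto split: if_splits)
    have U: "U i = U' i" if i: "i \<in> E" for i
    proof (cases "pt X i")
      case None then show ?thesis using ptNone[OF c(1) i] ptNone[OF c(2) i] 1[OF i] by auto
    next
      case (Some j)
      with ptSome[OF c(1) i Some] ptSome[OF c(2) i, of j] 1(1)[OF i] U2[of j] U2[of i] i show ?thesis by auto
    qed
    have "X = X'" by (rule PiE_ext[of _ E "\<lambda>_. {1..N}"]) (use c X in \<open>auto simp: cancelling_def E_def\<close>)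
    moreover have "U = U'" by (rule PiE_ext[of _ E "\<lambda>_. {-M..M}"]) (use c U in \<open>auto simp: cancelling_def E_def\<close>)
    ultimately show "X = X' \<and> U = U'" by simp
  qed
  moreover have "code ` cancelling E1 E2 N M \<subseteq> T"
  proof clarify
    fix X U assume c: "(X, U) \<in> cancelling E1 E2 N M"
    have "(pt X i, if i \<in> E1 \<or> pt X i = None then int (X i) else U i + M + 1) \<in> insert None (Some ` E) \<times> {1..int G}" if i: "i \<in> E" for i
    proof -
      have "X i \<in> {1..N}" "U i \<in> {-M..M}" using c i by (auto simp: cancelling_def E_def)
      moreover have "pt X i \<in> insert None (Some ` E)" using ptSome[OF c i] by (cases "pt X i") auto
      ultimately show ?thesis using G by auto
    qed
    then show "code (X, U) \<in> T" by (auto simp: code_def T_def)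
  qed
  moreover have "finite T" unfolding T_def using finE by (intro finite_PiE) auto
  ultimately have "card (cancelling E1 E2 N M) \<le> card T" by (rule card_inj_on_le)
  also have "card T = ((card E + 1) * G) ^ card E"
    using finE by (simp add: T_def card_PiE card_cartesian_product card_image)
  finally show ?thesis by (simp add: E_def)
qed

text \<open>
  A pair of tuples with frequencies is a pair of functions on the disjoint union of two copies
  \<open>I1\<close>, \<open>I2\<close> of the index set. The phase is \<open>\<Sum>\<^sub>i U\<^sub>i X\<^sub>i\<^sup>\<alpha> = \<Sum>\<^sub>p z\<^sub>p p\<^sup>\<alpha>\<close> with \<open>z = merged I X U\<close>.
\<close>

definition phase_data :: "'i set \<Rightarrow> 'i set \<Rightarrow> nat \<Rightarrow> int \<Rightarrow> (('i \<Rightarrow> nat) \<times> ('i \<Rightarrow> int)) set" where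
  "phase_data I1 I2 N M = {(X, U). X \<in> (I1 \<union> I2) \<rightarrow>\<^sub>E {1..N} \<and> U \<in> (I1 \<union> I2) \<rightarrow>\<^sub>E {-M..M} \<and>
     inj_on X I1 \<and> inj_on X I2 \<and> sum U I1 = 0 \<and> sum U I2 = 0 \<and> (\<exists>i\<in>I1. U i \<noteq> 0)}"

definition merged :: "'i set \<Rightarrow> ('i \<Rightarrow> nat) \<Rightarrow> ('i \<Rightarrow> int) \<Rightarrow> nat \<Rightarrow> int" where
  "merged I X U p = (\<Sum>i\<in>{i \<in> I. X i = p}. U i)"

lemma finite_phase_data:
  assumes "finite I1" "finite I2"
  shows "finite (phase_data I1 I2 N M)"
proof (rule finite_subset)
  show "phase_data I1 I2 N M \<subseteq> ((I1 \<union> I2) \<rightarrow>\<^sub>E {1..N}) \<times> ((I1 \<union> I2) \<rightarrow>\<^sub>E {-M..M})"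
    by (auto simp: phase_data_def)
qed (use assms in \<open>auto intro!: finite_cartesian_product finite_PiE\<close>)

text \<open>An index \<open>i\<close> of the first half with \<open>U i \<noteq> 0\<close> must
  share its position with some \<open>j\<close> of the second half, or its frequency would not
  cancel. Removing both leaves a cancelling configuration on \<open>m - 2\<close> indices, the
  common position costs one more factor \<open>G\<close>, and the two removed frequencies follow
  from the vanishing sums over the halves. The result is one power of \<open>G\<close> below the
  normalization, which makes the diagonal terms negligible.\<close>

lemma card_diagonal_phases:
  fixes I1 I2 :: "'i set" and G :: nat
  assumes fin: "finite I1" "finite I2" and disj: "I1 \<inter> I2 = {}"
    and G: "N \<le> G" "2 * M + 1 \<le> int G"
  defines "m \<equiv> card (I1 \<union> I2)"
  shows "card {(X, U) \<in> phase_data I1 I2 N M. \<forall>p. merged (I1 \<union> I2) X U p = 0} \<le> m\<^sup>2 * ((m + 1) ^ m * G ^ (m - 1))"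
    (is "card ?D \<le> _")
proof -
  define I where "I = I1 \<union> I2"
  have finI: "finite I" using fin by (simp add: I_def)
  define D where "D = (\<lambda>i j. {(X, U) \<in> phase_data I1 I2 N M. (\<forall>p. merged I X U p = 0) \<and> X j = X i})"
  have cover: "?D \<subseteq> (\<Union>(i, j)\<in>I1 \<times> I2. D i j)"
  proof clarify
    fix X U assume c: "(X, U) \<in> phase_data I1 I2 N M" and z: "\<forall>p. merged (I1 \<union> I2) X U p = 0"
    obtain i where i: "i \<in> I1" "U i \<noteq> 0" using c by (auto simp: phase_data_def)
    have "merged (I1 \<union> I2) X U (X i) = U i" if "\<not> (\<exists>j\<in>I2. X j = X i)"
    proof -
      have "{i' \<in> I1 \<union> I2. X i' = X i} = {i}" using c i that by (auto simp: phase_data_def inj_on_def)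
      then show ?thesis by (simp add: merged_def)
    qed
    then obtain j where "j \<in> I2" "X j = X i" using z i by auto
    then have "(i, j) \<in> I1 \<times> I2" "(X, U) \<in> D i j" using c z i by (auto simp: D_def I_def)
    then show "(X, U) \<in> (\<Union>(i, j)\<in>I1 \<times> I2. D i j)" by blast
  qed
  have cardD: "card (D i j) \<le> (m + 1) ^ m * G ^ (m - 1)" if ij: "i \<in> I1" "j \<in> I2" for i j
  proof -
    define f where "f = (\<lambda>(X :: 'i \<Rightarrow> nat, U :: 'i \<Rightarrow> int). ((restrict X (I - {i, j}), restrict U (I - {i, j})), X i))"
    define C where "C = cancelling (I1 - {i}) (I2 - {j}) N M"
    have un: "(I1 - {i}) \<union> (I2 - {j}) = I - {i, j}" using disj ij by (auto simp: I_def)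
    have "inj_on f (D i j)"
    proof (rule inj_onI, clarify)
      fix X U X' U' assume c: "(X, U) \<in> D i j" "(X', U') \<in> D i j" and eq: "f (X, U) = f (X', U')"
      from eq have e: "restrict X (I - {i, j}) = restrict X' (I - {i, j})"
        "restrict U (I - {i, j}) = restrict U' (I - {i, j})" "X i = X' i" by (simp_all add: f_def)
      have X0: "X l = X' l" "U l = U' l" if "l \<in> I - {i, j}" for l
        using fun_cong[OF e(1), of l] fun_cong[OF e(2), of l] that by auto
      have "X j = X' j" using c e(3) by (auto simp: D_def)
      then have X: "X l = X' l" if "l \<in> I" for l using X0(1)[of l] that e(3) by auto
      have "U i = - sum U (I1 - {i})" "U' i = - sum U' (I1 - {i})" "U j = - sum U (I2 - {j})" "U' j = - sum U' (I2 - {j})"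
        using c fin ij sum.remove[of I1 i U] sum.remove[of I1 i U'] sum.remove[of I2 j U] sum.remove[of I2 j U']
        by (auto simp: D_def phase_data_def)
      moreover have "sum U (I1 - {i}) = sum U' (I1 - {i})" "sum U (I2 - {j}) = sum U' (I2 - {j})"
        using disj ij by (auto intro!: sum.cong X0(2) simp: I_def)
      ultimately have "U i = U' i" "U j = U' j" by auto
      then have U: "U l = U' l" if "l \<in> I" for l using X0(2)[of l] that by auto
      have "X = X'" by (rule PiE_ext[of _ I "\<lambda>_. {1..N}"]) (use c X in \<open>auto simp: D_def phase_data_def I_def\<close>)
      moreover have "U = U'" by (rule PiE_ext[of _ I "\<lambda>_. {-M..M}"]) (use c U in \<open>auto simp: D_def phase_data_def I_def\<close>)
      ultimately show "X = X' \<and> U = U'" by simp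
    qed
    moreover have "f ` D i j \<subseteq> C \<times> {1..N}"
    proof (rule image_subsetI)
      fix XU assume "XU \<in> D i j"
      then obtain X U where XU: "XU = (X, U)" and c: "(X, U) \<in> D i j" by (cases XU) auto
      have Xr: "X l \<in> {1..N}" "U l \<in> {-M..M}" if "l \<in> I" for l using c that by (auto simp: D_def phase_data_def I_def)
      have inj: "inj_on X I1" "inj_on X I2" and Xij: "X j = X i" using c by (auto simp: D_def phase_data_def)
      have "(\<Sum>l'\<in>{l' \<in> I - {i, j}. restrict X (I - {i, j}) l' = restrict X (I - {i, j}) l}. restrict U (I - {i, j}) l') = 0"
        if l: "l \<in> I - {i, j}" for l
      proof -
        \<comment> \<open>No further index can sit at the common position of \<open>i\<close> and
          \<open>j\<close>, since it would collide within its own half. Hence deleting the pair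
          leaves all other fibres intact.\<close>
        have "X l \<noteq> X i" using l inj Xij ij unfolding I_def inj_on_def by (metis DiffE UnE insertI1 insertCI)
        then have "{l' \<in> I - {i, j}. restrict X (I - {i, j}) l' = restrict X (I - {i, j}) l} = {l' \<in> I. X l' = X l}"
          using l Xij by auto
        moreover have "(\<Sum>l'\<in>{l' \<in> I. X l' = X l}. restrict U (I - {i, j}) l') = (\<Sum>l'\<in>{l' \<in> I. X l' = X l}. U l')"
          using \<open>X l \<noteq> X i\<close> Xij by (intro sum.cong) auto
        moreover have "\<dots> = 0" using c by (auto simp: D_def merged_def)
        ultimately show ?thesis by simp
      qed
      then have "(restrict X (I - {i, j}), restrict U (I - {i, j})) \<in> C"
        unfolding C_def cancelling_def un using Xr inj disj ij
        by (auto simp: inj_on_def I_def)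
      moreover have "X i \<in> {1..N}" using Xr[of i] ij by (auto simp: I_def)
      ultimately show "f XU \<in> C \<times> {1..N}" by (simp add: f_def XU)
    qed
    ultimately have "card (D i j) \<le> card (C \<times> {1..N})"
      using fin by (intro card_inj_on_le) (auto simp: C_def intro!: finite_cancelling)
    also have "\<dots> \<le> ((card (I - {i, j}) + 1) * G) ^ card (I - {i, j}) * G"
      using card_cancelling[of "I1 - {i}" "I2 - {j}" N G M] fin disj G
      unfolding un by (auto simp: card_cartesian_product C_def intro!: mult_mono)
    also have "card (I - {i, j}) = m - 2" 
    proof -
      have "i \<noteq> j" using ij disj by auto
      then show ?thesis using ij by (subst card_Diff_subset) (auto simp: I_def m_def)
    qed
    also have "((m - 2 + 1) * G) ^ (m - 2) * G \<le> ((m + 1) ^ m) * G ^ (m - 1)"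
    proof -
      have "card {i, j} \<le> m" using ij fin unfolding m_def by (intro card_mono) auto
      moreover have "i \<noteq> j" using ij disj by auto
      ultimately have m2: "m \<ge> 2" by simp
      then have "G ^ (m - 2) * G = G ^ (m - 1)" by (metis Suc_1 Suc_diff_le diff_Suc_Suc diff_Suc_1' numeral_2_eq_2 power_Suc2)
      moreover have "(m - 2 + 1) ^ (m - 2) \<le> (m + 1) ^ (m - 2)" by (intro power_mono) auto
      moreover have "(m + 1) ^ (m - 2) \<le> (m + 1) ^ m" by (intro power_increasing) auto
      ultimately show ?thesis by (simp only: power_mult_distrib mult.assoc) (intro mult_mono, auto)
    qed
    finally show ?thesis .
  qed
  have "card ?D \<le> card (\<Union>(i, j)\<in>I1 \<times> I2. D i j)"
    using fin by (intro card_mono cover finite_UN_I) (auto simp: D_def intro: finite_subset[OF _ finite_phase_data])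
  also have "\<dots> \<le> (\<Sum>(i, j)\<in>I1 \<times> I2. card (D i j))"
    using card_UN_le[of "I1 \<times> I2" "\<lambda>(i, j). D i j"] fin by (simp add: case_prod_unfold)
  also have "\<dots> \<le> (\<Sum>(i, j)\<in>I1 \<times> I2. (m + 1) ^ m * G ^ (m - 1))"
    using cardD by (intro sum_mono) auto
  also have "\<dots> = (card I1 * card I2) * ((m + 1) ^ m * G ^ (m - 1))"
    using fin by (simp add: card_cartesian_product)
  also have "\<dots> \<le> m\<^sup>2 * ((m + 1) ^ m * G ^ (m - 1))"
    unfolding power2_eq_square m_def using fin by (intro mult_mono card_mono) auto
  finally show ?thesis .
qed

section \<open>Averaging the oscillatory bound over the off-diagonal configurations\<close>

lemma sum_shifted_powr_le:
  assumes \<beta>: "0 \<le> \<beta>" "\<beta> \<le> 1 / 2"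
  shows "(\<Sum>x\<in>{1..<q}. ((real q - real x) / real q) powr (- \<beta>)) \<le> 2 * real q"
proof (cases "q = 0")
  case False
  have "(\<Sum>x\<in>{1..<q}. ((real q - real x) / real q) powr (- \<beta>)) = (\<Sum>y\<in>{1..<q}. (real y / real q) powr (- \<beta>))"
    by (rule sum.reindex_bij_witness[of _ "\<lambda>y. q - y" "\<lambda>y. q - y"]) (auto simp: of_nat_diff)
  also have "\<dots> \<le> (\<Sum>y=1..q. (real y / real q) powr (- \<beta>))"
    by (intro sum_mono2) auto
  also have "\<dots> = (\<Sum>y=1..q. real y powr (- \<beta>)) * real q powr \<beta>"
    using False by (simp add: powr_divide powr_minus field_simps sum_distrib_left)
  also have "\<dots> \<le> (2 * real q powr (1 - \<beta>)) * real q powr \<beta>"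
    by (intro mult_right_mono sum_powr_neg_le \<beta>) auto
  also have "\<dots> = 2 * real q"
    using False by (simp add: powr_add[symmetric])
  finally show ?thesis .
qed simp

lemma sum_abs_int_powr_le:
  assumes \<beta>: "0 \<le> \<beta>" "\<beta> \<le> 1 / 2"
  shows "(\<Sum>\<zeta>\<in>{-int L..int L} - {0}. \<bar>real_of_int \<zeta>\<bar> powr (- \<beta>)) \<le> 4 * real L powr (1 - \<beta>)"
proof -
  have "{-int L..int L} - {0} = (\<lambda>y. int y) ` {1..L} \<union> (\<lambda>y. - int y) ` {1..L}"
  proof (intro equalityI subsetI)
    fix x assume x: "x \<in> {-int L..int L} - {0}"
    show "x \<in> (\<lambda>y. int y) ` {1..L} \<union> (\<lambda>y. - int y) ` {1..L}"
    proof (cases "x > 0")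
      case True then show ?thesis using x by (intro UnI1 image_eqI[of _ _ "nat x"]) auto
    next
      case False then show ?thesis using x by (intro UnI2 image_eqI[of _ _ "nat (- x)"]) auto
    qed
  qed auto
  moreover have "(\<Sum>\<zeta>\<in>(\<lambda>y. int y) ` {1..L}. \<bar>real_of_int \<zeta>\<bar> powr (- \<beta>)) = (\<Sum>y=1..L. real y powr (- \<beta>))"
    by (subst sum.reindex) (auto simp: inj_on_def)
  moreover have "(\<Sum>\<zeta>\<in>(\<lambda>y. - int y) ` {1..L}. \<bar>real_of_int \<zeta>\<bar> powr (- \<beta>)) = (\<Sum>y=1..L. real y powr (- \<beta>))"
    by (subst sum.reindex) (auto simp: inj_on_def)
  moreover have "(\<lambda>y. int y) ` {1..L} \<inter> (\<lambda>y. - int y) ` {1..L} = {}" by auto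
  ultimately show ?thesis using sum_powr_neg_le[OF \<beta>, of L] by (simp add: sum.union_disjoint)
qed

text \<open>The oscillatory bound has one factor for each distinct position, whereas the sum over
  configurations factorizes over indices. Repeating a factor that is at least 1 is harmless.\<close>

lemma prod_image_le:
  fixes F :: "'b \<Rightarrow> real"
  assumes "finite B" and "\<And>i. i \<in> B \<Longrightarrow> 1 \<le> F (X i)"
  shows "(\<Prod>p\<in>X ` B. F p) \<le> (\<Prod>i\<in>B. F (X i))"
proof -
  have "(\<Prod>p\<in>X ` B. F p) \<le> (\<Prod>p\<in>X ` B. \<Prod>i\<in>{i \<in> B. X i = p}. F (X i))"
  proof (rule prod_mono, safe)
    fix i assume i: "i \<in> B"
    have "F (X i) \<le> F (X i) ^ card {j \<in> B. X j = X i}"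
      using i assms by (intro self_le_power) (auto simp: card_gt_0_iff)
    also have "\<dots> = (\<Prod>j\<in>{j \<in> B. X j = X i}. F (X j))" by simp
    finally show "F (X i) \<le> (\<Prod>j\<in>{j \<in> B. X j = X i}. F (X j))" .
    show "0 \<le> F (X i)" using assms(2)[OF i] by simp
  qed
  also have "\<dots> = (\<Prod>i\<in>B. F (X i))" using assms(1) by (rule prod.image_gen[symmetric])
  finally show ?thesis .
qed

lemma sum_UN_le:
  fixes f :: "'b \<Rightarrow> real"
  assumes "finite S" "finite D" "S \<subseteq> (\<Union>d\<in>D. T d)" "\<And>d. d \<in> D \<Longrightarrow> finite (T d)"
    and "\<And>x. 0 \<le> f x"
  shows "sum f S \<le> (\<Sum>d\<in>D. sum f (T d))"
proof -
  have "sum f S \<le> sum f (\<Union>d\<in>D. T d)" using assms by (intro sum_mono2) auto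
  also have "\<dots> \<le> sum f (snd ` (SIGMA d:D. T d))" using assms by (intro sum_mono2) force+
  also have "\<dots> \<le> sum (f \<circ> snd) (SIGMA d:D. T d)"
    using assms by (intro sum_image_le) auto
  also have "\<dots> = (\<Sum>d\<in>D. sum f (T d))" using assms by (subst sum.Sigma) (auto simp: case_prod_unfold)
  finally show ?thesis .
qed

definition osc_int :: "'i set \<Rightarrow> real \<Rightarrow> real \<Rightarrow> ('i \<Rightarrow> nat) \<Rightarrow> ('i \<Rightarrow> int) \<Rightarrow> real" where
  "osc_int I a b X U = norm (integral {a..b} (\<lambda>\<alpha>. cis (2 * pi * (\<Sum>i\<in>I. real_of_int (U i) * real (X i) powr \<alpha>))))"

text \<open>After grouping the indices by position, only \<open>q\<close> and the positions of
  \<open>B\<close> survive, because the merged frequencies above \<open>q\<close> are 0. A nonempty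
  \<open>B\<close> supplies the second position that \<open>power_sum_integral_bound\<close> asks
  for, and \<open>card P \<le> card I\<close> allows the exponent \<open>1 / card I\<close>.\<close>

lemma osc_int_le:
  fixes I :: "'i set"
  assumes finI: "finite I" and X: "\<And>i. i \<in> I \<Longrightarrow> X i \<in> {1..N}" and q0: "q0 \<in> I" "X q0 = q"
    and B: "B = {i \<in> I. X i < q}" "B \<noteq> {}"
    and \<zeta>: "merged I X U q = \<zeta>" "\<zeta> \<noteq> 0" and top: "\<And>p. p > q \<Longrightarrow> merged I X U p = 0"
    and ab: "0 \<le> a" "a \<le> b" "b - a \<le> 1" and \<beta>: "\<beta> = 1 / real (card I)"
  shows "osc_int I a b X U \<le> (6 * real N powr (b - a)) ^ card I *
     (\<bar>real_of_int \<zeta>\<bar> powr (- \<beta>) * real q powr (- (a * \<beta>)) * (\<Prod>i\<in>B. ((real q - real (X i)) / real q) powr (- \<beta>)))"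
proof -
  define P where "P = insert q (X ` B)"
  have finB: "finite B" using finI B by auto
  have qP: "q \<notin> X ` B" using B by auto
  have qpos: "q > 0" using X[OF q0(1)] q0 by auto
  have card2: "2 \<le> card P"
  proof -
    have "card P = Suc (card (X ` B))" using finB qP by (simp add: P_def)
    moreover have "card (X ` B) > 0" using finB B(2) by (simp add: card_gt_0_iff)
    ultimately show ?thesis by simp
  qed
  have cardm: "card P \<le> card I"
  proof -
    have "P \<subseteq> X ` I" using q0 B by (auto simp: P_def)
    then have "card P \<le> card (X ` I)" using finI by (intro card_mono) auto
    also have "\<dots> \<le> card I" using finI by (rule card_image_le)
    finally show ?thesis .
  qed
  have eq: "(\<Sum>i\<in>I. real_of_int (U i) * real (X i) powr \<alpha>) = (\<Sum>p\<in>P. real_of_int (merged I X U p) * real p powr \<alpha>)" for \<alpha>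
  proof -
    have "(\<Sum>i\<in>I. real_of_int (U i) * real (X i) powr \<alpha>) =
       (\<Sum>p\<in>X ` I. \<Sum>i\<in>{i \<in> I. X i = p}. real_of_int (U i) * real (X i) powr \<alpha>)"
      using finI by (rule sum.image_gen)
    also have "\<dots> = (\<Sum>p\<in>X ` I. real_of_int (merged I X U p) * real p powr \<alpha>)"
      by (auto intro!: sum.cong simp: merged_def sum_distrib_right)
    also have "\<dots> = (\<Sum>p\<in>P. real_of_int (merged I X U p) * real p powr \<alpha>)"
    proof (rule sum.mono_neutral_right)
      show "P \<subseteq> X ` I" using q0 B by (auto simp: P_def)
      show "\<forall>p\<in>X ` I - P. real_of_int (merged I X U p) * real p powr \<alpha> = 0"
      proof
        fix p assume "p \<in> X ` I - P"
        then obtain i where "i \<in> I" "p = X i" "p \<noteq> q" "i \<notin> B" by (auto simp: P_def)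
        then have "p > q" using B by auto
        then show "real_of_int (merged I X U p) * real p powr \<alpha> = 0" by (simp add: top)
      qed
    qed (use finI in auto)
    finally show ?thesis .
  qed
  have Pq: "P - {q} = X ` B" using qP by (auto simp: P_def)
  have "osc_int I a b X U \<le> (6 * real N powr (b - a)) ^ card I *
      (\<bar>real_of_int \<zeta>\<bar> * real q powr a * (\<Prod>p\<in>P - {q}. (real q - real p) / real q)) powr (- 1 / real (card I))"
    unfolding osc_int_def eq \<zeta>(1)[symmetric]
    by (rule power_sum_integral_bound) (use finB X B q0 card2 cardm \<zeta> ab in \<open>auto simp: P_def\<close>)
  also have "- 1 / real (card I) = - \<beta>" by (simp add: \<beta>)
  also have "(\<bar>real_of_int \<zeta>\<bar> * real q powr a * (\<Prod>p\<in>P - {q}. (real q - real p) / real q)) powr - \<beta> =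
     \<bar>real_of_int \<zeta>\<bar> powr (- \<beta>) * real q powr (- (a * \<beta>)) * (\<Prod>p\<in>X ` B. ((real q - real p) / real q) powr - \<beta>)"
    unfolding Pq using B by (simp add: powr_mult powr_powr prod_powr_distrib prod_nonneg)
  also have "\<dots> \<le> \<bar>real_of_int \<zeta>\<bar> powr (- \<beta>) * real q powr (- (a * \<beta>)) * (\<Prod>i\<in>B. ((real q - real (X i)) / real q) powr (- \<beta>))"
  proof (intro mult_left_mono prod_image_le finB)
    fix i assume i: "i \<in> B"
    have "1 powr - \<beta> \<le> ((real q - real (X i)) / real q) powr - \<beta>"
      using i B qpos by (intro powr_mono2') (auto simp: \<beta>)
    then show "1 \<le> ((real q - real (X i)) / real q) powr - \<beta>" by simp
  qed auto
  finally show ?thesis by (simp add: mult_left_mono)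
qed

text \<open>
  The index \<open>q0\<close> sits at the largest position \<open>q\<close> with nonzero merged frequency \<open>\<zeta>\<close>, and \<open>E\<close>, \<open>B\<close> are the
  indices above and below \<open>q\<close>. The frequencies above \<open>q\<close> cancel.
\<close>

definition level_class where
  "level_class I1 I2 N M E B q0 q \<zeta> = {(X, U) \<in> phase_data I1 I2 N M.
     q0 \<in> I1 \<union> I2 \<and> X q0 = q \<and> E = {i \<in> I1 \<union> I2. q < X i} \<and> B = {i \<in> I1 \<union> I2. X i < q} \<and> B \<noteq> {} \<and>
     merged (I1 \<union> I2) X U q = \<zeta> \<and> \<zeta> \<noteq> 0 \<and> (\<forall>p>q. merged (I1 \<union> I2) X U p = 0)}"

lemma level_class_iff:
  assumes "(X, U) \<in> level_class I1 I2 N M E B q0 q \<zeta>" "i \<in> I1 \<union> I2"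
  shows "i \<in> E \<longleftrightarrow> q < X i" "i \<in> B \<longleftrightarrow> X i < q"
  using assms by (auto simp: level_class_def)

text \<open>
  The set \<open>D\<close> contains at most one index of each half. The frequencies on \<open>D\<close> are determined by the
  others, because the frequencies on each half sum to \<open>0\<close>.
\<close>

lemma level_class_sum_le:
  fixes I1 I2 :: "'i set" and G :: nat
  assumes fin: "finite I1" "finite I2" and disj: "I1 \<inter> I2 = {}"
    and G: "N \<le> G" "2 * M + 1 \<le> int G" and M: "M \<ge> 0"
    and D: "D \<subseteq> B" "\<And>i j. i \<in> D \<Longrightarrow> j \<in> D \<Longrightarrow> (i \<in> I1 \<longleftrightarrow> j \<in> I1) \<Longrightarrow> i = j"
    and \<beta>: "0 \<le> \<beta>" "\<beta> \<le> 1 / 2"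
    and ne: "level_class I1 I2 N M E B q0 q \<zeta> \<noteq> {}"
  defines "m \<equiv> card (I1 \<union> I2)"
  shows "(\<Sum>(X, U)\<in>level_class I1 I2 N M E B q0 q \<zeta>. \<Prod>i\<in>B. ((real q - real (X i)) / real q) powr (- \<beta>))
     \<le> (2 * real q) ^ card B * (real (m + 1) ^ m * real G ^ (m - 1 - card D))"
proof -
  define I where "I = I1 \<union> I2"
  have finI: "finite I" using fin by (simp add: I_def)
  \<comment> \<open>The indices whose frequency has to be recorded separately: those of
    \<open>E\<close> are counted with the cancelling part, those of \<open>D\<close> and that of
    \<open>q0\<close> are determined by linear relations.\<close>
  define R where "R = I - E - D - {q0}"
  let ?S = "level_class I1 I2 N M E B q0 q \<zeta>"
  define w where "w = (\<lambda>X :: 'i \<Rightarrow> nat. \<Prod>i\<in>B. ((real q - real (X i)) / real q) powr (- \<beta>))"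
  have str: "q0 \<in> I" "q0 \<notin> B" "q0 \<notin> E" "B \<subseteq> I" "E \<subseteq> I" "B \<inter> E = {}"
    using ne by (auto simp: level_class_def I_def)
  have finBE: "finite B" "finite E" "finite R" using str finI by (auto simp: R_def intro: finite_subset)
  have finD: "finite D" using D(1) finBE(1) by (rule finite_subset)
  define C where "C = cancelling (E \<inter> I1) (E \<inter> I2) N M"
  have EI: "(E \<inter> I1) \<union> (E \<inter> I2) = E" using str by (auto simp: I_def)
  have finC: "finite C" unfolding C_def using fin by (intro finite_cancelling) auto
  define f where "f = (\<lambda>(X :: 'i \<Rightarrow> nat, U :: 'i \<Rightarrow> int). (restrict X B, restrict U R, restrict X E, restrict U E))"
  define T where "T = (B \<rightarrow>\<^sub>E {1..<q}) \<times> (R \<rightarrow>\<^sub>E {-M..M}) \<times> C"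
  have finT: "finite T" unfolding T_def using finBE finC by (intro finite_cartesian_product finite_PiE) auto
  have inj: "inj_on f ?S"
  proof (rule inj_onI, clarify)
    fix X U X' U' assume c: "(X, U) \<in> ?S" "(X', U') \<in> ?S" and eq: "f (X, U) = f (X', U')"
    from eq have e: "restrict X B = restrict X' B" "restrict U R = restrict U' R"
      "restrict X E = restrict X' E" "restrict U E = restrict U' E" by (simp_all add: f_def)
    have Xq: "X i = q" "X' i = q" if "i \<in> I" "i \<notin> B" "i \<notin> E" for i
      using level_class_iff[OF c(1), of i] level_class_iff[OF c(2), of i] that by (auto simp: I_def)
    have X: "X i = X' i" if "i \<in> I" for i
      using fun_cong[OF e(1), of i] fun_cong[OF e(3), of i] Xq[of i] that by (auto simp: restrict_def split: if_splits)
    have U0: "U i = U' i" if "i \<in> I" "i \<notin> D" "i \<noteq> q0" for i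
      using fun_cong[OF e(2), of i] fun_cong[OF e(4), of i] that by (auto simp: restrict_def R_def split: if_splits)
    \<comment> \<open>The frequency at \<open>q0\<close> is recovered from \<zeta> and the other
      indices at position \<open>q\<close>; since \<open>D\<close> lies in \<open>B\<close>, all of
      those are already known. Only afterwards are the frequencies on \<open>D\<close> recovered
      from the sums over the halves.\<close>
    have Uq0: "U q0 = U' q0"
    proof -
      define Q where "Q = I - B - E"
      have Q: "{i \<in> I1 \<union> I2. X i = q} = Q" "{i \<in> I1 \<union> I2. X' i = q} = Q"
        using level_class_iff[OF c(1)] level_class_iff[OF c(2)] by (fastforce simp: Q_def I_def)+
      have "merged (I1 \<union> I2) X U q = \<zeta>" "merged (I1 \<union> I2) X' U' q = \<zeta>" using c by (simp_all add: level_class_def)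
      then have "sum U Q = \<zeta>" "sum U' Q = \<zeta>" by (simp_all only: merged_def Q)
      moreover have "sum U (Q - {q0}) = sum U' (Q - {q0})"
        using D by (intro sum.cong U0) (auto simp: Q_def)
      moreover have "finite Q" "q0 \<in> Q" using finI str by (auto simp: Q_def)
      ultimately show ?thesis using sum.remove[of Q q0 U] sum.remove[of Q q0 U'] by auto
    qed
    have U1: "U i = U' i" if "i \<in> I" "i \<notin> D" for i using U0[of i] Uq0 that by auto
    have U2: "U i = U' i" if i: "i \<in> D" "i \<in> J" and J: "J = I1 \<or> J = I2" for i J
    proof -
      have s: "sum U J = 0" "sum U' J = 0" "finite J" "J \<subseteq> I" using c J fin by (auto simp: level_class_def phase_data_def I_def)
      have "sum U (J - {i}) = sum U' (J - {i})"
      proof (intro sum.cong U1 refl)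
        fix l assume l: "l \<in> J - {i}"
        then show "l \<in> I" using s by auto
        show "l \<notin> D"
        proof
          assume "l \<in> D"
          moreover have "i \<in> I1 \<longleftrightarrow> l \<in> I1" using l i J disj by auto
          ultimately show False using D(2)[of i l] l i by auto
        qed
      qed
      then show ?thesis using s i sum.remove[of J i U] sum.remove[of J i U'] by auto
    qed
    have U: "U i = U' i" if "i \<in> I" for i
      using U1[of i] U2[of i I1] U2[of i I2] that by (auto simp: I_def)
    have "X = X'" by (rule PiE_ext[of _ I "\<lambda>_. {1..N}"]) (use c X in \<open>auto simp: level_class_def phase_data_def I_def\<close>)
    moreover have "U = U'" by (rule PiE_ext[of _ I "\<lambda>_. {-M..M}"]) (use c U in \<open>auto simp: level_class_def phase_data_def I_def\<close>)
    ultimately show "X = X' \<and> U = U'" by simp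
  qed
  have img: "f ` ?S \<subseteq> T"
  proof (rule image_subsetI)
    fix XU assume "XU \<in> ?S"
    then obtain X U where XU: "XU = (X, U)" and c: "(X, U) \<in> ?S" by (cases XU) auto
    have cp: "(X, U) \<in> phase_data I1 I2 N M" and Eq: "E = {i \<in> I1 \<union> I2. q < X i}" and Bq: "B = {i \<in> I1 \<union> I2. X i < q}"
      and top: "\<And>p. q < p \<Longrightarrow> merged (I1 \<union> I2) X U p = 0" using c by (auto simp: level_class_def)
    have r: "X i \<in> {1..N}" "U i \<in> {-M..M}" if "i \<in> I" for i using cp that by (auto simp: phase_data_def I_def)
    have injX: "inj_on X I1" "inj_on X I2" using cp by (auto simp: phase_data_def)
    have z: "(\<Sum>l'\<in>{l' \<in> E. restrict X E l' = restrict X E l}. restrict U E l') = 0" if l: "l \<in> E" for l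
    proof -
      have "{l' \<in> E. restrict X E l' = restrict X E l} = {l' \<in> I1 \<union> I2. X l' = X l}"
        using l unfolding Eq by auto
      moreover have "(\<Sum>l'\<in>{l' \<in> I1 \<union> I2. X l' = X l}. restrict U E l') = merged (I1 \<union> I2) X U (X l)"
        unfolding merged_def using l Eq by (intro sum.cong) auto
      ultimately show ?thesis using top[of "X l"] l Eq by auto
    qed
    have "restrict X B \<in> B \<rightarrow>\<^sub>E {1..<q}" using r str Bq by (auto simp: I_def)
    moreover have "restrict U R \<in> R \<rightarrow>\<^sub>E {-M..M}" using r by (auto simp: R_def)
    moreover have "(restrict X E, restrict U E) \<in> C"
    proof -
      have "restrict X E \<in> E \<rightarrow>\<^sub>E {1..N}" "restrict U E \<in> E \<rightarrow>\<^sub>E {-M..M}" using r str by auto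
      moreover have "inj_on (restrict X E) (E \<inter> I1)" "inj_on (restrict X E) (E \<inter> I2)"
        using injX by (auto simp: inj_on_def)
      ultimately show ?thesis unfolding C_def cancelling_def EI using z by simp
    qed
    ultimately show "f XU \<in> T" by (simp add: f_def XU T_def)
  qed
  have w0: "w X \<ge> 0" for X by (simp add: w_def prod_nonneg)
  have "(\<Sum>(X, U)\<in>?S. w X) = (\<Sum>t\<in>f ` ?S. w (fst t))"
    by (subst sum.reindex[OF inj]) (auto intro!: sum.cong prod.cong simp: f_def w_def)
  \<comment> \<open>In \<open>T\<close> the positions on \<open>B\<close> range freely below
    \<open>q\<close>, without injectivity, so that their weighted sum becomes a product over
    \<open>B\<close>.\<close>
  also have "\<dots> \<le> (\<Sum>t\<in>T. w (fst t))" by (intro sum_mono2 finT img w0)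
  also have "\<dots> = (\<Sum>Y\<in>B \<rightarrow>\<^sub>E {1..<q}. w Y) * real (card ((R \<rightarrow>\<^sub>E {-M..M}) \<times> C))"
    unfolding T_def using sum.cartesian_product[of "\<lambda>Y _. w Y" "(R \<rightarrow>\<^sub>E {-M..M}) \<times> C" "B \<rightarrow>\<^sub>E {1..<q}"]
    by (simp add: case_prod_unfold sum_distrib_right mult.commute del: card_cartesian_product)
  also have "(\<Sum>Y\<in>B \<rightarrow>\<^sub>E {1..<q}. w Y) = (\<Prod>i\<in>B. \<Sum>x\<in>{1..<q}. ((real q - real x) / real q) powr (- \<beta>))"
    unfolding w_def using finBE by (subst prod_sum_PiE) auto
  also have "\<dots> \<le> (2 * real q) ^ card B"
    unfolding prod_constant by (intro power_mono sum_shifted_powr_le \<beta> sum_nonneg) auto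
  also have "real (card ((R \<rightarrow>\<^sub>E {-M..M}) \<times> C)) \<le> real (m + 1) ^ m * real G ^ (m - 1 - card D)"
  proof -
    \<comment> \<open>\<open>R\<close> and \<open>E\<close> together have
      \<open>m - 1 - card D\<close> elements, which is the power of \<open>G\<close>: one factor is
      saved at \<open>q0\<close> and one for each element of \<open>D\<close>.\<close>
    have RD: "card R = m - 1 - card D - card E" "card E \<le> m - 1 - card D"
    proof -
      have "card (E \<union> D \<union> {q0}) = card E + card D + 1"
        using finBE finD str D(1) by (subst card_Un_disjoint; (subst card_Un_disjoint)?) auto
      moreover have "E \<union> D \<union> {q0} \<subseteq> I" using str D by auto
      moreover have "card (E \<union> D \<union> {q0}) \<le> m"
        unfolding m_def I_def[symmetric] using calculation finI by (intro card_mono) auto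
      moreover have "R = I - (E \<union> D \<union> {q0})" by (auto simp: R_def)
      then have "card R = m - card (E \<union> D \<union> {q0})"
        using calculation finI finBE finD by (simp add: card_Diff_subset m_def I_def)
      ultimately show "card R = m - 1 - card D - card E" "card E \<le> m - 1 - card D" by auto
    qed
    have Em: "card E \<le> m" using RD by simp
    have "card ((R \<rightarrow>\<^sub>E {-M..M}) \<times> C) = nat (2 * M + 1) ^ card R * card C"
      using finBE M by (simp add: card_cartesian_product card_PiE)
    also have "\<dots> \<le> G ^ card R * ((card E + 1) * G) ^ card E"
      using card_cancelling[of "E \<inter> I1" "E \<inter> I2" N G M] fin disj G M unfolding EI C_def[symmetric]
      by (intro mult_mono power_mono) auto
    also have "\<dots> = (card E + 1) ^ card E * G ^ (m - 1 - card D)"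
    proof -
      have "card R + card E = m - 1 - card D" using RD by linarith
      then have "G ^ card R * G ^ card E = G ^ (m - 1 - card D)" by (simp only: power_add[symmetric])
      then show ?thesis unfolding power_mult_distrib by (metis mult.left_commute)
    qed
    also have "\<dots> \<le> (m + 1) ^ m * G ^ (m - 1 - card D)"
    proof (intro mult_right_mono)
      have "(card E + 1) ^ card E \<le> (m + 1) ^ card E" using Em by (intro power_mono) auto
      also have "\<dots> \<le> (m + 1) ^ m" using Em by (intro power_increasing) auto
      finally show "(card E + 1) ^ card E \<le> (m + 1) ^ m" .
    qed auto
    finally have "card ((R \<rightarrow>\<^sub>E {-M..M}) \<times> C) \<le> (m + 1) ^ m * G ^ (m - 1 - card D)" .
    then show ?thesis by (metis of_nat_le_iff of_nat_mult of_nat_power)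
  qed
  finally show ?thesis unfolding w_def by (simp add: mult_left_mono mult_right_mono)
qed

text \<open>
  If \<open>B\<close> meets both halves, then \<open>D\<close> has two elements, and both relations save a factor \<open>G\<close>. Otherwise
  only one factor is saved, but then \<open>card B \<le> k\<close> compensates for it.
\<close>

lemma off_diagonal_moment:
  fixes I1 I2 :: "'i set" and G k :: nat
  assumes fin: "finite I1" "finite I2" and disj: "I1 \<inter> I2 = {}"
    and k: "card I1 = k" "card I2 = k" "k \<ge> 2" and \<beta>: "\<beta> = 1 / real (2 * k)"
    and G: "N \<le> G" "2 * M + 1 \<le> int G" and M: "M \<ge> 0"
    and ab: "0 \<le> a" "a \<le> b" "b - a \<le> 1"
    and \<delta>: "\<delta> \<le> \<beta>" "2 * real k - 2 - \<beta> + \<delta> \<le> a * \<beta>"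
  defines "m \<equiv> 2 * k"
  shows "(\<Sum>(X, U)\<in>{(X, U) \<in> phase_data I1 I2 N M. \<exists>p. merged (I1 \<union> I2) X U p \<noteq> 0}. osc_int (I1 \<union> I2) a b X U)
     \<le> 4 * real m * real m * 4 ^ m * (12 * real (m + 1)) ^ m * (real G powr (real m - \<delta>) * (real G powr (b - a)) ^ m)"
    (is "(\<Sum>(X, U)\<in>?S. _) \<le> _")
proof -
  define I where "I = I1 \<union> I2"
  have finI: "finite I" and cardI: "card I = m" using fin disj k by (simp_all add: I_def m_def card_Un_disjoint)
  have m: "m \<ge> 4" using k by (simp add: m_def)
  have \<beta>m: "\<beta> = 1 / real m" by (simp add: \<beta> m_def)
  have \<beta>r: "0 \<le> \<beta>" "\<beta> \<le> 1 / 2" using m by (auto simp: \<beta>m divide_le_eq)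
  have G1: "G \<ge> 1" using G(2) M by linarith
  define WG where "WG = real G powr (b - a)"
  define L where "L = m * nat M"
  \<comment> \<open>The data fixed before counting: the sets of indices above and below the leading
    position, one index at it, the position \<open>q\<close> and its merged frequency \<zeta>. The
    two subsets of \<open>I\<close> and the index \<open>q0\<close> contribute only a
    constant.\<close>
  define DS where "DS = (Pow I \<times> Pow I \<times> I) \<times> ({1..N} \<times> ({-int L..int L} - {0}))"
  define T where "T = (\<lambda>((E, B, q0), (q, \<zeta>)). level_class I1 I2 N M E B q0 q \<zeta>)"
  define K where "K = 12 ^ m * real (m + 1) ^ m * WG ^ m * real G powr (real m - 2 + \<beta> - \<delta>)"
  have K0: "K \<ge> 0" by (simp add: K_def WG_def)
  have finDS: "finite DS" using finI by (auto simp: DS_def)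
  have finT: "finite (T d)" for d
    by (rule finite_subset[OF _ finite_phase_data[OF fin, of N M]]) (auto simp: T_def level_class_def split: prod.splits)
  have osc0: "0 \<le> osc_int I a b X U" for X U by (simp add: osc_int_def)
  have cover: "?S \<subseteq> (\<Union>d\<in>DS. T d)"
  proof clarify
    fix X U p assume c: "(X, U) \<in> phase_data I1 I2 N M" and p: "merged (I1 \<union> I2) X U p \<noteq> 0"
    define Z where "Z = {p. merged I X U p \<noteq> 0}"
    have ZX: "Z \<subseteq> X ` I"
    proof
      fix p assume "p \<in> Z"
      then have "{i \<in> I. X i = p} \<noteq> {}" unfolding Z_def merged_def using sum.empty by force
      then show "p \<in> X ` I" by auto
    qed
    have finZ: "finite Z" using finI by (intro finite_subset[OF ZX]) auto
    have Zne: "Z \<noteq> {}" using p by (auto simp: Z_def I_def)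
    define q where "q = Max Z"
    have qZ: "q \<in> Z" unfolding q_def using finZ Zne by (rule Max_in)
    have qtop: "merged I X U p = 0" if "p > q" for p
      using that Max_ge[OF finZ, of p] by (auto simp: q_def Z_def not_less[symmetric])
    obtain q0 where q0: "q0 \<in> I" "X q0 = q" using qZ ZX by auto
    define B where "B = {i \<in> I. X i < q}"
    define E where "E = {i \<in> I. q < X i}"
    define \<zeta> where "\<zeta> = merged I X U q"
    have \<zeta>0: "\<zeta> \<noteq> 0" using qZ by (simp add: Z_def \<zeta>_def)
    have r: "X i \<in> {1..N}" "U i \<in> {-M..M}" if "i \<in> I" for i using c that by (auto simp: phase_data_def I_def)
    \<comment> \<open>With nothing below \<open>q\<close>, the sum of all frequencies would be
      \<zeta>, but it is 0 on each half.\<close>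
    have "B \<noteq> {}"
    proof
      assume "B = {}"
      have "sum U I = (\<Sum>p\<in>X ` I. merged I X U p)"
        unfolding merged_def using finI by (rule sum.image_gen)
      also have "\<dots> = (\<Sum>p\<in>{q}. merged I X U p)"
      proof (rule sum.mono_neutral_right)
        show "\<forall>p\<in>X ` I - {q}. merged I X U p = 0"
        proof
          fix p assume p: "p \<in> X ` I - {q}"
          then have "\<not> p < q" using \<open>B = {}\<close> by (auto simp: B_def)
          then show "merged I X U p = 0" using p by (intro qtop) auto
        qed
      qed (use finI q0 in auto)
      finally have "sum U I = \<zeta>" by (simp add: \<zeta>_def)
      moreover have "sum U I = 0" using c fin disj by (simp add: phase_data_def I_def sum.union_disjoint)
      ultimately show False using \<zeta>0 by simp
    qed
    have "\<bar>\<zeta>\<bar> \<le> int L"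
    proof -
      have "\<bar>\<zeta>\<bar> \<le> (\<Sum>i\<in>{i \<in> I. X i = q}. \<bar>U i\<bar>)" unfolding \<zeta>_def merged_def by (rule sum_abs)
      also have "\<dots> \<le> (\<Sum>i\<in>{i \<in> I. X i = q}. M)" using r(2) by (intro sum_mono) (fastforce simp: abs_le_iff)
      also have "\<dots> \<le> (\<Sum>i\<in>I. M)" using finI M by (intro sum_mono2) auto
      also have "\<dots> = int L" using M by (simp add: L_def cardI)
      finally show ?thesis .
    qed
    then have "((E, B, q0), (q, \<zeta>)) \<in> DS"
      using q0 r[OF q0(1)] \<zeta>0 by (auto simp: DS_def B_def E_def)
    moreover have "(X, U) \<in> T ((E, B, q0), (q, \<zeta>))"
      using c q0 \<zeta>0 \<open>B \<noteq> {}\<close> qtop unfolding T_def level_class_def I_def[symmetric]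
      by (simp add: B_def E_def \<zeta>_def[symmetric])
    ultimately show "(X, U) \<in> (\<Union>d\<in>DS. T d)" by blast
  qed
  have each: "(\<Sum>(X, U)\<in>level_class I1 I2 N M E B q0 q \<zeta>. osc_int I a b X U) \<le> K * \<bar>real_of_int \<zeta>\<bar> powr (- \<beta>)" for E B q0 q \<zeta>
  proof (cases "level_class I1 I2 N M E B q0 q \<zeta> = {}")
    case False
    then obtain X0 U0 where c0: "(X0, U0) \<in> level_class I1 I2 N M E B q0 q \<zeta>" by auto
    then have str: "q0 \<in> I" "q0 \<notin> B" "B \<subseteq> I" "B \<noteq> {}" "q \<in> {1..N}"
      by (auto simp: level_class_def I_def phase_data_def)
    have finB: "finite B" using str finI by (auto intro: finite_subset)
    have q1: "1 \<le> q" "q \<le> G" using str G by auto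
    define pick where "pick = (\<lambda>J. if B \<inter> J = {} then {} else {SOME i. i \<in> B \<inter> J})"
    define D where "D = pick I1 \<union> pick I2"
    have pick: "pick J \<subseteq> B \<inter> J" "card (pick J) = (if B \<inter> J = {} then 0 else 1)"
      "\<And>i j. i \<in> pick J \<Longrightarrow> j \<in> pick J \<Longrightarrow> i = j" for J
      using some_in_eq[of "B \<inter> J"] by (auto simp: pick_def split: if_splits)
    have DB: "D \<subseteq> B" using pick(1) by (auto simp: D_def)
    have Duniq: "i = j" if "i \<in> D" "j \<in> D" "i \<in> I1 \<longleftrightarrow> j \<in> I1" for i j
      using that pick(1)[of I1] pick(1)[of I2] pick(3)[of _ I1] pick(3)[of _ I2] disj unfolding D_def by blast
    have "finite (pick J)" for J using pick(1)[of J] finB by (auto intro: finite_subset)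
    then have cardD: "card D = card (pick I1) + card (pick I2)"
      unfolding D_def using pick(1)[of I1] pick(1)[of I2] disj by (intro card_Un_disjoint) auto
    have cardB: "card B \<le> m - 1"
    proof -
      have "B \<subseteq> I - {q0}" using str by auto
      then have "card B \<le> card (I - {q0})" using finI by (intro card_mono) auto
      then show ?thesis using str finI cardI by simp
    qed
    have Bcase: "card D = 2 \<or> card D = 1 \<and> card B \<le> k"
    proof -
      have "B \<inter> I1 \<noteq> {} \<or> B \<inter> I2 \<noteq> {}" using str by (auto simp: I_def)
      moreover have "card B \<le> k" if "B \<inter> J = {}" "J = I1 \<or> J = I2" for J
      proof -
        have "B \<subseteq> I1 \<or> B \<subseteq> I2" using that str by (auto simp: I_def)
        then show ?thesis using fin k card_mono[of I1 B] card_mono[of I2 B] by auto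
      qed
      ultimately show ?thesis by (auto simp: cardD pick(2))
    qed
    have mD: "real (m - 1 - card D) = real m - 1 - real (card D)" using Bcase m by auto
    \<comment> \<open>After the sums over \<open>B\<close> the power of \<open>q\<close> is
      \<open>card B - a * \<beta>\<close>. Since \<open>1 \<le> q \<le> G\<close>, a positive power
      is replaced by the same power of \<open>G\<close> and a negative one by 1, hence the maximum
      with 0.\<close>
    define e where "e = max 0 (real (card B) - a * \<beta>)"
    \<comment> \<open>If \<open>card D = 2\<close>, then \<open>card B \<le> m - 1\<close> turns the
      claim for \<open>e > 0\<close> into the hypothesis
      \<open>2 * k - 2 - \<beta> + \<delta> \<le> a * \<beta>\<close>, which is where the threshold
      for \<alpha> originates. If \<open>card D = 1\<close>, then
      \<open>card B \<le> k \<le> 2 * k - 2\<close> suffices. For \<open>e = 0\<close> both cases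
      rest on \<open>\<delta> \<le> \<beta>\<close>.\<close>
    have e: "e + (real m - 1 - real (card D)) \<le> real m - 2 + \<beta> - \<delta>"
    proof -
      have "real (card B) \<le> real m - 1" using cardB m by linarith
      then show ?thesis using Bcase \<delta> k(3) \<beta>r unfolding e_def m_def by (auto simp: max_def)
    qed
    define \<kappa> where "\<kappa> = (6 * real N powr (b - a)) ^ m * (\<bar>real_of_int \<zeta>\<bar> powr (- \<beta>) * real q powr (- (a * \<beta>)))"
    have \<kappa>0: "\<kappa> \<ge> 0" by (simp add: \<kappa>_def)
    have "(\<Sum>(X, U)\<in>level_class I1 I2 N M E B q0 q \<zeta>. osc_int I a b X U)
      \<le> (\<Sum>(X, U)\<in>level_class I1 I2 N M E B q0 q \<zeta>. \<kappa> * (\<Prod>i\<in>B. ((real q - real (X i)) / real q) powr (- \<beta>)))"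
    proof (rule sum_mono, clarify)
      fix X U assume c: "(X, U) \<in> level_class I1 I2 N M E B q0 q \<zeta>"
      have "osc_int I a b X U \<le> (6 * real N powr (b - a)) ^ card I *
         (\<bar>real_of_int \<zeta>\<bar> powr (- \<beta>) * real q powr (- (a * \<beta>)) * (\<Prod>i\<in>B. ((real q - real (X i)) / real q) powr (- \<beta>)))"
        by (rule osc_int_le) (use c finI ab in \<open>auto simp: level_class_def I_def phase_data_def \<beta>m cardI[unfolded I_def]\<close>)
      then show "osc_int I a b X U \<le> \<kappa> * (\<Prod>i\<in>B. ((real q - real (X i)) / real q) powr (- \<beta>))"
        by (simp add: \<kappa>_def cardI mult_ac)
    qed
    also have "\<dots> = \<kappa> * (\<Sum>(X, U)\<in>level_class I1 I2 N M E B q0 q \<zeta>. \<Prod>i\<in>B. ((real q - real (X i)) / real q) powr (- \<beta>))"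
      by (simp add: sum_distrib_left case_prod_unfold)
    also have "\<dots> \<le> \<kappa> * ((2 * real q) ^ card B * (real (m + 1) ^ m * real G ^ (m - 1 - card D)))"
      using level_class_sum_le[OF fin disj G M DB Duniq \<beta>r False] unfolding I_def[symmetric] cardI
      by (rule mult_left_mono[OF _ \<kappa>0])
    also have "\<dots> = (6 * real N powr (b - a)) ^ m * \<bar>real_of_int \<zeta>\<bar> powr (- \<beta>) * real (m + 1) ^ m * 2 ^ card B *
         (real q powr (real (card B) - a * \<beta>) * real G powr (real m - 1 - real (card D)))"
    proof -
      have 1: "real q powr (real (card B) - a * \<beta>) = real q ^ card B * real q powr (- (a * \<beta>))"
        using q1 powr_add[of "real q" "real (card B)" "- (a * \<beta>)"] by (simp add: powr_realpow)
      have 2: "real G ^ (m - 1 - card D) = real G powr (real m - 1 - real (card D))"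
        using G1 by (simp only: mD[symmetric] powr_realpow)
      show ?thesis unfolding \<kappa>_def power_mult_distrib[of 2 "real q"] 1 2 by (simp only: mult_ac)
    qed
    also have "\<dots> \<le> (6 * WG) ^ m * \<bar>real_of_int \<zeta>\<bar> powr (- \<beta>) * real (m + 1) ^ m * 2 ^ m * real G powr (real m - 2 + \<beta> - \<delta>)"
    proof (intro mult_mono)
      show "(6 * real N powr (b - a)) ^ m \<le> (6 * WG) ^ m"
        unfolding WG_def using ab G by (intro power_mono mult_left_mono powr_mono2) auto
      show "(2::real) ^ card B \<le> 2 ^ m" using cardB m by (intro power_increasing) auto
      have "real q powr (real (card B) - a * \<beta>) \<le> real q powr e"
        using q1 by (intro powr_mono) (auto simp: e_def)
      also have "\<dots> \<le> real G powr e" using q1 by (intro powr_mono2) (auto simp: e_def)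
      finally have "real q powr (real (card B) - a * \<beta>) * real G powr (real m - 1 - real (card D)) \<le>
          real G powr e * real G powr (real m - 1 - real (card D))"
        by (intro mult_right_mono) auto
      also have "\<dots> \<le> real G powr (real m - 2 + \<beta> - \<delta>)"
        using G1 e by (simp add: powr_add[symmetric] powr_mono)
      finally show "real q powr (real (card B) - a * \<beta>) * real G powr (real m - 1 - real (card D)) \<le> real G powr (real m - 2 + \<beta> - \<delta>)" .
    qed (auto simp: WG_def)
    also have "\<dots> = K * \<bar>real_of_int \<zeta>\<bar> powr (- \<beta>)"
    proof -
      have "(6 * WG) ^ m * 2 ^ m = 12 ^ m * WG ^ m" unfolding power_mult_distrib[symmetric] by simp
      moreover have "x * z * y * w * g = (x * w) * (y * g * z)" for x y z w g :: real by (simp only: mult_ac)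
      ultimately have "(6 * WG) ^ m * \<bar>real_of_int \<zeta>\<bar> powr (- \<beta>) * real (m + 1) ^ m * 2 ^ m * real G powr (real m - 2 + \<beta> - \<delta>)
        = (12 ^ m * WG ^ m) * (real (m + 1) ^ m * real G powr (real m - 2 + \<beta> - \<delta>) * \<bar>real_of_int \<zeta>\<bar> powr (- \<beta>))"
        by metis
      then show ?thesis unfolding K_def by (simp only: mult_ac)
    qed
    finally show ?thesis .
  qed (use K0 in simp)
  have "(\<Sum>(X, U)\<in>?S. osc_int I a b X U) \<le> (\<Sum>d\<in>DS. \<Sum>(X, U)\<in>T d. osc_int I a b X U)"
    using fin osc0 by (intro sum_UN_le finDS cover finT finite_subset[OF _ finite_phase_data[OF fin, of N M]]) auto
  also have "\<dots> \<le> (\<Sum>d\<in>DS. K * \<bar>real_of_int (snd (snd d))\<bar> powr (- \<beta>))"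
    by (rule sum_mono) (auto simp: T_def each split: prod.splits)
  also have "\<dots> = (\<Sum>x\<in>Pow I \<times> Pow I \<times> I. \<Sum>q\<in>{1..N}. K * (\<Sum>\<zeta>\<in>{-int L..int L} - {0}. \<bar>real_of_int \<zeta>\<bar> powr (- \<beta>)))"
    unfolding DS_def by (simp add: sum.cartesian_product' sum_distrib_left)
  also have "\<dots> = real (2 ^ m * (2 ^ m * m)) * (real N * (K * (\<Sum>\<zeta>\<in>{-int L..int L} - {0}. \<bar>real_of_int \<zeta>\<bar> powr (- \<beta>))))"
    by (simp add: card_cartesian_product card_Pow finI cardI)
  \<comment> \<open>The sum over \<open>q\<close> contributes \<open>G\<close> and the sum over
    \<zeta> a constant times \<open>G powr (1 - \<beta>)\<close>; with the factor
    \<open>G powr (m - 2 + \<beta> - \<delta>)\<close> of \<open>K\<close> this makes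
    \<open>G powr (m - \<delta>)\<close>.\<close>
  also have "\<dots> \<le> real (2 ^ m * (2 ^ m * m)) * (real G * (K * (4 * (real m * real G powr (1 - \<beta>)))))"
  proof -
    have "(\<Sum>\<zeta>\<in>{-int L..int L} - {0}. \<bar>real_of_int \<zeta>\<bar> powr (- \<beta>)) \<le> 4 * real L powr (1 - \<beta>)"
      by (rule sum_abs_int_powr_le[OF \<beta>r])
    also have "real L powr (1 - \<beta>) \<le> (real m * real G) powr (1 - \<beta>)"
    proof (intro powr_mono2)
      have "nat M \<le> G" using G(2) M by linarith
      then show "real L \<le> real m * real G" by (simp add: L_def mult_left_mono)
    qed (use \<beta>r in auto)
    also have "\<dots> = real m powr (1 - \<beta>) * real G powr (1 - \<beta>)" by (simp add: powr_mult)
    also have "\<dots> \<le> real m powr 1 * real G powr (1 - \<beta>)"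
      using m \<beta>r by (intro mult_right_mono powr_mono) auto
    finally show ?thesis using K0 G by (intro mult_left_mono mult_mono mult_nonneg_nonneg[OF K0]) (auto intro!: sum_nonneg)
  qed
  also have "\<dots> = 4 * real m * real m * 4 ^ m * (12 * real (m + 1)) ^ m * WG ^ m *
      (real G powr (real m - 2 + \<beta> - \<delta>) * (real G powr 1 * real G powr (1 - \<beta>)))"
  proof -
    have "(2::real) ^ m * 2 ^ m = 4 ^ m" unfolding power_mult_distrib[symmetric] by simp
    then have 1: "real (2 ^ m * (2 ^ m * m)) = 4 ^ m * real m" by simp
    have 2: "real G powr 1 = real G" using G1 by simp
    show ?thesis unfolding 1 2 K_def power_mult_distrib[of 12 "real (m + 1)"] by (simp only: mult_ac)
  qed
  also have "real G powr (real m - 2 + \<beta> - \<delta>) * (real G powr 1 * real G powr (1 - \<beta>)) = real G powr (real m - \<delta>)"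
    unfolding powr_add[symmetric] by (simp add: algebra_simps)
  finally show ?thesis by (simp add: I_def WG_def mult_ac)
qed

text \<open>The terms with identically vanishing phase are estimated by 1 each. Their number is at
  most a constant times \<open>G ^ (m - 1)\<close>, which is within the off-diagonal bound because
  \<open>\<delta> \<le> 1\<close>; doubling the constant 4 absorbs them.\<close>

lemma moment_bound:
  fixes I1 I2 :: "'i set" and G k :: nat
  assumes fin: "finite I1" "finite I2" and disj: "I1 \<inter> I2 = {}"
    and k: "card I1 = k" "card I2 = k" "k \<ge> 2" and \<beta>: "\<beta> = 1 / real (2 * k)"
    and G: "N \<le> G" "2 * M + 1 \<le> int G" and M: "M \<ge> 0"
    and ab: "0 \<le> a" "a \<le> b" "b - a \<le> 1"
    and \<delta>: "\<delta> \<le> \<beta>" "2 * real k - 2 - \<beta> + \<delta> \<le> a * \<beta>"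
  defines "m \<equiv> 2 * k"
  shows "(\<Sum>(X, U)\<in>phase_data I1 I2 N M. osc_int (I1 \<union> I2) a b X U)
     \<le> 8 * real m * real m * 4 ^ m * (12 * real (m + 1)) ^ m * real G powr (real m - \<delta> + real m * (b - a))"
proof -
  define S0 where "S0 = {(X, U) \<in> phase_data I1 I2 N M. \<forall>p. merged (I1 \<union> I2) X U p = 0}"
  define S1 where "S1 = {(X, U) \<in> phase_data I1 I2 N M. \<exists>p. merged (I1 \<union> I2) X U p \<noteq> 0}"
  define K where "K = 4 * real m * real m * 4 ^ m * (12 * real (m + 1)) ^ m"
  have finp: "finite (phase_data I1 I2 N M)" by (rule finite_phase_data[OF fin])
  have G1: "G \<ge> 1" using G(2) M by linarith
  have m: "m \<ge> 4" "card (I1 \<union> I2) = m" using k fin disj by (auto simp: m_def card_Un_disjoint)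
  have \<delta>1: "\<delta> \<le> 1" using \<delta>(1) \<beta> k(3) by (auto simp: divide_le_eq intro: order_trans)
  have split: "(\<Sum>(X, U)\<in>phase_data I1 I2 N M. osc_int (I1 \<union> I2) a b X U) =
     (\<Sum>(X, U)\<in>S0. osc_int (I1 \<union> I2) a b X U) + (\<Sum>(X, U)\<in>S1. osc_int (I1 \<union> I2) a b X U)"
    using finp by (subst sum.union_disjoint[symmetric]) (auto simp: S0_def S1_def intro!: sum.cong intro: finite_subset)
  have G2: "real G powr (real m - \<delta>) * (real G powr (b - a)) ^ m = real G powr (real m - \<delta> + real m * (b - a))"
    using G1 by (simp add: powr_add powr_powr[symmetric] powr_realpow[symmetric] mult.commute) (simp add: powr_powr mult.commute)
  have 1: "(\<Sum>(X, U)\<in>S1. osc_int (I1 \<union> I2) a b X U) \<le> K * real G powr (real m - \<delta> + real m * (b - a))"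
    unfolding G2[symmetric] unfolding S1_def K_def m_def by (rule off_diagonal_moment[OF fin disj k \<beta> G M ab \<delta>])
  have "(\<Sum>(X, U)\<in>S0. osc_int (I1 \<union> I2) a b X U) \<le> (\<Sum>XU\<in>S0. 1)"
  proof (rule sum_mono, clarify)
    fix X U assume "(X, U) \<in> S0"
    then have "X \<in> I1 \<union> I2 \<rightarrow>\<^sub>E {1..N}" by (simp add: S0_def phase_data_def)
    then have "0 < X i" if "i \<in> I1 \<union> I2" for i using PiE_mem[OF _ that, of X "\<lambda>_. {1..N}"] by auto
    then have "osc_int (I1 \<union> I2) a b X U \<le> 1 * (b - a)"
      unfolding osc_int_def using ab
      by (intro integral_bound continuous_on_cis continuous_intros continuous_on_powr') auto
    then show "osc_int (I1 \<union> I2) a b X U \<le> 1" using ab by simp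
  qed
  also have "\<dots> = real (card S0)" by simp
  also have "\<dots> \<le> real (m\<^sup>2 * ((m + 1) ^ m * G ^ (m - 1)))"
    using card_diagonal_phases[OF fin disj G] m(2) unfolding S0_def of_nat_le_iff by simp
  also have "\<dots> = (real m * real m * real (m + 1) ^ m) * real G powr (real m - 1)"
    using G1 m by (simp add: powr_realpow[symmetric] power2_eq_square of_nat_diff)
  also have "\<dots> \<le> K * real G powr (real m - \<delta> + real m * (b - a))"
  proof (intro mult_mono powr_mono)
    have "1 * 1 * (real m * real m * real (m + 1) ^ m) \<le> (4 * 4 ^ m) * 12 ^ m * (real m * real m * real (m + 1) ^ m)"
      by (intro mult_right_mono mult_mono) (auto intro: order_trans[OF _ mult_mono[of 1 4 1 "4 ^ m"]])
    moreover have "K = (4 * 4 ^ m) * 12 ^ m * (real m * real m * real (m + 1) ^ m)"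
      unfolding K_def power_mult_distrib by (simp only: mult_ac)
    ultimately show "real m * real m * real (m + 1) ^ m \<le> K" by simp
    show "real m - 1 \<le> real m - \<delta> + real m * (b - a)"
      using \<delta>1 ab mult_nonneg_nonneg[of "real m" "b - a"] by linarith
  qed (use G1 in \<open>auto simp: K_def\<close>)
  finally show ?thesis using split 1 by (simp add: K_def)
qed

subsection \<open>Mean squares and almost everywhere convergence\<close>

text \<open>Expanding the square and bounding every product of coefficients by \<open>C^2\<close>
  leaves the individual oscillatory integrals. No cancellation between different pairs is
  exploited.\<close>

lemma integral_norm_exp_sum_le:
  fixes \<theta> :: "'p \<Rightarrow> real \<Rightarrow> real" and c :: "'p \<Rightarrow> complex"
  assumes fin: "finite A" and cont: "\<And>p. p \<in> A \<Longrightarrow> continuous_on {a..b} (\<theta> p)"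
    and c: "\<And>p. p \<in> A \<Longrightarrow> norm (c p) \<le> C"
  shows "integral {a..b} (\<lambda>\<alpha>. (norm (\<Sum>p\<in>A. c p * cis (\<theta> p \<alpha>)))\<^sup>2)
     \<le> C\<^sup>2 * (\<Sum>(p, p')\<in>A \<times> A. norm (integral {a..b} (\<lambda>\<alpha>. cis (\<theta> p \<alpha> - \<theta> p' \<alpha>))))"
proof -
  define S where "S = (\<lambda>\<alpha>. \<Sum>p\<in>A. c p * cis (\<theta> p \<alpha>))"
  have sq: "complex_of_real ((norm (S \<alpha>))\<^sup>2) = (\<Sum>(p, p')\<in>A \<times> A. (c p * cnj (c p')) * cis (\<theta> p \<alpha> - \<theta> p' \<alpha>))" for \<alpha>
  proof -
    have "complex_of_real ((norm (S \<alpha>))\<^sup>2) = S \<alpha> * cnj (S \<alpha>)" by (rule complex_norm_square)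
    also have "\<dots> = (\<Sum>(p, p')\<in>A \<times> A. (c p * cis (\<theta> p \<alpha>)) * (cnj (c p') * cis (- \<theta> p' \<alpha>)))"
      unfolding S_def by (simp add: sum_product sum.cartesian_product cis_cnj[symmetric])
    also have "\<dots> = (\<Sum>(p, p')\<in>A \<times> A. (c p * cnj (c p')) * cis (\<theta> p \<alpha> - \<theta> p' \<alpha>))"
      by (intro sum.cong) (auto simp: cis_divide[symmetric] divide_inverse cis_inverse)
    finally show ?thesis .
  qed
  have int: "(\<lambda>\<alpha>. (c p * cnj (c p')) * cis (\<theta> p \<alpha> - \<theta> p' \<alpha>)) integrable_on {a..b}" if "p \<in> A" "p' \<in> A" for p p'
    using that cont by (intro integrable_continuous_interval continuous_intros continuous_on_cis) auto
  have contS: "continuous_on {a..b} (\<lambda>\<alpha>. (norm (S \<alpha>))\<^sup>2)"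
    unfolding S_def using cont by (intro continuous_intros continuous_on_cis) auto
  have "complex_of_real (integral {a..b} (\<lambda>\<alpha>. (norm (S \<alpha>))\<^sup>2)) = integral {a..b} (\<lambda>\<alpha>. complex_of_real ((norm (S \<alpha>))\<^sup>2))"
    using has_integral_of_real[OF integrable_integral[OF integrable_continuous_interval[OF contS]]]
    by (intro integral_unique[symmetric])
  also have "\<dots> = (\<Sum>(p, p')\<in>A \<times> A. integral {a..b} (\<lambda>\<alpha>. (c p * cnj (c p')) * cis (\<theta> p \<alpha> - \<theta> p' \<alpha>)))"
    unfolding sq using fin int by (subst integral_sum) (auto simp: case_prod_unfold)
  also have "\<dots> = (\<Sum>(p, p')\<in>A \<times> A. (c p * cnj (c p')) * integral {a..b} (\<lambda>\<alpha>. cis (\<theta> p \<alpha> - \<theta> p' \<alpha>)))"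
    by (simp add: case_prod_unfold)
  finally have "\<bar>integral {a..b} (\<lambda>\<alpha>. (norm (S \<alpha>))\<^sup>2)\<bar> =
     norm (\<Sum>(p, p')\<in>A \<times> A. (c p * cnj (c p')) * integral {a..b} (\<lambda>\<alpha>. cis (\<theta> p \<alpha> - \<theta> p' \<alpha>)))"
    by (metis norm_of_real)
  also have "\<dots> \<le> (\<Sum>(p, p')\<in>A \<times> A. C\<^sup>2 * norm (integral {a..b} (\<lambda>\<alpha>. cis (\<theta> p \<alpha> - \<theta> p' \<alpha>))))"
  proof (intro sum_norm_le, clarify)
    fix p p' assume p: "p \<in> A" "p' \<in> A"
    have "norm (c p) * norm (c p') \<le> C * C" using c[OF p(1)] c[OF p(2)] by (intro mult_mono) (auto intro: order_trans[OF norm_ge_zero])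
    then show "norm ((c p * cnj (c p')) * integral {a..b} (\<lambda>\<alpha>. cis (\<theta> p \<alpha> - \<theta> p' \<alpha>))) \<le> C\<^sup>2 * norm (integral {a..b} (\<lambda>\<alpha>. cis (\<theta> p \<alpha> - \<theta> p' \<alpha>)))"
      unfolding norm_mult complex_mod_cnj power2_eq_square by (intro mult_right_mono) auto
  qed
  finally show ?thesis unfolding S_def by (simp add: sum_distrib_left case_prod_unfold)
qed

text \<open>
  The coefficient of \<open>x j powr \<alpha>\<close> in \<open>\<Sum>\<^sub>i n\<^sub>i (x\<^sub>i\<^sup>\<alpha> - x\<^sub>i\<^sub>+\<^sub>1\<^sup>\<alpha>)\<close>, by summation by parts.
\<close>

definition tuple_coeff :: "nat \<Rightarrow> (nat \<Rightarrow> int) \<Rightarrow> nat \<Rightarrow> int" where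
  "tuple_coeff k n j = (if j < k then n j else 0) - (if 1 < j then n (j - 1) else 0)"

lemma sum_tuple_coeff:
  fixes y :: "nat \<Rightarrow> real"
  assumes "k \<ge> 1"
  shows "(\<Sum>j\<in>{1..k}. real_of_int (tuple_coeff k n j) * y j) = (\<Sum>i\<in>{1..<k}. real_of_int (n i) * (y i - y (i + 1)))"
proof -
  have "(\<Sum>j\<in>{1..k}. real_of_int (tuple_coeff k n j) * y j) =
    (\<Sum>j\<in>{1..k}. if j < k then real_of_int (n j) * y j else 0) - (\<Sum>j\<in>{1..k}. if 1 < j then real_of_int (n (j - 1)) * y j else 0)"
    unfolding sum_subtractf[symmetric] by (intro sum.cong) (auto simp: tuple_coeff_def algebra_simps)
  also have "(\<Sum>j\<in>{1..k}. if j < k then real_of_int (n j) * y j else 0) = (\<Sum>j\<in>{1..<k}. real_of_int (n j) * y j)"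
    by (intro sum.mono_neutral_cong_right) auto
  also have "(\<Sum>j\<in>{1..k}. if 1 < j then real_of_int (n (j - 1)) * y j else 0) = (\<Sum>j\<in>{2..k}. real_of_int (n (j - 1)) * y j)"
    by (intro sum.mono_neutral_cong_right) auto
  also have "\<dots> = (\<Sum>i\<in>{1..<k}. real_of_int (n i) * y (i + 1))"
    by (rule sum.reindex_bij_witness[of _ "\<lambda>i. i + 1" "\<lambda>j. j - 1"]) (use assms in auto)
  finally show ?thesis by (simp add: sum_subtractf[symmetric] algebra_simps)
qed

lemma sum_tuple_coeff_zero:
  assumes "k \<ge> 1"
  shows "(\<Sum>j\<in>{1..k}. tuple_coeff k n j) = 0"
proof -
  have "real_of_int (\<Sum>j\<in>{1..k}. tuple_coeff k n j) = 0"
    using sum_tuple_coeff[OF assms, of n "\<lambda>_. 1"] by simp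
  then show ?thesis by (simp only: of_int_eq_0_iff)
qed

text \<open>The partial sums telescope, so the frequencies \<open>n\<close> can be read off from the
  coefficients. This gives the injectivity in the passage to \<open>phase_data\<close>.\<close>

lemma sum_tuple_coeff_upto: "i < k \<Longrightarrow> 1 \<le> i \<Longrightarrow> (\<Sum>j\<in>{1..i}. tuple_coeff k n j) = n i"
proof (induction i)
  case (Suc i)
  show ?case
  proof (cases "i = 0")
    case False
    then show ?thesis using Suc by (simp add: tuple_coeff_def)
  qed (use Suc in \<open>simp add: tuple_coeff_def\<close>)
qed simp

definition freqs :: "nat \<Rightarrow> nat \<Rightarrow> (nat \<Rightarrow> int) set" where
  "freqs k h = {1..<k} \<rightarrow>\<^sub>E {-int h..int h}"

definition zero_freq :: "nat \<Rightarrow> nat \<Rightarrow> int" where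
  "zero_freq k = (\<lambda>i\<in>{1..<k}. 0)"

definition tuple_phase :: "nat \<Rightarrow> (nat \<Rightarrow> int) \<Rightarrow> (nat \<Rightarrow> nat) \<Rightarrow> real \<Rightarrow> real" where
  "tuple_phase k n x \<alpha> = 2 * pi * (\<Sum>i\<in>{1..<k}. real_of_int (n i) * (real (x i) powr \<alpha> - real (x (i + 1)) powr \<alpha>))"

definition corr_exp_sum :: "nat \<Rightarrow> nat \<Rightarrow> nat \<Rightarrow> ((nat \<Rightarrow> int) \<Rightarrow> complex) \<Rightarrow> real \<Rightarrow> complex" where
  "corr_exp_sum k N h c \<alpha> =
     (\<Sum>(x, n)\<in>distinct_tuples k N \<times> (freqs k h - {zero_freq k}). c n * cis (tuple_phase k n x \<alpha>))"

lemma finite_freqs [simp]: "finite (freqs k h)"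
  by (auto simp: freqs_def intro!: finite_PiE)

lemma finite_distinct_tuples [simp]: "finite (distinct_tuples k N)"
  by (rule finite_subset[of _ "{1..k} \<rightarrow>\<^sub>E {1..N}"]) (auto simp: distinct_tuples_def intro!: finite_PiE)

lemma distinct_tuples_pos: "x \<in> distinct_tuples k N \<Longrightarrow> i \<in> {1..k} \<Longrightarrow> 1 \<le> x i"
  using PiE_mem[of x "{1..k}" "\<lambda>_. {1..N}" i] by (auto simp: distinct_tuples_def)

lemma continuous_on_tuple_phase:
  assumes "x \<in> distinct_tuples k N"
  shows "continuous_on S (tuple_phase k n x)"
proof -
  have "x i > 0" "x (Suc i) > 0" if "1 \<le> i" "i < k" for i
    using distinct_tuples_pos[OF assms, of i] distinct_tuples_pos[OF assms, of "Suc i"] that by auto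
  then show ?thesis
    unfolding tuple_phase_def by (intro continuous_intros continuous_on_powr') auto
qed

lemma continuous_on_corr_exp_sum: "continuous_on S (corr_exp_sum k N h c)"
  unfolding corr_exp_sum_def case_prod_unfold
  by (intro continuous_intros continuous_on_cis) (auto intro: continuous_on_tuple_phase)

text \<open>Expanding the square produces pairs of tuples with frequencies; \<open>f\<close> turns
  such a pair into one configuration, the second phase entering with a minus sign. Its frequencies
  are differences of two entries of \<open>n\<close>, hence bounded by \<open>2 * h\<close>, which
  explains \<open>4 * h + 1 \<le> G\<close>. The exclusion of the zero frequency becomes the
  condition of \<open>phase_data\<close> that some frequency on the first half is nonzero.\<close>

lemma corr_exp_sum_variance:
  fixes k N h G :: nat
  assumes k: "k \<ge> 2" and \<beta>: "\<beta> = 1 / real (2 * k)"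
    and G: "N \<le> G" "4 * h + 1 \<le> G"
    and ab: "0 \<le> a" "a \<le> b" "b - a \<le> 1"
    and \<delta>: "\<delta> \<le> \<beta>" "2 * real k - 2 - \<beta> + \<delta> \<le> a * \<beta>"
    and c: "\<And>n. n \<in> freqs k h \<Longrightarrow> norm (c n) \<le> C"
  defines "m \<equiv> 2 * k"
  shows "integral {a..b} (\<lambda>\<alpha>. (norm (corr_exp_sum k N h c \<alpha>))\<^sup>2)
    \<le> C\<^sup>2 * (8 * real m * real m * 4 ^ m * (12 * real (m + 1)) ^ m * real G powr (real m - \<delta> + real m * (b - a)))"
proof -
  define I1 :: "(nat + nat) set" where "I1 = Inl ` {1..k}"
  define I2 :: "(nat + nat) set" where "I2 = Inr ` {1..k}"
  define I where "I = I1 \<union> I2"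
  have fin: "finite I1" "finite I2" and disj: "I1 \<inter> I2 = {}" and card: "card I1 = k" "card I2 = k"
    by (auto simp: I1_def I2_def card_image)
  define A where "A = distinct_tuples k N \<times> (freqs k h - {zero_freq k})"
  have finA: "finite A" by (simp add: A_def)
  define f where "f = (\<lambda>((x :: nat \<Rightarrow> nat, n), (x', n')).
     (\<lambda>i\<in>I. case_sum x x' i, \<lambda>i\<in>I. case_sum (tuple_coeff k n) (\<lambda>j. - tuple_coeff k n' j) i))"
  have frange: "tuple_coeff k n j \<in> {- int (2 * h)..int (2 * h)}" if "n \<in> freqs k h" "j \<in> {1..k}" for n j
  proof -
    have "n i \<in> {-int h..int h}" if "i \<in> {1..<k}" for i using \<open>n \<in> freqs k h\<close> that by (auto simp: freqs_def)
    then have b: "- int h \<le> n i \<and> n i \<le> int h" if "1 \<le> i" "i < k" for i using that by auto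
    have "j < k \<Longrightarrow> - int h \<le> n j \<and> n j \<le> int h" "1 < j \<Longrightarrow> - int h \<le> n (j - 1) \<and> n (j - 1) \<le> int h"
      using that(2) by (auto intro!: b simp del: diff_Suc_1)
    then show ?thesis by (cases "j < k"; cases "1 < j") (auto simp: tuple_coeff_def)
  qed
  have n_eqI: "n = n'" if "n \<in> freqs k h" "n' \<in> freqs k h" "\<And>j. j \<in> {1..k} \<Longrightarrow> tuple_coeff k n j = tuple_coeff k n' j" for n n'
  proof (rule PiE_ext[of _ "{1..<k}" "\<lambda>_. {-int h..int h}"])
    fix i assume i: "i \<in> {1..<k}"
    have "n i = (\<Sum>j\<in>{1..i}. tuple_coeff k n j)" using i by (intro sum_tuple_coeff_upto[symmetric]) auto
    also have "\<dots> = (\<Sum>j\<in>{1..i}. tuple_coeff k n' j)" using i by (intro sum.cong that(3)) auto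
    also have "\<dots> = n' i" using i by (intro sum_tuple_coeff_upto) auto
    finally show "n i = n' i" .
  qed (use that in \<open>auto simp: freqs_def\<close>)
  have zf: "zero_freq k \<in> freqs k h" by (auto simp: zero_freq_def freqs_def)
  have zc: "tuple_coeff k (zero_freq k) j = 0" if "j \<in> {1..k}" for j
    using that by (auto simp: tuple_coeff_def zero_freq_def)
  have inj: "inj_on f (A \<times> A)"
  proof (rule inj_onI)
    fix z w assume zw: "z \<in> A \<times> A" "w \<in> A \<times> A" "f z = f w"
    obtain x n x' n' where z: "z = ((x, n), (x', n'))" by (cases z) auto
    obtain y l y' l' where w: "w = ((y, l), (y', l'))" by (cases w) auto
    have A: "(x, n) \<in> A" "(x', n') \<in> A" "(y, l) \<in> A" "(y', l') \<in> A"
      and eq: "f ((x, n), (x', n')) = f ((y, l), (y', l'))"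
      using zw by (auto simp: z w)
    have e1: "(\<lambda>i\<in>I. case_sum x x' i) = (\<lambda>i\<in>I. case_sum y y' i)"
      and e2: "(\<lambda>i\<in>I. case_sum (tuple_coeff k n) (\<lambda>j. - tuple_coeff k n' j) i) = (\<lambda>i\<in>I. case_sum (tuple_coeff k l) (\<lambda>j. - tuple_coeff k l' j) i)"
      using eq by (auto simp: f_def)
    have j: "x j = y j" "x' j = y' j" "tuple_coeff k n j = tuple_coeff k l j" "tuple_coeff k n' j = tuple_coeff k l' j"
      if "j \<in> {1..k}" for j
      using fun_cong[OF e1, of "Inl j"] fun_cong[OF e1, of "Inr j"] fun_cong[OF e2, of "Inl j"] fun_cong[OF e2, of "Inr j"] that
      by (auto simp: I_def I1_def I2_def)
    have "x = y" by (rule PiE_ext[of _ "{1..k}" "\<lambda>_. {1..N}"]) (use A j in \<open>auto simp: A_def distinct_tuples_def\<close>)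
    moreover have "x' = y'" by (rule PiE_ext[of _ "{1..k}" "\<lambda>_. {1..N}"]) (use A j in \<open>auto simp: A_def distinct_tuples_def\<close>)
    moreover have "n = l" "n' = l'" using A by (auto intro!: n_eqI j simp: A_def)
    ultimately show "z = w" by (simp add: z w)
  qed
  have img: "f ` (A \<times> A) \<subseteq> phase_data I1 I2 N (int (2 * h))"
  proof (rule image_subsetI)
    fix z assume "z \<in> A \<times> A"
    then obtain x n x' n' where z: "z = ((x, n), (x', n'))" and A: "(x, n) \<in> A" "(x', n') \<in> A" by auto
    define X where "X = (\<lambda>i\<in>I. case_sum x x' i)"
    define U where "U = (\<lambda>i\<in>I. case_sum (tuple_coeff k n) (\<lambda>j. - tuple_coeff k n' j) i)"
    have x: "x j \<in> {1..N}" "x' j \<in> {1..N}" if "j \<in> {1..k}" for j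
      using A that by (auto simp: A_def distinct_tuples_def)
    have Xv: "X (Inl j) = x j" "X (Inr j) = x' j" "U (Inl j) = tuple_coeff k n j" "U (Inr j) = - tuple_coeff k n' j" if "j \<in> {1..k}" for j
      using that by (auto simp: X_def U_def I_def I1_def I2_def)
    have nf: "n \<in> freqs k h" "n' \<in> freqs k h" "n \<noteq> zero_freq k" using A by (auto simp: A_def)
    have "X \<in> I \<rightarrow>\<^sub>E {1..N}" unfolding X_def using x by (auto simp: I_def I1_def I2_def)
    moreover have "U \<in> I \<rightarrow>\<^sub>E {- int (2 * h)..int (2 * h)}"
      unfolding U_def restrict_PiE_iff
    proof
      fix i assume "i \<in> I"
      then obtain j where "j \<in> {1..k}" "i = Inl j \<or> i = Inr j" by (auto simp: I_def I1_def I2_def)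
      then show "case_sum (tuple_coeff k n) (\<lambda>j. - tuple_coeff k n' j) i \<in> {- int (2 * h)..int (2 * h)}"
        using frange[OF nf(1), of j] frange[OF nf(2), of j] by auto
    qed
    moreover have "inj_on X I1" "inj_on X I2"
    proof -
      have "inj_on x {1..k}" "inj_on x' {1..k}" using A by (simp_all add: A_def distinct_tuples_def)
      moreover have "inj_on (X \<circ> Inl) {1..k} \<longleftrightarrow> inj_on x {1..k}" "inj_on (X \<circ> Inr) {1..k} \<longleftrightarrow> inj_on x' {1..k}"
        by (intro inj_on_cong; simp add: Xv)+
      ultimately have "inj_on (X \<circ> Inl) {1..k}" "inj_on (X \<circ> Inr) {1..k}" by simp_all
      then show "inj_on X I1" "inj_on X I2" unfolding I1_def I2_def by (auto intro: inj_on_imageI)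
    qed
    moreover have "sum U I1 = 0" "sum U I2 = 0"
    proof -
      have "sum U I1 = (\<Sum>j\<in>{1..k}. tuple_coeff k n j)"
        unfolding I1_def by (subst sum.reindex) (auto intro!: sum.cong simp: Xv)
      then show "sum U I1 = 0" using sum_tuple_coeff_zero[of k n] k by simp
      have "sum U I2 = (\<Sum>j\<in>{1..k}. - tuple_coeff k n' j)"
        unfolding I2_def by (subst sum.reindex) (auto intro!: sum.cong simp: Xv)
      then show "sum U I2 = 0" using sum_tuple_coeff_zero[of k n'] k by (simp add: sum_negf)
    qed
    moreover have "\<exists>i\<in>I1. U i \<noteq> 0"
    proof (rule ccontr)
      assume "\<not> ?thesis"
      then have "tuple_coeff k n j = tuple_coeff k (zero_freq k) j" if "j \<in> {1..k}" for j
        using that zc[OF that] Xv[OF that] by (auto simp: I1_def)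
      then show False using n_eqI[OF nf(1) zf] nf(3) by auto
    qed
    ultimately have "(X, U) \<in> phase_data I1 I2 N (int (2 * h))"
      unfolding phase_data_def I_def by simp
    then show "f z \<in> phase_data I1 I2 N (int (2 * h))" by (simp add: f_def z X_def U_def)
  qed
  have osc: "norm (integral {a..b} (\<lambda>\<alpha>. cis (tuple_phase k n x \<alpha> - tuple_phase k n' x' \<alpha>))) =
     (case f ((x, n), (x', n')) of (X, U) \<Rightarrow> osc_int I a b X U)" for x n x' n'
  proof -
    have "tuple_phase k n x \<alpha> - tuple_phase k n' x' \<alpha> =
      2 * pi * (\<Sum>i\<in>I. real_of_int ((\<lambda>i\<in>I. case_sum (tuple_coeff k n) (\<lambda>j. - tuple_coeff k n' j) i) i) * real ((\<lambda>i\<in>I. case_sum x x' i) i) powr \<alpha>)" for \<alpha>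
    proof -
      have "(\<Sum>i\<in>I. real_of_int ((\<lambda>i\<in>I. case_sum (tuple_coeff k n) (\<lambda>j. - tuple_coeff k n' j) i) i) * real ((\<lambda>i\<in>I. case_sum x x' i) i) powr \<alpha>) =
        (\<Sum>i\<in>I. real_of_int (case_sum (tuple_coeff k n) (\<lambda>j. - tuple_coeff k n' j) i) * real (case_sum x x' i) powr \<alpha>)"
        by (intro sum.cong) auto
      also have "\<dots> = (\<Sum>j\<in>{1..k}. real_of_int (tuple_coeff k n j) * real (x j) powr \<alpha>) - (\<Sum>j\<in>{1..k}. real_of_int (tuple_coeff k n' j) * real (x' j) powr \<alpha>)"
        unfolding I_def using fin disj by (subst sum.union_disjoint) (auto simp: I1_def I2_def sum.reindex sum_negf)
      finally have eq: "(\<Sum>i\<in>I. real_of_int ((\<lambda>i\<in>I. case_sum (tuple_coeff k n) (\<lambda>j. - tuple_coeff k n' j) i) i) * real ((\<lambda>i\<in>I. case_sum x x' i) i) powr \<alpha>)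
         = (\<Sum>j\<in>{1..k}. real_of_int (tuple_coeff k n j) * real (x j) powr \<alpha>) - (\<Sum>j\<in>{1..k}. real_of_int (tuple_coeff k n' j) * real (x' j) powr \<alpha>)" .
      have k1: "1 \<le> k" using k by simp
      show ?thesis
        unfolding eq tuple_phase_def sum_tuple_coeff[OF k1] by (rule right_diff_distrib[symmetric])
    qed
    then show ?thesis by (simp add: f_def osc_int_def)
  qed
  have eqS: "corr_exp_sum k N h c \<alpha> = (\<Sum>p\<in>A. c (snd p) * cis (tuple_phase k (snd p) (fst p) \<alpha>))" for \<alpha>
    by (simp add: corr_exp_sum_def A_def case_prod_unfold)
  have "integral {a..b} (\<lambda>\<alpha>. (norm (corr_exp_sum k N h c \<alpha>))\<^sup>2)
    \<le> C\<^sup>2 * (\<Sum>(p, p')\<in>A \<times> A. norm (integral {a..b} (\<lambda>\<alpha>. cis (tuple_phase k (snd p) (fst p) \<alpha> - tuple_phase k (snd p') (fst p') \<alpha>))))"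
    unfolding eqS
    by (rule integral_norm_exp_sum_le[OF finA]) (auto simp: A_def intro: continuous_on_tuple_phase c)
  also have "(\<Sum>(p, p')\<in>A \<times> A. norm (integral {a..b} (\<lambda>\<alpha>. cis (tuple_phase k (snd p) (fst p) \<alpha> - tuple_phase k (snd p') (fst p') \<alpha>)))) =
     (\<Sum>z\<in>A \<times> A. case f z of (X, U) \<Rightarrow> osc_int I a b X U)"
    by (intro sum.cong) (auto simp: osc)
  also have "\<dots> = (\<Sum>(X, U)\<in>f ` (A \<times> A). osc_int I a b X U)"
    by (subst sum.reindex[OF inj]) (simp add: o_def)
  also have "\<dots> \<le> (\<Sum>(X, U)\<in>phase_data I1 I2 N (int (2 * h)). osc_int I a b X U)"
    by (intro sum_mono2 finite_phase_data fin img) (auto simp: osc_int_def)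
  also have "\<dots> \<le> 8 * real m * real m * 4 ^ m * (12 * real (m + 1)) ^ m * real G powr (real m - \<delta> + real m * (b - a))"
    unfolding m_def I_def by (rule moment_bound[OF fin disj card k \<beta>]) (use G ab \<delta> in auto)
  finally show ?thesis by (simp add: mult_left_mono)
qed

section \<open>Convergence to 0 along a polynomial sequence of N\<close>

text \<open>By monotone convergence the series of \<open>(norm (S m \<alpha>))^2\<close> has a
  finite integral over the interval, so it converges for almost every \<alpha> there, and its terms
  tend to 0.\<close>

lemma AE_tendsto_0_of_summable_integrals:
  fixes S :: "nat \<Rightarrow> real \<Rightarrow> complex"
  assumes cont: "\<And>m. continuous_on {a..b} (S m)"
    and V: "\<And>m. integral {a..b} (\<lambda>\<alpha>. (norm (S m \<alpha>))\<^sup>2) \<le> V m" "summable V"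
  shows "AE \<alpha> in lborel. \<alpha> \<in> {a..b} \<longrightarrow> (\<lambda>m. S m \<alpha>) \<longlonglongrightarrow> 0"
proof -
  define g where "g = (\<lambda>m \<alpha>. indicator {a..b} \<alpha> * (norm (S m \<alpha>))\<^sup>2)"
  have g0: "0 \<le> g m \<alpha>" for m \<alpha> by (simp add: g_def)
  have c2: "continuous_on {a..b} (\<lambda>\<alpha>. (norm (S m \<alpha>))\<^sup>2)" for m by (intro continuous_intros cont)
  have meas: "g m \<in> borel_measurable borel" for m
    using borel_measurable_continuous_on_indicator[OF _ c2[of m]] by (simp add: g_def)
  have nn: "(\<integral>\<^sup>+\<alpha>. ennreal (g m \<alpha>) \<partial>lborel) = ennreal (integral {a..b} (\<lambda>\<alpha>. (norm (S m \<alpha>))\<^sup>2))" for m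
  proof -
    have "((\<lambda>\<alpha>. (norm (S m \<alpha>))\<^sup>2) has_integral integral {a..b} (\<lambda>\<alpha>. (norm (S m \<alpha>))\<^sup>2)) {a..b}"
      by (intro integrable_integral integrable_continuous_interval c2)
    then have "(\<integral>\<^sup>+\<alpha>\<in>{a..b}. ennreal ((norm (S m \<alpha>))\<^sup>2) \<partial>lborel) = ennreal (integral {a..b} (\<lambda>\<alpha>. (norm (S m \<alpha>))\<^sup>2))"
      using meas[of m] by (intro nn_integral_has_integral_lebesgue') (auto simp: g_def)
    then show ?thesis by (simp add: g_def ennreal_mult' ennreal_indicator mult.commute)
  qed
  have V0: "0 \<le> V m" for m
    using order_trans[OF integral_nonneg[OF integrable_continuous_interval[OF c2]] V(1)] by auto
  have "(\<integral>\<^sup>+\<alpha>. (\<Sum>m. ennreal (g m \<alpha>)) \<partial>lborel) = (\<Sum>m. \<integral>\<^sup>+\<alpha>. ennreal (g m \<alpha>) \<partial>lborel)"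
    using meas by (intro nn_integral_suminf) auto
  also have "\<dots> \<le> (\<Sum>m. ennreal (V m))"
    unfolding nn by (intro suminf_le ennreal_leI V) auto
  also have "\<dots> = ennreal (suminf V)" by (intro suminf_ennreal2 V0 V)
  also have "\<dots> < \<infinity>" by simp
  finally have "AE \<alpha> in lborel. (\<Sum>m. ennreal (g m \<alpha>)) \<noteq> \<infinity>"
    using meas by (intro nn_integral_PInf_AE) auto
  then show ?thesis
  proof (rule AE_mp, intro AE_I2 impI)
    fix \<alpha> assume fin: "(\<Sum>m. ennreal (g m \<alpha>)) \<noteq> \<infinity>" and \<alpha>: "\<alpha> \<in> {a..b}"
    have "summable (\<lambda>m. g m \<alpha>)" using fin g0 by (intro summable_suminf_not_top) (auto simp: top_ennreal_def)
    then have "(\<lambda>m. g m \<alpha>) \<longlonglongrightarrow> 0" by (rule summable_LIMSEQ_zero)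
    then have "(\<lambda>m. sqrt (g m \<alpha>)) \<longlonglongrightarrow> 0" using tendsto_real_sqrt by fastforce
    then show "(\<lambda>m. S m \<alpha>) \<longlonglongrightarrow> 0" using \<alpha> by (simp add: g_def tendsto_norm_zero_iff)
  qed
qed

text \<open>The size required of the coefficients is that of a product of \<open>k - 1\<close>
  kernels with coefficients O(1 / N). The exceptional null set may depend on \<open>K\<close> and on
  the array \<open>c\<close>, so only countably many arrays can be used simultaneously later
  on.\<close>

definition admissible_exponent :: "nat \<Rightarrow> real \<Rightarrow> nat \<Rightarrow> bool" where
  "admissible_exponent k a0 r \<longleftrightarrow> r \<ge> 1 \<and>
    (\<forall>K c C. (\<forall>N n. N \<ge> 1 \<longrightarrow> n \<in> freqs k (K * N) \<longrightarrow> norm (c N n) \<le> C / real N ^ (k - 1)) \<longrightarrow>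
       (AE \<alpha> in lborel. \<alpha> \<ge> a0 \<longrightarrow>
         (\<lambda>m. corr_exp_sum k (Suc m ^ r) (K * Suc m ^ r) (c (Suc m ^ r)) \<alpha> / of_nat (Suc m ^ r)) \<longlonglongrightarrow> 0))"

text \<open>With coefficients O(N^(1 - k)) and the factor 1 / N the variance is at most a constant
  times \<open>N powr (- \<delta> / 2)\<close>, half of \<delta> having been spent on the length of
  the interval. Along \<open>N = (m + 1) ^ r\<close> with \<open>r \<ge> 4 / \<delta>\<close> this
  is summable, being O(1 / (m + 1)^2).\<close>

lemma admissible_exponent_exists:
  fixes k :: nat
  assumes k: "k \<ge> 2" and a0: "a0 > 4 * (real k)\<^sup>2 - 4 * real k - 1"
  shows "\<exists>r. admissible_exponent k a0 r"
proof -
  define \<beta> where "\<beta> = 1 / real (2 * k)"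
  \<comment> \<open>The margin by which \<open>a0 * \<beta>\<close> exceeds
    \<open>2 * k - 2 - \<beta>\<close>, positive exactly because \<open>a0\<close> lies above the
    threshold; it is capped at \<beta> as the moment bound requires.\<close>
  define \<delta> where "\<delta> = min \<beta> (a0 * \<beta> - (2 * real k - 2 - \<beta>))"
  have \<beta>0: "\<beta> > 0" using k by (simp add: \<beta>_def)
  have a0': "a0 > 0"
  proof -
    have "4 * (real k)\<^sup>2 - 4 * real k - 1 = 4 * real k * (real k - 1) - 1" by (simp add: power2_eq_square algebra_simps)
    moreover have "4 * 2 * 1 \<le> 4 * real k * (real k - 1)" using k by (intro mult_mono) auto
    ultimately show ?thesis using a0 by linarith
  qed
  have \<delta>0: "\<delta> > 0"
  proof -
    have "(2 * real k - 2) * (2 * real k) < a0 + 1" using a0 by (simp add: power2_eq_square algebra_simps)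
    then have "(2 * real k - 2) * (2 * real k) * \<beta> < (a0 + 1) * \<beta>" using \<beta>0 by (rule mult_strict_right_mono)
    moreover have "(2 * real k - 2) * (2 * real k) * \<beta> = 2 * real k - 2" using k by (simp add: \<beta>_def)
    ultimately show ?thesis using \<beta>0 by (simp add: \<delta>_def algebra_simps)
  qed
  \<comment> \<open>The length of the intervals of \<alpha>: the loss
    \<open>2 * k * \<epsilon>\<close> in the exponent is at most
    \<open>\<delta> / 2\<close>.\<close>
  define \<epsilon> where "\<epsilon> = min 1 (\<delta> / (4 * real k))"
  have \<epsilon>: "\<epsilon> > 0" "\<epsilon> \<le> 1" "real (2 * k) * \<epsilon> \<le> \<delta> / 2"
  proof -
    show "\<epsilon> > 0" "\<epsilon> \<le> 1" using \<delta>0 k by (auto simp: \<epsilon>_def)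
    have "real (2 * k) * \<epsilon> \<le> real (2 * k) * (\<delta> / (4 * real k))" by (intro mult_left_mono) (auto simp: \<epsilon>_def)
    then show "real (2 * k) * \<epsilon> \<le> \<delta> / 2" using k by simp
  qed
  define r where "r = nat \<lceil>4 / \<delta>\<rceil> + 1"
  have r: "r \<ge> 1" "4 / \<delta> \<le> real r" unfolding r_def by linarith+
  define Nm where "Nm = (\<lambda>m. Suc m ^ r)"
  have Nm1: "Nm m \<ge> 1" for m by (simp add: Nm_def)
  show ?thesis
    unfolding admissible_exponent_def
  proof (intro exI[of _ r] conjI r(1) allI impI)
    fix K :: nat and c :: "nat \<Rightarrow> (nat \<Rightarrow> int) \<Rightarrow> complex" and C :: real
    assume "\<forall>N n. N \<ge> 1 \<longrightarrow> n \<in> freqs k (K * N) \<longrightarrow> norm (c N n) \<le> C / real N ^ (k - 1)"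
    then have c: "norm (c N n) \<le> C / real N ^ (k - 1)" if "N \<ge> 1" "n \<in> freqs k (K * N)" for N n
      using that by blast
    define Q where "Q = 8 * real (2 * k) * real (2 * k) * 4 ^ (2 * k) * (12 * real (2 * k + 1)) ^ (2 * k)"
    define g where "g = real (4 * K + 1)"
    define V where "V = (\<lambda>m. C\<^sup>2 * Q * g powr (real (2 * k) - \<delta> / 2) * (1 / real (Suc m) ^ 2))"
    have Q0: "Q \<ge> 0" and g1: "g \<ge> 1" by (simp_all add: Q_def g_def)
    define S where "S = (\<lambda>m \<alpha>. corr_exp_sum k (Nm m) (K * Nm m) (c (Nm m)) \<alpha> / of_nat (Nm m))"
    have "summable (\<lambda>m. 1 / real (Suc m) ^ 2)"
      using inverse_squares_sums by (auto simp: sums_iff)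
    then have sumV: "summable V" unfolding V_def by (rule summable_mult)
    have contS: "continuous_on {a..b} (S m)" for m a b
      unfolding S_def using Nm1[of m] by (intro continuous_intros continuous_on_corr_exp_sum) auto
    have var: "integral {a..a + \<epsilon>} (\<lambda>\<alpha>. (norm (S m \<alpha>))\<^sup>2) \<le> V m" if a: "a \<ge> a0" for a m
    proof -
      define N where "N = Nm m"
      define G where "G = (4 * K + 1) * N"
      have N1: "N \<ge> 1" using Nm1 by (simp add: N_def)
      have G: "N \<le> G" "4 * (K * N) + 1 \<le> G" using N1 by (auto simp: G_def)
      have "integral {a..a + \<epsilon>} (\<lambda>\<alpha>. (norm (corr_exp_sum k N (K * N) (c N) \<alpha>))\<^sup>2)
        \<le> (C / real N ^ (k - 1))\<^sup>2 * (Q * real G powr (real (2 * k) - \<delta> + real (2 * k) * (a + \<epsilon> - a)))"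
        unfolding Q_def
      proof (rule corr_exp_sum_variance[OF k \<beta>_def G])
        show "0 \<le> a" "a \<le> a + \<epsilon>" "a + \<epsilon> - a \<le> 1" using a a0' \<epsilon> by auto
        show "\<delta> \<le> \<beta>" by (simp add: \<delta>_def)
        have "a0 * \<beta> \<le> a * \<beta>" using a \<beta>0 by simp
        then show "2 * real k - 2 - \<beta> + \<delta> \<le> a * \<beta>" by (simp add: \<delta>_def min_def split: if_splits)
        show "norm (c N n) \<le> C / real N ^ (k - 1)" if "n \<in> freqs k (K * N)" for n using c[OF N1 that] .
      qed
      also have "\<dots> \<le> (C / real N ^ (k - 1))\<^sup>2 * (Q * real G powr (real (2 * k) - \<delta> / 2))"
        using G N1 \<epsilon>(3) Q0 by (intro mult_left_mono powr_mono) auto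
      also have "real G powr (real (2 * k) - \<delta> / 2) = g powr (real (2 * k) - \<delta> / 2) * real N powr (real (2 * k) - \<delta> / 2)"
        unfolding G_def g_def of_nat_mult by (rule powr_mult)
      finally have 1: "integral {a..a + \<epsilon>} (\<lambda>\<alpha>. (norm (corr_exp_sum k N (K * N) (c N) \<alpha>))\<^sup>2) / (real N)\<^sup>2
         \<le> (C / real N ^ (k - 1))\<^sup>2 * (Q * (g powr (real (2 * k) - \<delta> / 2) * real N powr (real (2 * k) - \<delta> / 2))) / (real N)\<^sup>2"
        by (intro divide_right_mono) auto
      have "(C / real N ^ (k - 1))\<^sup>2 * (Q * (g powr (real (2 * k) - \<delta> / 2) * real N powr (real (2 * k) - \<delta> / 2))) / (real N)\<^sup>2
        = C\<^sup>2 * Q * g powr (real (2 * k) - \<delta> / 2) * (real N powr (real (2 * k) - \<delta> / 2) / ((real N ^ (k - 1))\<^sup>2 * (real N)\<^sup>2))"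
        by (simp add: power_divide)
      also have "(real N ^ (k - 1))\<^sup>2 * (real N)\<^sup>2 = real N powr real (2 * k)"
      proof -
        have "real N ^ (k - 1) * real N = real N ^ k" using k by (intro power_minus_mult) auto
        then have "(real N ^ (k - 1))\<^sup>2 * (real N)\<^sup>2 = real N ^ (2 * k)"
          by (metis power_mult_distrib power_mult mult.commute)
        then show ?thesis using N1 by (simp only: powr_realpow)
      qed
      also have "real N powr (real (2 * k) - \<delta> / 2) / real N powr real (2 * k) = real N powr (- \<delta> / 2)"
        by (simp add: powr_diff[symmetric])
      also have "real N powr (- \<delta> / 2) \<le> 1 / real (Suc m) ^ 2"
      proof -
        have "real N = real (Suc m) powr real r" by (simp add: N_def Nm_def powr_realpow)
        then have "real N powr (- \<delta> / 2) = real (Suc m) powr (- (real r * (\<delta> / 2)))" by (simp add: powr_powr)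
        also have "\<dots> \<le> real (Suc m) powr (- 2)"
        proof (intro powr_mono)
          have "4 / \<delta> * (\<delta> / 2) \<le> real r * (\<delta> / 2)" using r(2) \<delta>0 by (intro mult_right_mono) auto
          then show "- (real r * (\<delta> / 2)) \<le> - 2" using \<delta>0 by simp
        qed auto
        also have "\<dots> = 1 / real (Suc m) ^ 2" by (simp add: powr_minus powr_numeral divide_inverse)
        finally show ?thesis .
      qed
      finally have 2: "(C / real N ^ (k - 1))\<^sup>2 * (Q * (g powr (real (2 * k) - \<delta> / 2) * real N powr (real (2 * k) - \<delta> / 2))) / (real N)\<^sup>2 \<le> V m"
        unfolding V_def using Q0 by (simp add: mult_left_mono)
      have "integral {a..a + \<epsilon>} (\<lambda>\<alpha>. (norm (S m \<alpha>))\<^sup>2) = integral {a..a + \<epsilon>} (\<lambda>\<alpha>. (norm (corr_exp_sum k N (K * N) (c N) \<alpha>))\<^sup>2 / (real N)\<^sup>2)"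
        by (simp add: S_def N_def norm_divide power_divide)
      then show ?thesis using 1 2 by simp
    qed
    \<comment> \<open>Countably many intervals of length \<epsilon> cover the half-line from
      \<open>a0\<close> on. The same \<delta>, \<epsilon> and \<open>r\<close> serve all of them,
      since the condition on \<open>a\<close> only becomes easier as \<open>a\<close> grows.\<close>
    have "AE \<alpha> in lborel. \<alpha> \<in> {a0 + real j * \<epsilon>..a0 + real j * \<epsilon> + \<epsilon>} \<longrightarrow> (\<lambda>m. S m \<alpha>) \<longlonglongrightarrow> 0" for j
      using \<epsilon> by (intro AE_tendsto_0_of_summable_integrals[OF contS var sumV]) auto
    then have "AE \<alpha> in lborel. \<forall>j::nat. \<alpha> \<in> {a0 + real j * \<epsilon>..a0 + real j * \<epsilon> + \<epsilon>} \<longrightarrow> (\<lambda>m. S m \<alpha>) \<longlonglongrightarrow> 0"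
      by (simp only: AE_all_countable) auto
    then have "AE \<alpha> in lborel. \<alpha> \<ge> a0 \<longrightarrow> (\<lambda>m. S m \<alpha>) \<longlonglongrightarrow> 0"
    proof (rule AE_mp, intro AE_I2 impI)
      fix \<alpha> assume *: "\<forall>j::nat. \<alpha> \<in> {a0 + real j * \<epsilon>..a0 + real j * \<epsilon> + \<epsilon>} \<longrightarrow> (\<lambda>m. S m \<alpha>) \<longlonglongrightarrow> 0" and \<alpha>: "a0 \<le> \<alpha>"
      define j where "j = nat \<lfloor>(\<alpha> - a0) / \<epsilon>\<rfloor>"
      have "0 \<le> (\<alpha> - a0) / \<epsilon>" using \<alpha> \<epsilon> by simp
      then have "real j \<le> (\<alpha> - a0) / \<epsilon>" "(\<alpha> - a0) / \<epsilon> \<le> real j + 1" unfolding j_def by linarith+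
      then have "\<alpha> \<in> {a0 + real j * \<epsilon>..a0 + real j * \<epsilon> + \<epsilon>}" using \<epsilon> by (simp add: field_simps)
      then show "(\<lambda>m. S m \<alpha>) \<longlonglongrightarrow> 0" using * by blast
    qed
    then show "AE \<alpha> in lborel. \<alpha> \<ge> a0 \<longrightarrow>
         (\<lambda>m. corr_exp_sum k (Suc m ^ r) (K * Suc m ^ r) (c (Suc m ^ r)) \<alpha> / of_nat (Suc m ^ r)) \<longlonglongrightarrow> 0"
      by (simp only: S_def Nm_def)
  qed
qed

subsection \<open>Fejer kernels\<close>

lemma prod_cis: "(\<Prod>j\<in>A. cis (g j)) = cis (\<Sum>j\<in>A. g j)"
  by (induction A rule: infinite_finite_induct) (auto simp: cis_mult)

definition trig_poly :: "nat \<Rightarrow> (int \<Rightarrow> complex) \<Rightarrow> (real \<Rightarrow> real) \<Rightarrow> bool" where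
  "trig_poly h e T \<longleftrightarrow> (\<forall>t. complex_of_real (T t) = (\<Sum>n\<in>{-int h..int h}. e n * cis (2 * pi * real_of_int n * t)))"

lemma prod_trig_poly:
  assumes "\<And>j. j \<in> {1..<k} \<Longrightarrow> trig_poly h (e j) (T j)"
  shows "complex_of_real (\<Prod>j\<in>{1..<k}. T j (y j)) =
    (\<Sum>n\<in>freqs k h. (\<Prod>j\<in>{1..<k}. e j (n j)) * cis (2 * pi * (\<Sum>j\<in>{1..<k}. real_of_int (n j) * y j)))"
proof -
  have "complex_of_real (\<Prod>j\<in>{1..<k}. T j (y j)) = (\<Prod>j\<in>{1..<k}. \<Sum>n\<in>{-int h..int h}. e j n * cis (2 * pi * real_of_int n * y j))"
    using assms by (simp add: trig_poly_def)
  also have "\<dots> = (\<Sum>n\<in>freqs k h. \<Prod>j\<in>{1..<k}. e j (n j) * cis (2 * pi * real_of_int (n j) * y j))"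
    unfolding freqs_def by (rule prod_sum_PiE) auto
  finally show ?thesis
    by (simp add: prod.distrib prod_cis sum_distrib_left mult.assoc)
qed

lemma sum_prod_trig_poly:
  assumes T: "\<And>j. j \<in> {1..<k} \<Longrightarrow> trig_poly h (e j) (T j)"
  shows "complex_of_real (\<Sum>x\<in>distinct_tuples k N. \<Prod>j\<in>{1..<k}. T j (real (x j) powr \<alpha> - real (x (j + 1)) powr \<alpha>)) =
    of_nat (card (distinct_tuples k N)) * (\<Prod>j\<in>{1..<k}. e j 0) + corr_exp_sum k N h (\<lambda>n. \<Prod>j\<in>{1..<k}. e j (n j)) \<alpha>"
proof -
  define c where "c = (\<lambda>n. \<Prod>j\<in>{1..<k}. e j (n j))"
  have zf: "zero_freq k \<in> freqs k h" by (auto simp: zero_freq_def freqs_def)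
  have z: "tuple_phase k (zero_freq k) x \<alpha> = 0" for x by (simp add: tuple_phase_def zero_freq_def)
  have cz: "c (zero_freq k) = (\<Prod>j\<in>{1..<k}. e j 0)" by (simp add: c_def zero_freq_def)
  have "complex_of_real (\<Sum>x\<in>distinct_tuples k N. \<Prod>j\<in>{1..<k}. T j (real (x j) powr \<alpha> - real (x (j + 1)) powr \<alpha>)) =
     (\<Sum>x\<in>distinct_tuples k N. \<Sum>n\<in>freqs k h. c n * cis (tuple_phase k n x \<alpha>))"
    unfolding of_real_sum
    by (intro sum.cong refl) (subst prod_trig_poly[OF T], auto simp: c_def tuple_phase_def)
  also have "\<dots> = (\<Sum>x\<in>distinct_tuples k N. c (zero_freq k) + (\<Sum>n\<in>freqs k h - {zero_freq k}. c n * cis (tuple_phase k n x \<alpha>)))"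
    using zf by (intro sum.cong refl) (subst sum.remove[of _ "zero_freq k"], auto simp: z)
  also have "\<dots> = of_nat (card (distinct_tuples k N)) * c (zero_freq k) + corr_exp_sum k N h c \<alpha>"
    unfolding corr_exp_sum_def by (simp add: sum.distrib sum.cartesian_product)
  finally show ?thesis unfolding cz by (simp add: c_def)
qed

text \<open>A tuple that is not injective has equal entries at some pair of indices; there are at
  most \<open>k ^ 2\<close> such pairs and at most \<open>N ^ (k - 1)\<close> tuples for
  each.\<close>

lemma card_distinct_tuples_bounds:
  shows "card (distinct_tuples k N) \<le> N ^ k"
    and "real N ^ k - real k ^ 2 * real N ^ (k - 1) \<le> real (card (distinct_tuples k N))"
proof -
  define P where "P = {1..k} \<rightarrow>\<^sub>E {1..N}"
  have finP: "finite P" by (auto simp: P_def intro!: finite_PiE)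
  have cP: "card P = N ^ k" by (simp add: P_def card_PiE)
  have sub: "distinct_tuples k N \<subseteq> P" by (auto simp: distinct_tuples_def P_def)
  show "card (distinct_tuples k N) \<le> N ^ k" using card_mono[OF finP sub] cP by simp
  define Q where "Q = (\<lambda>(i, j). {x \<in> P. x i = x j})"
  define D where "D = {(i, j). i \<in> {1..k} \<and> j \<in> {1..k} \<and> i \<noteq> j}"
  have D: "D \<subseteq> {1..k} \<times> {1..k}" "finite D" by (auto simp: D_def intro: finite_subset[of _ "{1..k} \<times> {1..k}"])
  have cQ: "card (Q d) \<le> N ^ (k - 1)" if "d \<in> D" for d
  proof -
    obtain i j where d: "d = (i, j)" "i \<in> {1..k}" "j \<in> {1..k}" "i \<noteq> j" using \<open>d \<in> D\<close> by (auto simp: D_def)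
    have "inj_on (\<lambda>x. restrict x ({1..k} - {j})) (Q d)"
    proof (rule inj_onI)
      fix x y assume xy: "x \<in> Q d" "y \<in> Q d" "restrict x ({1..k} - {j}) = restrict y ({1..k} - {j})"
      have e: "x l = y l" if "l \<in> {1..k}" "l \<noteq> j" for l using fun_cong[OF xy(3), of l] that by auto
      have "x l = y l" if "l \<in> {1..k}" for l
        using e[OF that] e[OF d(2,4)] xy by (cases "l = j") (auto simp: Q_def d)
      then show "x = y" using xy by (intro PiE_ext[of x "{1..k}" "\<lambda>_. {1..N}"]) (auto simp: Q_def d P_def)
    qed
    moreover have "(\<lambda>x. restrict x ({1..k} - {j})) ` Q d \<subseteq> ({1..k} - {j}) \<rightarrow>\<^sub>E {1..N}"
    proof (rule image_subsetI)
      fix x assume "x \<in> Q d"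
      then have "x \<in> {1..k} \<rightarrow>\<^sub>E {1..N}" by (simp add: Q_def d P_def)
      then show "restrict x ({1..k} - {j}) \<in> ({1..k} - {j}) \<rightarrow>\<^sub>E {1..N}"
        unfolding restrict_PiE_iff using PiE_mem[of x "{1..k}" "\<lambda>_. {1..N}"] by blast
    qed
    ultimately have "card (Q d) \<le> card (({1..k} - {j}) \<rightarrow>\<^sub>E {1..N})"
      by (rule card_inj_on_le) (auto intro!: finite_PiE)
    also have "\<dots> = N ^ (k - 1)" using d by (simp add: card_PiE)
    finally show ?thesis .
  qed
  have "P - distinct_tuples k N \<subseteq> (\<Union>d\<in>D. Q d)"
  proof
    fix x assume "x \<in> P - distinct_tuples k N"
    then obtain i j where "x \<in> P" "i \<in> {1..k}" "j \<in> {1..k}" "i \<noteq> j" "x i = x j"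
      by (auto simp: distinct_tuples_def P_def inj_on_def)
    then have "(i, j) \<in> D" "x \<in> Q (i, j)" by (auto simp: D_def Q_def)
    then show "x \<in> (\<Union>d\<in>D. Q d)" by blast
  qed
  then have "card (P - distinct_tuples k N) \<le> card (\<Union>d\<in>D. Q d)"
    using D finP by (intro card_mono) (auto simp: Q_def split: prod.splits)
  also have "\<dots> \<le> (\<Sum>d\<in>D. card (Q d))" by (rule card_UN_le[OF D(2)])
  also have "\<dots> \<le> (\<Sum>d\<in>D. N ^ (k - 1))" by (rule sum_mono) (rule cQ)
  also have "\<dots> = card D * N ^ (k - 1)" by simp
  also have "\<dots> \<le> k ^ 2 * N ^ (k - 1)"
    using card_mono[OF _ D(1)] by (intro mult_right_mono) (auto simp: card_cartesian_product power2_eq_square)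
  finally have "card (P - distinct_tuples k N) \<le> k ^ 2 * N ^ (k - 1)" .
  moreover have "card (P - distinct_tuples k N) = N ^ k - card (distinct_tuples k N)"
    using sub finP cP by (simp add: card_Diff_subset finite_subset)
  ultimately have "N ^ k \<le> k ^ 2 * N ^ (k - 1) + card (distinct_tuples k N)" by linarith
  then have "real (N ^ k) \<le> real (k ^ 2 * N ^ (k - 1) + card (distinct_tuples k N))" by (simp only: of_nat_le_iff)
  then show "real N ^ k - real k ^ 2 * real N ^ (k - 1) \<le> real (card (distinct_tuples k N))" by simp
qed

lemma card_distinct_tuples_asymp:
  assumes "k \<ge> 1"
  shows "(\<lambda>N. real (card (distinct_tuples k N)) / real N ^ k) \<longlonglongrightarrow> 1"
proof (rule tendsto_sandwich)
  show "\<forall>\<^sub>F N in sequentially. 1 - real k ^ 2 / real N \<le> real (card (distinct_tuples k N)) / real N ^ k"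
  proof (intro eventually_sequentiallyI[of 1])
    fix N :: nat assume N: "1 \<le> N"
    have e: "real N ^ k = real N ^ (k - 1) * real N" using assms power_minus_mult[of k "real N"] by simp
    have "1 - real k ^ 2 / real N = (real N ^ k - real k ^ 2 * real N ^ (k - 1)) / real N ^ k"
      unfolding e using N by (simp add: field_simps)
    also have "\<dots> \<le> real (card (distinct_tuples k N)) / real N ^ k"
      using card_distinct_tuples_bounds(2) by (intro divide_right_mono) auto
    finally show "1 - real k ^ 2 / real N \<le> real (card (distinct_tuples k N)) / real N ^ k" .
  qed
  show "\<forall>\<^sub>F N in sequentially. real (card (distinct_tuples k N)) / real N ^ k \<le> 1"
  proof (intro eventually_sequentiallyI[of 1])
    fix N :: nat assume N: "1 \<le> N"
    have "real (card (distinct_tuples k N)) \<le> real (N ^ k)"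
      using card_distinct_tuples_bounds(1)[of k N] by (simp only: of_nat_le_iff)
    then show "real (card (distinct_tuples k N)) / real N ^ k \<le> 1" using N by simp
  qed
  show "(\<lambda>N. 1 - real k ^ 2 / real N) \<longlonglongrightarrow> 1"
    using tendsto_diff[OF tendsto_const tendsto_divide_0[OF tendsto_const filterlim_real_at_infinity_sequentially], of 1] by simp
qed auto

section \<open>Size, periodicity and partition of unity of the Fejer kernel\<close>

text \<open>Normalized to the value 1 at 0 instead of to mean 1. For \<open>H \<ge> 1\<close> the
  mean is \<open>1 / H\<close>, and the \<open>H\<close> translates by multiples of
  \<open>1 / H\<close> form a partition of unity.\<close>

definition fejer :: "nat \<Rightarrow> real \<Rightarrow> real" where
  "fejer H t = (norm (\<Sum>a<H. cis (2 * pi * real a * t)))\<^sup>2 / (real H)\<^sup>2"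

text \<open>Counts how often a frequency occurs when the square is expanded; the value is
  \<open>(H - \<bar>n\<bar>) / H^2\<close> for \<open>\<bar>n\<bar> \<le> H\<close>.\<close>

definition fejer_coeff :: "nat \<Rightarrow> int \<Rightarrow> real" where
  "fejer_coeff H n = real (card {(a, b) \<in> {..<H} \<times> {..<H}. int a - int b = n}) / (real H)\<^sup>2"

lemma fejer_nonneg [simp]: "0 \<le> fejer H t"
  by (simp add: fejer_def)

lemma fejer_double_sum:
  "complex_of_real (fejer H t) = (\<Sum>(a, b)\<in>{..<H} \<times> {..<H}. cis (2 * pi * (real a - real b) * t)) / (of_nat H)\<^sup>2"
proof -
  have "complex_of_real ((norm (\<Sum>a<H. cis (2 * pi * real a * t)))\<^sup>2) = (\<Sum>a<H. cis (2 * pi * real a * t)) * cnj (\<Sum>a<H. cis (2 * pi * real a * t))"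
    by (rule complex_norm_square)
  also have "\<dots> = (\<Sum>(a, b)\<in>{..<H} \<times> {..<H}. cis (2 * pi * real a * t) * cis (- (2 * pi * real b * t)))"
    by (simp add: sum_product sum.cartesian_product cis_cnj[symmetric])
  also have "\<dots> = (\<Sum>(a, b)\<in>{..<H} \<times> {..<H}. cis (2 * pi * (real a - real b) * t))"
    by (intro sum.cong) (auto simp: cis_mult algebra_simps)
  finally show ?thesis by (simp add: fejer_def)
qed

lemma fejer_trig_poly:
  assumes "H \<le> h"
  shows "trig_poly h (\<lambda>n. of_real (fejer_coeff H n)) (fejer H)"
  unfolding trig_poly_def
proof
  fix t
  have "(\<Sum>(a, b)\<in>{..<H} \<times> {..<H}. cis (2 * pi * (real a - real b) * t)) =
    (\<Sum>n\<in>{-int h..int h}. \<Sum>p\<in>{p \<in> {..<H} \<times> {..<H}. int (fst p) - int (snd p) = n}. cis (2 * pi * (real (fst p) - real (snd p)) * t))"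
    using assms by (subst sum.group) (auto simp: case_prod_unfold)
  also have "\<dots> = (\<Sum>n\<in>{-int h..int h}. of_nat (card {(a, b) \<in> {..<H} \<times> {..<H}. int a - int b = n}) * cis (2 * pi * real_of_int n * t))"
  proof (intro sum.cong refl)
    fix n
    have "real (fst p) - real (snd p) = real_of_int n" if "int (fst p) - int (snd p) = n" for p using that by auto
    then have "(\<Sum>p\<in>{p \<in> {..<H} \<times> {..<H}. int (fst p) - int (snd p) = n}. cis (2 * pi * (real (fst p) - real (snd p)) * t)) =
      (\<Sum>p\<in>{p \<in> {..<H} \<times> {..<H}. int (fst p) - int (snd p) = n}. cis (2 * pi * real_of_int n * t))"
      by (intro sum.cong) auto
    then show "(\<Sum>p\<in>{p \<in> {..<H} \<times> {..<H}. int (fst p) - int (snd p) = n}. cis (2 * pi * (real (fst p) - real (snd p)) * t)) =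
      of_nat (card {(a, b) \<in> {..<H} \<times> {..<H}. int a - int b = n}) * cis (2 * pi * real_of_int n * t)"
    proof -
      have "{(a, b) \<in> {..<H} \<times> {..<H}. int a - int b = n} = {p \<in> {..<H} \<times> {..<H}. int (fst p) - int (snd p) = n}" by auto
      then show ?thesis using \<open>_ = (\<Sum>p\<in>_. cis (2 * pi * real_of_int n * t))\<close> by simp
    qed
  qed
  finally show "complex_of_real (fejer H t) = (\<Sum>n\<in>{-int h..int h}. of_real (fejer_coeff H n) * cis (2 * pi * real_of_int n * t))"
    unfolding fejer_double_sum by (simp add: fejer_coeff_def sum_divide_distrib)
qed

lemma fejer_coeff_bounds:
  assumes "H \<ge> 1"
  shows "0 \<le> fejer_coeff H n" "fejer_coeff H n \<le> 1 / real H" "fejer_coeff H 0 = 1 / real H"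
proof -
  show "0 \<le> fejer_coeff H n" by (simp add: fejer_coeff_def)
  have "card {(a, b) \<in> {..<H} \<times> {..<H}. int a - int b = n} \<le> card {..<H}"
    by (rule card_inj_on_le[of fst]) (auto simp: inj_on_def)
  then have "fejer_coeff H n \<le> real H / (real H)\<^sup>2"
    unfolding fejer_coeff_def by (intro divide_right_mono) auto
  then show "fejer_coeff H n \<le> 1 / real H" using assms by (simp add: power2_eq_square)
  have "card {(a, b) \<in> {..<H} \<times> {..<H}. int a - int b = 0} = card {..<H}"
    by (rule bij_betw_same_card[of fst]) (auto simp: bij_betw_def inj_on_def image_iff)
  then show "fejer_coeff H 0 = 1 / real H" using assms by (simp add: fejer_coeff_def power2_eq_square)
qed

lemma trig_poly_shift:
  assumes "trig_poly h e T"
  shows "trig_poly h (\<lambda>n. e n * cis (- (2 * pi * real_of_int n * s))) (\<lambda>t. T (t - s))"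
  using assms unfolding trig_poly_def by (auto simp: mult.assoc cis_mult algebra_simps intro!: sum.cong)

lemma trig_poly_weighted_sum:
  assumes "\<And>l. l \<in> L \<Longrightarrow> trig_poly h (e l) (T l)"
  shows "trig_poly h (\<lambda>n. \<Sum>l\<in>L. of_real (w l) * e l n) (\<lambda>t. \<Sum>l\<in>L. w l * T l t)"
  using assms unfolding trig_poly_def
  by (auto simp: sum_distrib_left sum_distrib_right mult.assoc sum.swap[of _ L])

lemma fejer_periodic: "fejer H (t + of_int z) = fejer H t"
proof -
  have "cis (2 * pi * real a * (t + of_int z)) = cis (2 * pi * real a * t)" for a
  proof -
    have "2 * pi * real a * (t + of_int z) = 2 * pi * real a * t + 2 * pi * real_of_int (int a * z)" by (simp add: algebra_simps)
    also have "cis \<dots> = cis (2 * pi * real a * t)" unfolding cis_mult[symmetric] by (subst cis_multiple_2pi) auto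
    finally show ?thesis .
  qed
  then show ?thesis by (simp add: fejer_def)
qed

lemma norm_cis_minus_one_ge:
  assumes "\<bar>t\<bar> \<le> 1 / 2"
  shows "2 * \<bar>t\<bar> \<le> norm (cis (2 * pi * t) - 1)"
proof -
  have main: "s \<le> sin (pi * s)" if s: "0 \<le> s" "s \<le> 1 / 2" for s
  proof -
    define x where "x = pi * s"
    \<comment> \<open>Since \<open>x = pi * s\<close> is at most 2, the Taylor bound
      \<open>x - x ^ 3 / 6\<close> is at least \<open>x / 3\<close>, and \<open>pi > 3\<close> makes
      this at least \<open>s\<close>.\<close>
    have x: "0 \<le> x" "x \<le> 2" using s pi_less_4 mult_mono[of pi 4 s "1/2"] by (auto simp: x_def)
    have "\<bar>sin x - (\<Sum>m<3. sin_coeff m * x ^ m)\<bar> \<le> inverse (fact 3) * \<bar>x\<bar> ^ 3" by (rule Maclaurin_sin_bound)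
    then have "\<bar>sin x - x\<bar> \<le> x ^ 3 / 6"
      using x by (simp add: sin_coeff_def numeral_3_eq_3 eval_nat_numeral)
    moreover have "x ^ 3 \<le> 4 * x"
    proof -
      have "x * x \<le> 2 * 2" using x by (intro mult_mono) auto
      then have "(x * x) * x \<le> 4 * x" using x by (intro mult_right_mono) auto
      then show ?thesis by (simp add: power3_eq_cube)
    qed
    ultimately have "x / 3 \<le> sin x" by linarith
    moreover have "3 * s \<le> x" unfolding x_def using pi_gt3 s by (intro mult_right_mono) auto
    ultimately show ?thesis by (simp add: x_def)
  qed
  have "\<bar>t\<bar> \<le> \<bar>sin (pi * t)\<bar>"
  proof (cases "t \<ge> 0")
    case True
    then show ?thesis using main[of t] assms by auto
  next
    case False
    then show ?thesis using main[of "- t"] assms by auto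
  qed
  moreover have "norm (cis (2 * pi * t) - 1) = 2 * \<bar>sin (pi * t)\<bar>"
    using dist_exp_i_1[of "2 * pi * t"] by (simp add: cis_conv_exp)
  ultimately show ?thesis by simp
qed

lemma fejer_le_half:
  assumes "t \<noteq> 0" "\<bar>t\<bar> \<le> 1 / 2"
  shows "fejer H t \<le> 1 / (real H * t)\<^sup>2"
proof -
  define w where "w = cis (2 * pi * t)"
  have w: "2 * \<bar>t\<bar> \<le> norm (w - 1)" unfolding w_def by (rule norm_cis_minus_one_ge) fact
  then have "w \<noteq> 1" using assms(1) by auto
  have "(\<Sum>a<H. cis (2 * pi * real a * t)) = (\<Sum>a<H. w ^ a)"
  proof (intro sum.cong refl)
    fix a show "cis (2 * pi * real a * t) = w ^ a"
      using Complex.DeMoivre[of "2 * pi * t" a] by (simp only: w_def mult_ac)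
  qed
  also have "\<dots> = (w ^ H - 1) / (w - 1)" using \<open>w \<noteq> 1\<close> by (rule geometric_sum)
  finally have "norm (\<Sum>a<H. cis (2 * pi * real a * t)) = norm (w ^ H - 1) / norm (w - 1)" by (simp add: norm_divide)
  also have "\<dots> \<le> 2 / (2 * \<bar>t\<bar>)"
  proof (intro frac_le)
    have "norm (w ^ H - 1) \<le> norm (w ^ H) + norm (1::complex)" by (rule norm_triangle_ineq4)
    then show "norm (w ^ H - 1) \<le> 2" by (simp add: w_def norm_power)
  qed (use w assms in auto)
  finally have "norm (\<Sum>a<H. cis (2 * pi * real a * t)) \<le> 1 / \<bar>t\<bar>" by simp
  then have "(norm (\<Sum>a<H. cis (2 * pi * real a * t)))\<^sup>2 \<le> (1 / \<bar>t\<bar>)\<^sup>2" by (intro power_mono) auto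
  then have "fejer H t \<le> (1 / \<bar>t\<bar>)\<^sup>2 / (real H)\<^sup>2" unfolding fejer_def by (intro divide_right_mono) auto
  then show ?thesis by (simp add: power_divide power_mult_distrib mult.commute)
qed

text \<open>The difference between a point of the central period and a grid node can exceed 1 / 2.
  If \<open>1 / 2 < \<bar>t\<bar> \<le> 3 / 4\<close>, the translate \<open>s\<close> of
  \<open>t\<close> by 1 towards 0 satisfies
  \<open>\<bar>s\<bar> \<ge> 1 / 4 \<ge> \<bar>t\<bar> / 3\<close>, which produces the factor 9 =
  3^2.\<close>

lemma fejer_le:
  assumes "t \<noteq> 0" "\<bar>t\<bar> \<le> 3 / 4"
  shows "fejer H t \<le> 9 / (real H * t)\<^sup>2"
proof -
  have *: "fejer H t \<le> 9 / (real H * t)\<^sup>2" if s: "fejer H t = fejer H s" "s \<noteq> 0" "\<bar>s\<bar> \<le> 1 / 2" "\<bar>t\<bar> \<le> 3 * \<bar>s\<bar>" for s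
  proof (cases "H = 0")
    case False
    have "fejer H t \<le> 1 / (real H * s)\<^sup>2" using fejer_le_half s by simp
    also have "\<dots> = 9 / (real H * (3 * s))\<^sup>2" by (simp add: power_mult_distrib)
    also have "\<dots> \<le> 9 / (real H * t)\<^sup>2"
    proof (intro divide_left_mono)
      have "(real H * \<bar>t\<bar>)\<^sup>2 \<le> (real H * (3 * \<bar>s\<bar>))\<^sup>2" using s by (intro power_mono mult_left_mono) auto
      then show "(real H * t)\<^sup>2 \<le> (real H * (3 * s))\<^sup>2" by (simp add: power_mult_distrib)
    qed (use s assms False in auto)
    finally show ?thesis .
  qed (simp add: fejer_def)
  consider "\<bar>t\<bar> \<le> 1 / 2" | "t > 1 / 2" | "t < - 1 / 2" by linarith
  then show ?thesis
  proof cases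
    case 1 then show ?thesis using assms by (intro *[of t]) auto
  next
    case 2 then show ?thesis using assms fejer_periodic[of H t "-1"] by (intro *[of "t - 1"]) auto
  next
    case 3 then show ?thesis using assms fejer_periodic[of H t 1] by (intro *[of "t + 1"]) auto
  qed
qed

lemma fejer_ge:
  assumes "\<bar>t\<bar> \<le> 1 / (6 * real H)" "H \<ge> 1"
  shows "1 / 4 \<le> fejer H t"
proof -
  have c: "1 / 2 \<le> cos (2 * pi * real a * t)" if "a < H" for a
  proof -
    have "\<bar>2 * pi * real a * t\<bar> = 2 * pi * (real a * \<bar>t\<bar>)" by (simp add: abs_mult)
    also have "\<dots> \<le> 2 * pi * (real H * (1 / (6 * real H)))"
      using that assms by (intro mult_left_mono mult_mono) auto
    also have "\<dots> = pi / 3" using assms by simp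
    finally have "cos (pi / 3) \<le> cos \<bar>2 * pi * real a * t\<bar>" by (intro cos_monotone_0_pi_le) auto
    then show ?thesis by (simp add: cos_60)
  qed
  have "real H / 2 = (\<Sum>a<H. 1 / 2)" by simp
  also have "\<dots> \<le> (\<Sum>a<H. cos (2 * pi * real a * t))" using c by (intro sum_mono) auto
  also have "\<dots> = Re (\<Sum>a<H. cis (2 * pi * real a * t))" by simp
  also have "\<dots> \<le> norm (\<Sum>a<H. cis (2 * pi * real a * t))" by (rule complex_Re_le_cmod)
  finally have "(real H / 2)\<^sup>2 \<le> (norm (\<Sum>a<H. cis (2 * pi * real a * t)))\<^sup>2" by (intro power_mono) auto
  then have "(real H / 2)\<^sup>2 / (real H)\<^sup>2 \<le> fejer H t" unfolding fejer_def by (intro divide_right_mono) auto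
  then show ?thesis using assms by (simp add: power_divide)
qed

text \<open>In the expanded square, summation over a full set of shifts is the orthogonality of the
  \<open>H\<close>-th roots of unity: only \<open>a = b\<close> survives, because
  \<open>\<bar>a - b\<bar> < H\<close>. The window of nodes may start at any
  \<open>c\<close>.\<close>

lemma sum_fejer_shifts:
  assumes H: "H \<ge> 1"
  shows "(\<Sum>l\<in>{c..<c + int H}. fejer H (t - real_of_int l / real H)) = 1"
proof -
  have inner: "(\<Sum>l\<in>{c..<c + int H}. cis (2 * pi * (real a - real b) * (t - real_of_int l / real H))) = (if a = b then of_nat H else 0)"
    if ab: "a < H" "b < H" for a b
  proof (cases "a = b")
    case False
    define w where "w = cis (- (2 * pi * (real a - real b) / real H))"
    have "w \<noteq> 1"
    proof
      assume "w = 1"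
      then obtain n where n: "- (2 * pi * (real a - real b) / real H) = of_int n * (2 * pi)" by (auto simp: w_def cis_eq_1_iff)
      then have "2 * pi * ((real b - real a) / real H) = 2 * pi * of_int n" by (simp add: algebra_simps diff_divide_distrib)
      then have "(real b - real a) / real H = of_int n" by (subst (asm) mult_left_cancel) auto
      then have "real b - real a = of_int n * real H" using H by (simp add: field_simps)
      then have "real_of_int (int b - int a) = real_of_int (n * int H)" by simp
      then have e: "int b - int a = n * int H" by (simp only: of_int_eq_iff)
      then have "int H dvd int b - int a" by simp
      then have "\<bar>int H\<bar> \<le> \<bar>int b - int a\<bar>" using False by (intro dvd_imp_le_int) auto
      then show False using ab by auto
    qed
    have wH: "w ^ H = 1"
    proof -
      have "real H * - (2 * pi * (real a - real b) / real H) = 2 * pi * real_of_int (int b - int a)"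
        using H by (simp add: field_simps)
      then have "w ^ H = cis (2 * pi * real_of_int (int b - int a))" by (simp only: w_def Complex.DeMoivre)
      then show ?thesis by (simp add: cis_multiple_2pi)
    qed
    have "(\<Sum>l\<in>{c..<c + int H}. cis (2 * pi * (real a - real b) * (t - real_of_int l / real H))) =
      (\<Sum>i<H. cis (2 * pi * (real a - real b) * (t - real_of_int (c + int i) / real H)))"
      by (rule sum.reindex_bij_witness[of _ "\<lambda>i. c + int i" "\<lambda>l. nat (l - c)"]) auto
    also have "\<dots> = (\<Sum>i<H. cis (2 * pi * (real a - real b) * (t - real_of_int c / real H)) * w ^ i)"
      unfolding w_def Complex.DeMoivre cis_mult using H by (intro sum.cong refl arg_cong[of _ _ cis]) (simp add: field_simps)
    also have "\<dots> = cis (2 * pi * (real a - real b) * (t - real_of_int c / real H)) * (\<Sum>i<H. w ^ i)" by (simp add: sum_distrib_left)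
    also have "(\<Sum>i<H. w ^ i) = 0" using \<open>w \<noteq> 1\<close> wH by (simp add: geometric_sum)
    finally show ?thesis using False by simp
  qed simp
  have "complex_of_real (\<Sum>l\<in>{c..<c + int H}. fejer H (t - real_of_int l / real H)) =
     (\<Sum>(a, b)\<in>{..<H} \<times> {..<H}. \<Sum>l\<in>{c..<c + int H}. cis (2 * pi * (real a - real b) * (t - real_of_int l / real H))) / (of_nat H)\<^sup>2"
    unfolding of_real_sum fejer_double_sum sum_divide_distrib[symmetric]
    by (subst sum.swap) (simp add: case_prod_unfold)
  also have "(\<Sum>(a, b)\<in>{..<H} \<times> {..<H}. \<Sum>l\<in>{c..<c + int H}. cis (2 * pi * (real a - real b) * (t - real_of_int l / real H))) =
     (\<Sum>(a, b)\<in>{..<H} \<times> {..<H}. if a = b then of_nat H else 0)"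
    by (intro sum.cong) (auto simp: inner)
  also have "\<dots> = (\<Sum>a<H. \<Sum>b<H. if a = b then of_nat H else 0)" by (rule sum.cartesian_product[symmetric])
  also have "\<dots> = (of_nat H)\<^sup>2" by (simp add: power2_eq_square)
  finally have "complex_of_real (\<Sum>l\<in>{c..<c + int H}. fejer H (t - real_of_int l / real H)) = complex_of_real 1" using H by simp
  then show ?thesis by (simp only: of_real_eq_iff)
qed

lemma sum_inverse_square_nat_tail: "D \<ge> 2 \<Longrightarrow> finite I \<Longrightarrow> (\<And>i. i \<in> I \<Longrightarrow> D \<le> i) \<Longrightarrow> (\<Sum>i\<in>I. 1 / (real i)\<^sup>2) \<le> 1 / (real D - 1)"
proof -
  assume D: "D \<ge> 2" and fin: "finite I" and I: "\<And>i. i \<in> I \<Longrightarrow> D \<le> i"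
  have *: "(\<Sum>i\<in>{D..<D + n}. 1 / (real i)\<^sup>2) \<le> 1 / (real D - 1) - 1 / (real (D + n) - 1)" for n
  proof (induction n)
    case (Suc n)
    define y where "y = real (D + n)"
    have y: "y \<ge> 2" using D by (simp add: y_def)
    have "1 / y\<^sup>2 \<le> 1 / (y - 1) - 1 / y" using y by (simp add: field_simps power2_eq_square)
    then show ?case using Suc by (simp add: y_def)
  qed simp
  define n where "n = Suc (Max (insert D I)) - D"
  have "I \<subseteq> {D..<D + n}"
  proof
    fix i assume "i \<in> I"
    then have "i \<le> Max (insert D I)" using fin by (intro Max_ge) auto
    then have "i < D + n" unfolding n_def by linarith
    then show "i \<in> {D..<D + n}" using I[OF \<open>i \<in> I\<close>] by simp
  qed
  then have "(\<Sum>i\<in>I. 1 / (real i)\<^sup>2) \<le> (\<Sum>i\<in>{D..<D + n}. 1 / (real i)\<^sup>2)" by (intro sum_mono2) auto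
  also have "\<dots> \<le> 1 / (real D - 1) - 1 / (real (D + n) - 1)" by (rule *)
  also have "\<dots> \<le> 1 / (real D - 1)" using D by auto
  finally show ?thesis .
qed

text \<open>On each side of \<open>x\<close> the integer parts of the distances are distinct and at
  least \<open>D\<close>, so each side is bounded by a tail of the series of
  \<open>1 / i^2\<close>.\<close>

lemma sum_inverse_square_tail:
  fixes L :: "int set" and x :: real
  assumes D: "D \<ge> 2" and fin: "finite L" and L: "\<And>l. l \<in> L \<Longrightarrow> real D \<le> \<bar>x - real_of_int l\<bar>"
  shows "(\<Sum>l\<in>L. 1 / (x - real_of_int l)\<^sup>2) \<le> 2 / (real D - 1)"
proof -
  have half: "(\<Sum>l\<in>M. 1 / (x - real_of_int l)\<^sup>2) \<le> 1 / (real D - 1)"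
    if M: "finite M" "\<And>l. l \<in> M \<Longrightarrow> real D \<le> s * (x - real_of_int l)" and s: "s = 1 \<or> s = -1" for M s
  proof -
    define g where "g = (\<lambda>l. nat \<lfloor>s * (x - real_of_int l)\<rfloor>)"
    have g: "D \<le> g l" "real (g l) \<le> s * (x - real_of_int l)" if "l \<in> M" for l
      using M(2)[OF that] D unfolding g_def by linarith+
    have inj: "inj_on g M"
    proof (rule inj_onI)
      fix l l' assume ll: "l \<in> M" "l' \<in> M" "g l = g l'"
      have "\<lfloor>s * (x - real_of_int l)\<rfloor> = \<lfloor>s * (x - real_of_int l')\<rfloor>"
        using ll M(2)[OF ll(1)] M(2)[OF ll(2)] D unfolding g_def by linarith
      then show "l = l'" using s by (auto, linarith+)
    qed
    have "(\<Sum>l\<in>M. 1 / (x - real_of_int l)\<^sup>2) \<le> (\<Sum>l\<in>M. 1 / (real (g l))\<^sup>2)"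
    proof (rule sum_mono)
      fix l assume l: "l \<in> M"
      have "(real (g l))\<^sup>2 \<le> (s * (x - real_of_int l))\<^sup>2" using g[OF l] by (intro power_mono) auto
      also have "\<dots> = (x - real_of_int l)\<^sup>2" using s by (auto simp: power2_commute)
      finally show "1 / (x - real_of_int l)\<^sup>2 \<le> 1 / (real (g l))\<^sup>2"
        using g[OF l] D by (intro divide_left_mono) (auto intro!: mult_pos_pos zero_less_power2[THEN iffD2])
    qed
    also have "\<dots> = (\<Sum>i\<in>g ` M. 1 / (real i)\<^sup>2)" by (simp add: sum.reindex[OF inj])
    also have "\<dots> \<le> 1 / (real D - 1)" using D M g by (intro sum_inverse_square_nat_tail) auto
    finally show ?thesis .
  qed
  have "(\<Sum>l\<in>L. 1 / (x - real_of_int l)\<^sup>2) = (\<Sum>l\<in>{l \<in> L. real_of_int l \<le> x}. 1 / (x - real_of_int l)\<^sup>2) + (\<Sum>l\<in>{l \<in> L. \<not> real_of_int l \<le> x}. 1 / (x - real_of_int l)\<^sup>2)"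
    using fin by (subst sum.union_disjoint[symmetric]) (auto intro!: sum.cong)
  also have "\<dots> \<le> 1 / (real D - 1) + 1 / (real D - 1)"
    using L fin by (intro add_mono half[of _ 1] half[of _ "-1"]) fastforce+
  finally show ?thesis by simp
qed

text \<open>
  A trigonometric polynomial which majorizes \<open>1 / (1 + (N t)\<^sup>2)\<close> on the central period. Its
  coefficients are still \<open>O(1 / N)\<close>; it serves as a common majorant for all approximation errors.
\<close>

definition bump :: "nat \<Rightarrow> real \<Rightarrow> real" where
  "bump N t = (\<Sum>l\<in>{-int (3 * N)..int (3 * N)}. 72 / (1 + (real_of_int l)\<^sup>2) * fejer N (t - real_of_int l / real (3 * N)))"

definition bump_coeff :: "nat \<Rightarrow> int \<Rightarrow> complex" where
  "bump_coeff N n = (\<Sum>l\<in>{-int (3 * N)..int (3 * N)}. of_real (72 / (1 + (real_of_int l)\<^sup>2)) *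
     (of_real (fejer_coeff N n) * cis (- (2 * pi * real_of_int n * (real_of_int l / real (3 * N))))))"

lemma bump_periodic: "bump N (t + of_int z) = bump N t"
proof -
  have "fejer N (t + of_int z - s) = fejer N (t - s)" for s
    using fejer_periodic[of N "t - s" z] by (simp add: algebra_simps)
  then show ?thesis by (simp add: bump_def)
qed

lemma bump_trig_poly: "N \<le> h \<Longrightarrow> trig_poly h (bump_coeff N) (bump N)"
  unfolding bump_def bump_coeff_def by (intro trig_poly_weighted_sum trig_poly_shift fejer_trig_poly)

lemma sum_bump_weights: "(\<Sum>l\<in>{-int L..int L}. 72 / (1 + (real_of_int l)\<^sup>2)) \<le> 288"
proof -
  define A where "A = {-int L..int L} \<inter> {l. \<bar>l\<bar> \<le> 1}"
  define B where "B = {-int L..int L} \<inter> {l. 2 \<le> \<bar>l\<bar>}"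
  have "(\<Sum>l\<in>{-int L..int L}. 1 / (1 + (real_of_int l)\<^sup>2)) = (\<Sum>l\<in>A. 1 / (1 + (real_of_int l)\<^sup>2)) + (\<Sum>l\<in>B. 1 / (1 + (real_of_int l)\<^sup>2))"
    by (subst sum.union_disjoint[symmetric]) (auto simp: A_def B_def intro!: sum.cong)
  also have "(\<Sum>l\<in>A. 1 / (1 + (real_of_int l)\<^sup>2)) \<le> (\<Sum>l\<in>{-1, 0, 1}. 1 / (1 + (real_of_int l)\<^sup>2))"
    by (intro sum_mono2) (auto simp: A_def)
  also have "\<dots> = 2" by simp
  also have "(\<Sum>l\<in>B. 1 / (1 + (real_of_int l)\<^sup>2)) \<le> (\<Sum>l\<in>B. 1 / (0 - real_of_int l)\<^sup>2)"
    by (intro sum_mono divide_left_mono) (auto simp: B_def add_pos_nonneg)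
  also have "\<dots> \<le> 2 / (real 2 - 1)"
    by (intro sum_inverse_square_tail) (auto simp: B_def)
  finally have "(\<Sum>l\<in>{-int L..int L}. 1 / (1 + (real_of_int l)\<^sup>2)) \<le> 4" by simp
  then have "72 * (\<Sum>l\<in>{-int L..int L}. 1 / (1 + (real_of_int l)\<^sup>2)) \<le> 288" by simp
  then show ?thesis by (simp add: sum_distrib_left)
qed

lemma norm_bump_coeff:
  assumes "N \<ge> 1"
  shows "norm (bump_coeff N n) \<le> 288 / real N"
proof -
  have "norm (bump_coeff N n) \<le> (\<Sum>l\<in>{-int (3 * N)..int (3 * N)}. 72 / (1 + (real_of_int l)\<^sup>2) * (1 / real N))"
    unfolding bump_coeff_def
  proof (rule sum_norm_le)
    fix l
    have "norm (complex_of_real (72 / (1 + (real_of_int l)\<^sup>2))) = 72 / (1 + (real_of_int l)\<^sup>2)" by (simp del: of_real_divide)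
    moreover have "norm (complex_of_real (fejer_coeff N n)) \<le> 1 / real N" using fejer_coeff_bounds(1,2)[OF assms, of n] by simp
    ultimately show "norm (complex_of_real (72 / (1 + (real_of_int l)\<^sup>2)) * (of_real (fejer_coeff N n) * cis (- (2 * pi * real_of_int n * (real_of_int l / real (3 * N))))))
      \<le> 72 / (1 + (real_of_int l)\<^sup>2) * (1 / real N)"
      unfolding norm_mult norm_cis mult_1_right by (intro mult_mono) auto
  qed
  also have "\<dots> = (\<Sum>l\<in>{-int (3 * N)..int (3 * N)}. 72 / (1 + (real_of_int l)\<^sup>2)) * (1 / real N)" by (rule sum_distrib_right[symmetric])
  also have "\<dots> \<le> 288 * (1 / real N)" by (intro mult_right_mono sum_bump_weights) auto
  finally show ?thesis by simp
qed

text \<open>The nodes have spacing \<open>1 / (3 * N)\<close>, so some node lies within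
  \<open>1 / (6 * N)\<close> of \<open>t\<close>, where the kernel is at least 1 / 4. For that node
  \<open>1 + l^2 \<le> 18 * (1 + (N * t)^2)\<close>, and the constant 72 in the weights is 4 times
  18.\<close>

lemma bump_ge:
  assumes "N \<ge> 1" "\<bar>t\<bar> \<le> 1 / 2"
  shows "1 / (1 + (real N * t)\<^sup>2) \<le> bump N t"
proof -
  define y where "y = 3 * (real N * t)"
  define l where "l = round y"
  have l: "\<bar>real_of_int l - y\<bar> \<le> 1 / 2" unfolding l_def by (rule of_int_round_abs_le)
  have "real N * \<bar>t\<bar> \<le> real N * (1 / 2)" using assms by (intro mult_left_mono) auto
  moreover have "\<bar>y\<bar> = 3 * (real N * \<bar>t\<bar>)" by (simp add: y_def abs_mult)
  ultimately have ya: "\<bar>y\<bar> \<le> 3 / 2 * real N" by linarith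
  have lr: "l \<in> {-int (3 * N)..int (3 * N)}"
  proof -
    have "1 \<le> real N" using assms(1) by simp
    moreover have "\<bar>real_of_int l\<bar> \<le> \<bar>y\<bar> + 1 / 2"
      using l abs_triangle_ineq[of "real_of_int l - y" y] by linarith
    ultimately have "\<bar>real_of_int l\<bar> \<le> 3 * real N" using ya by linarith
    then have "real_of_int \<bar>l\<bar> \<le> real_of_int (int (3 * N))" by simp
    then have "\<bar>l\<bar> \<le> int (3 * N)" by (simp only: of_int_le_iff)
    then show ?thesis by (auto simp: abs_le_iff)
  qed
  have f: "1 / 4 \<le> fejer N (t - real_of_int l / real (3 * N))"
  proof (rule fejer_ge)
    have "t - real_of_int l / real (3 * N) = (y - real_of_int l) / real (3 * N)" using assms by (simp add: y_def field_simps)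
    then have "\<bar>t - real_of_int l / real (3 * N)\<bar> = \<bar>real_of_int l - y\<bar> / real (3 * N)" by (simp add: abs_divide abs_minus_commute)
    also have "\<dots> \<le> (1 / 2) / real (3 * N)" using l by (intro divide_right_mono) auto
    finally show "\<bar>t - real_of_int l / real (3 * N)\<bar> \<le> 1 / (6 * real N)" by simp
  qed fact
  have "1 + (real_of_int l)\<^sup>2 \<le> 18 * (1 + (real N * t)\<^sup>2)"
  proof -
    have "\<bar>real_of_int l\<bar> \<le> \<bar>y\<bar> + 1 / 2" using l abs_triangle_ineq[of "real_of_int l - y" y] by linarith
    then have "\<bar>real_of_int l\<bar>\<^sup>2 \<le> (\<bar>y\<bar> + 1 / 2)\<^sup>2" by (intro power_mono) auto
    then have "(real_of_int l)\<^sup>2 \<le> (\<bar>y\<bar> + 1 / 2)\<^sup>2" by simp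
    also have "\<dots> \<le> 2 * y\<^sup>2 + 1 / 2"
    proof -
      have "0 \<le> (\<bar>y\<bar> - 1 / 2)\<^sup>2" by simp
      then show ?thesis by (simp add: power2_sum power2_diff power_divide)
    qed
    also have "y\<^sup>2 = 9 * (real N * t)\<^sup>2" by (simp add: y_def power_mult_distrib)
    finally show ?thesis by simp
  qed
  then have "1 / (1 + (real N * t)\<^sup>2) \<le> 18 / (1 + (real_of_int l)\<^sup>2)"
    by (simp add: divide_le_eq le_divide_eq add_pos_nonneg mult.commute pos_le_divide_eq)
  also have "\<dots> = 72 / (1 + (real_of_int l)\<^sup>2) * (1 / 4)"
  proof -
    have "18 / x = 72 / x * (1 / 4)" for x :: real by (cases "x = 0") (auto simp: field_simps)
    then show ?thesis .
  qed
  also have "\<dots> \<le> 72 / (1 + (real_of_int l)\<^sup>2) * fejer N (t - real_of_int l / real (3 * N))"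
    using f by (intro mult_left_mono) auto
  also have "\<dots> \<le> bump N t"
    unfolding bump_def using lr
    by (intro member_le_sum[of l _ "\<lambda>l. 72 / (1 + (real_of_int l)\<^sup>2) * fejer N (t - real_of_int l / real (3 * N))"])
       (auto intro!: mult_nonneg_nonneg divide_nonneg_nonneg)
  finally show ?thesis .
qed

section \<open>Limits of the kernel averages for almost every \<alpha>\<close>

lemma bij_betw_index_pos_less: "k \<ge> 2 \<Longrightarrow> CARD('n::{finite,linorder}) = k - 1 \<Longrightarrow> bij_betw index_pos (UNIV :: 'n set) {1..<k}"
proof -
  assume "k \<ge> 2" "CARD('n) = k - 1"
  then have "{1..CARD('n)} = {1..<k}" by auto
  then show ?thesis using bij_betw_index_pos[where 'n = 'n] by simp
qed

text \<open>Transfers the convergence from coordinates numbered \<open>1, ..., k - 1\<close> to the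
  index type, and from the complex sum to the real one by taking real parts. The polynomials may
  differ from coordinate to coordinate, which leaves room for arbitrary shifts.\<close>

lemma AE_prod_trig_poly:
  fixes e :: "'n::{finite,linorder} \<Rightarrow> nat \<Rightarrow> int \<Rightarrow> complex" and T :: "'n::{finite,linorder} \<Rightarrow> nat \<Rightarrow> real \<Rightarrow> real"
  assumes k: "k \<ge> 2" "CARD('n::{finite,linorder}) = k - 1" and r: "admissible_exponent k a0 r"
    and T: "\<And>i N. N \<ge> 1 \<Longrightarrow> trig_poly (K * N) (e i N) (T i N)"
    and e: "\<And>i N n. N \<ge> 1 \<Longrightarrow> norm (e i N n) \<le> C / real N"
  shows "AE \<alpha> in lborel. \<alpha> \<ge> a0 \<longrightarrow>
    (\<lambda>m. ((\<Sum>x\<in>distinct_tuples k (Suc m ^ r). \<Prod>i\<in>UNIV. T i (Suc m ^ r) ((power_diffs x \<alpha> :: real ^ 'n::{finite,linorder}) $ i)) -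
       real (card (distinct_tuples k (Suc m ^ r))) * Re (\<Prod>i\<in>UNIV. e i (Suc m ^ r) 0)) / real (Suc m ^ r)) \<longlonglongrightarrow> 0"
proof -
  define q where "q = inv_into (UNIV :: 'n set) index_pos"
  have bij: "bij_betw index_pos (UNIV :: 'n set) {1..<k}" using bij_betw_index_pos_less[OF k] .
  have q: "q (index_pos i) = i" for i :: 'n
    unfolding q_def using bij by (intro inv_into_f_f) (auto simp: bij_betw_def)
  define c where "c = (\<lambda>N n. \<Prod>j\<in>{1..<k}. e (q j) N (n j))"
  have c: "norm (c N n) \<le> C ^ (k - 1) / real N ^ (k - 1)" if "N \<ge> 1" for N n
  proof -
    have "norm (c N n) \<le> (\<Prod>j\<in>{1..<k}. C / real N)"
      unfolding c_def prod_norm[symmetric] using e[OF that] by (intro prod_mono) auto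
    then show ?thesis by (simp add: power_divide)
  qed
  have eq: "complex_of_real (((\<Sum>x\<in>distinct_tuples k N. \<Prod>i\<in>UNIV. T i N ((power_diffs x \<alpha> :: real ^ 'n::{finite,linorder}) $ i)) -
       real (card (distinct_tuples k N)) * Re (\<Prod>i\<in>UNIV. e i N 0)) / real N) = of_real (Re (corr_exp_sum k N (K * N) (c N) \<alpha> / of_nat N))"
    if N: "N \<ge> 1" for N \<alpha>
  proof -
    have 1: "(\<Prod>i\<in>UNIV. T i N ((power_diffs x \<alpha> :: real ^ 'n::{finite,linorder}) $ i)) = (\<Prod>j\<in>{1..<k}. T (q j) N (real (x j) powr \<alpha> - real (x (j + 1)) powr \<alpha>))" for x
      using prod.reindex_bij_betw[OF bij, of "\<lambda>j. T (q j) N (real (x j) powr \<alpha> - real (x (j + 1)) powr \<alpha>)"]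
      by (simp add: q power_diffs_def)
    have 2: "(\<Prod>i\<in>UNIV. e i N 0) = (\<Prod>j\<in>{1..<k}. e (q j) N 0)"
      using prod.reindex_bij_betw[OF bij, of "\<lambda>j. e (q j) N 0"] by (simp add: q)
    have "complex_of_real (\<Sum>x\<in>distinct_tuples k N. \<Prod>j\<in>{1..<k}. T (q j) N (real (x j) powr \<alpha> - real (x (j + 1)) powr \<alpha>)) =
      of_nat (card (distinct_tuples k N)) * (\<Prod>j\<in>{1..<k}. e (q j) N 0) + corr_exp_sum k N (K * N) (c N) \<alpha>"
      unfolding c_def using T[OF N] by (rule sum_prod_trig_poly)
    then have "Re (complex_of_real (\<Sum>x\<in>distinct_tuples k N. \<Prod>j\<in>{1..<k}. T (q j) N (real (x j) powr \<alpha> - real (x (j + 1)) powr \<alpha>))) =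
      Re (of_nat (card (distinct_tuples k N)) * (\<Prod>j\<in>{1..<k}. e (q j) N 0) + corr_exp_sum k N (K * N) (c N) \<alpha>)" by (rule arg_cong)
    then have "(\<Sum>x\<in>distinct_tuples k N. \<Prod>j\<in>{1..<k}. T (q j) N (real (x j) powr \<alpha> - real (x (j + 1)) powr \<alpha>)) =
      Re (of_nat (card (distinct_tuples k N)) * (\<Prod>j\<in>{1..<k}. e (q j) N 0) + corr_exp_sum k N (K * N) (c N) \<alpha>)"
      by (simp only: Re_complex_of_real)
    also have "\<dots> = real (card (distinct_tuples k N)) * Re (\<Prod>j\<in>{1..<k}. e (q j) N 0) + Re (corr_exp_sum k N (K * N) (c N) \<alpha>)"
      by simp
    finally have "(\<Sum>x\<in>distinct_tuples k N. \<Prod>j\<in>{1..<k}. T (q j) N (real (x j) powr \<alpha> - real (x (j + 1)) powr \<alpha>)) -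
      real (card (distinct_tuples k N)) * Re (\<Prod>j\<in>{1..<k}. e (q j) N 0) = Re (corr_exp_sum k N (K * N) (c N) \<alpha>)" by linarith
    then show ?thesis unfolding 1 2 by (simp add: Re_divide_of_nat)
  qed
  have "AE \<alpha> in lborel. \<alpha> \<ge> a0 \<longrightarrow>
         (\<lambda>m. corr_exp_sum k (Suc m ^ r) (K * Suc m ^ r) (c (Suc m ^ r)) \<alpha> / of_nat (Suc m ^ r)) \<longlonglongrightarrow> 0"
    using r c unfolding admissible_exponent_def by blast
  then show ?thesis
  proof (rule AE_mp, intro AE_I2 impI)
    fix \<alpha> assume "\<alpha> \<ge> a0 \<longrightarrow> (\<lambda>m. corr_exp_sum k (Suc m ^ r) (K * Suc m ^ r) (c (Suc m ^ r)) \<alpha> / of_nat (Suc m ^ r)) \<longlonglongrightarrow> 0" "a0 \<le> \<alpha>"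
    then have "(\<lambda>m. Re (corr_exp_sum k (Suc m ^ r) (K * Suc m ^ r) (c (Suc m ^ r)) \<alpha> / of_nat (Suc m ^ r))) \<longlonglongrightarrow> Re 0"
      by (intro tendsto_Re) auto
    moreover have "Re (corr_exp_sum k (Suc m ^ r) (K * Suc m ^ r) (c (Suc m ^ r)) \<alpha> / of_nat (Suc m ^ r)) =
      ((\<Sum>x\<in>distinct_tuples k (Suc m ^ r). \<Prod>i\<in>UNIV. T i (Suc m ^ r) ((power_diffs x \<alpha> :: real ^ 'n::{finite,linorder}) $ i)) -
       real (card (distinct_tuples k (Suc m ^ r))) * Re (\<Prod>i\<in>UNIV. e i (Suc m ^ r) 0)) / real (Suc m ^ r)" for m
      using eq[of "Suc m ^ r" \<alpha>] unfolding of_real_eq_iff by simp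
    ultimately show "(\<lambda>m. ((\<Sum>x\<in>distinct_tuples k (Suc m ^ r). \<Prod>i\<in>UNIV. T i (Suc m ^ r) ((power_diffs x \<alpha> :: real ^ 'n::{finite,linorder}) $ i)) -
       real (card (distinct_tuples k (Suc m ^ r))) * Re (\<Prod>i\<in>UNIV. e i (Suc m ^ r) 0)) / real (Suc m ^ r)) \<longlonglongrightarrow> 0"
      by simp
  qed
qed

text \<open>All that the deterministic part has to know about \<alpha>. The first condition concerns
  countably many pairs of \<open>K\<close> and \<open>l\<close>, so it holds outside a single null
  set; its limit is the volume of a cube of side \<open>1 / K\<close>. The second supplies the
  uniform control of the approximation errors.\<close>

definition good_along :: "nat \<Rightarrow> 'n::{finite,linorder} itself \<Rightarrow> nat \<Rightarrow> real \<Rightarrow> bool" where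
  "good_along k _ r \<alpha> \<longleftrightarrow>
    (\<forall>K\<ge>1. \<forall>l :: 'n::{finite,linorder} \<Rightarrow> int. (\<lambda>m. (\<Sum>x\<in>distinct_tuples k (Suc m ^ r). \<Prod>i\<in>UNIV.
       fejer (K * Suc m ^ r) ((power_diffs x \<alpha> :: real ^ 'n::{finite,linorder}) $ i - real_of_int (l i) / real (K * Suc m ^ r))) / real (Suc m ^ r))
         \<longlonglongrightarrow> 1 / real K ^ CARD('n::{finite,linorder})) \<and>
    (\<exists>C. \<forall>m. (\<Sum>x\<in>distinct_tuples k (Suc m ^ r). \<Prod>i\<in>UNIV. bump (Suc m ^ r) ((power_diffs x \<alpha> :: real ^ 'n::{finite,linorder}) $ i)) / real (Suc m ^ r) \<le> C)"

lemma AE_good_along: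
  assumes k: "k \<ge> 2" "CARD('n::{finite,linorder}) = k - 1" and r: "admissible_exponent k a0 r"
  shows "AE \<alpha> in lborel. \<alpha> \<ge> a0 \<longrightarrow> good_along k TYPE('n::{finite,linorder}) r \<alpha>"
proof -
  have r1: "r \<ge> 1" using r by (simp add: admissible_exponent_def)
  have Ninf: "filterlim (\<lambda>m. Suc m ^ r) at_top sequentially"
  proof (rule filterlim_at_top_mono[OF filterlim_Suc])
    show "\<forall>\<^sub>F m in sequentially. Suc m \<le> Suc m ^ r" using r1 by (intro always_eventually allI self_le_power) auto
  qed
  have asymp: "(\<lambda>m. real (card (distinct_tuples k (Suc m ^ r))) / real (Suc m ^ r) ^ k) \<longlonglongrightarrow> 1"
    using filterlim_compose[OF card_distinct_tuples_asymp Ninf] k by simp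
  have pk: "real N ^ k = real N * real N ^ (k - 1)" for N using k power_minus_mult[of k "real N"] by (simp add: mult.commute)
  have A: "AE \<alpha> in lborel. \<alpha> \<ge> a0 \<longrightarrow> (\<lambda>m. (\<Sum>x\<in>distinct_tuples k (Suc m ^ r). \<Prod>i\<in>UNIV.
       fejer (K * Suc m ^ r) ((power_diffs x \<alpha> :: real ^ 'n::{finite,linorder}) $ i - real_of_int (l i) / real (K * Suc m ^ r))) / real (Suc m ^ r))
         \<longlonglongrightarrow> 1 / real K ^ CARD('n)" if K: "K \<ge> 1" for K and l :: "'n \<Rightarrow> int"
  proof -
    define e where "e = (\<lambda>i N n. complex_of_real (fejer_coeff (K * N) n) * cis (- (2 * pi * real_of_int n * (real_of_int (l i) / real (K * N)))))"
    define T where "T = (\<lambda>i N t. fejer (K * N) (t - real_of_int (l i) / real (K * N)))"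
    have tp: "trig_poly (K * N) (e i N) (T i N)" for i N
      unfolding e_def T_def by (intro trig_poly_shift fejer_trig_poly) auto
    have ne: "norm (e i N n) \<le> 1 / real N" if N: "N \<ge> 1" for i N n
    proof -
      have KN: "K * N \<ge> 1" using K N by (simp add: Suc_leI)
      have "norm (e i N n) \<le> 1 / real (K * N)"
        unfolding e_def norm_mult norm_cis using fejer_coeff_bounds(1,2)[OF KN, of n] by simp
      also have "\<dots> \<le> 1 / real N" using K N by (intro divide_left_mono) auto
      finally show ?thesis .
    qed
    have e0: "Re (\<Prod>i\<in>UNIV. e i N 0) = 1 / real (K * N) ^ (k - 1)" if N: "N \<ge> 1" for N
    proof -
      have "e i N 0 = of_real (1 / real (K * N))" for i using fejer_coeff_bounds(3)[of "K * N"] K N by (simp add: e_def Suc_leI)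
      then have "(\<Prod>i\<in>(UNIV :: 'n set). e i N 0) = of_real ((1 / real (K * N)) ^ (k - 1))" using k by simp
      then show ?thesis by (simp add: power_one_over)
    qed
    \<comment> \<open>The product of the zero coefficients is \<open>1 / (K * N) ^ (k - 1)\<close>
      and there are asymptotically \<open>N ^ k\<close> tuples; after division by \<open>N\<close>
      only the power of \<open>K\<close> remains.\<close>
    have lim: "(\<lambda>m. real (card (distinct_tuples k (Suc m ^ r))) * Re (\<Prod>i\<in>UNIV. e i (Suc m ^ r) 0) / real (Suc m ^ r)) \<longlonglongrightarrow> 1 / real K ^ (k - 1)"
    proof -
      have "real (card (distinct_tuples k (Suc m ^ r))) * Re (\<Prod>i\<in>UNIV. e i (Suc m ^ r) 0) / real (Suc m ^ r) =
        (real (card (distinct_tuples k (Suc m ^ r))) / real (Suc m ^ r) ^ k) * (1 / real K ^ (k - 1))" for m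
        unfolding pk by (subst e0) (auto simp: power_mult_distrib)
      then show ?thesis using tendsto_mult[OF asymp tendsto_const[of "1 / real K ^ (k - 1)"]] by simp
    qed
    have "AE \<alpha> in lborel. \<alpha> \<ge> a0 \<longrightarrow>
      (\<lambda>m. ((\<Sum>x\<in>distinct_tuples k (Suc m ^ r). \<Prod>i\<in>UNIV. T i (Suc m ^ r) ((power_diffs x \<alpha> :: real ^ 'n::{finite,linorder}) $ i)) -
         real (card (distinct_tuples k (Suc m ^ r))) * Re (\<Prod>i\<in>UNIV. e i (Suc m ^ r) 0)) / real (Suc m ^ r)) \<longlonglongrightarrow> 0"
      by (rule AE_prod_trig_poly[where K = K and C = 1, OF k r]) (use tp ne in auto)
    then show ?thesis
    proof (rule AE_mp, intro AE_I2 impI)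
      fix \<alpha> assume *: "a0 \<le> \<alpha> \<longrightarrow> (\<lambda>m. ((\<Sum>x\<in>distinct_tuples k (Suc m ^ r). \<Prod>i\<in>UNIV. T i (Suc m ^ r) ((power_diffs x \<alpha> :: real ^ 'n::{finite,linorder}) $ i)) -
       real (card (distinct_tuples k (Suc m ^ r))) * Re (\<Prod>i\<in>UNIV. e i (Suc m ^ r) 0)) / real (Suc m ^ r)) \<longlonglongrightarrow> 0" "a0 \<le> \<alpha>"
      from tendsto_add[OF mp[OF *] lim]
      show "(\<lambda>m. (\<Sum>x\<in>distinct_tuples k (Suc m ^ r). \<Prod>i\<in>UNIV.
       fejer (K * Suc m ^ r) ((power_diffs x \<alpha> :: real ^ 'n::{finite,linorder}) $ i - real_of_int (l i) / real (K * Suc m ^ r))) / real (Suc m ^ r))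
         \<longlonglongrightarrow> 1 / real K ^ CARD('n)" unfolding diff_divide_distrib using k by (simp add: T_def)
    qed
  qed
  \<comment> \<open>For the majorant boundedness is enough: its main term is at most
    \<open>288 ^ (k - 1)\<close>, and the remainder converges, hence is bounded.\<close>
  have B: "AE \<alpha> in lborel. \<alpha> \<ge> a0 \<longrightarrow> (\<exists>C. \<forall>m. (\<Sum>x\<in>distinct_tuples k (Suc m ^ r). \<Prod>i\<in>UNIV. bump (Suc m ^ r) ((power_diffs x \<alpha> :: real ^ 'n::{finite,linorder}) $ i)) / real (Suc m ^ r) \<le> C)"
  proof -
    have tp: "trig_poly (1 * N) (bump_coeff N) (bump N)" for N by (intro bump_trig_poly) auto
    have bd: "real (card (distinct_tuples k N)) * Re (\<Prod>i\<in>(UNIV :: 'n set). bump_coeff N 0) / real N \<le> 288 ^ (k - 1)" if N: "N \<ge> 1" for N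
    proof -
      have "Re (\<Prod>i\<in>(UNIV :: 'n set). bump_coeff N 0) \<le> norm (bump_coeff N 0) ^ (k - 1)"
        using complex_Re_le_cmod[of "bump_coeff N 0 ^ (k - 1)"] k by (simp add: norm_power)
      also have "\<dots> \<le> (288 / real N) ^ (k - 1)" by (intro power_mono norm_bump_coeff N) auto
      finally have "real (card (distinct_tuples k N)) * Re (\<Prod>i\<in>(UNIV :: 'n set). bump_coeff N 0) / real N \<le> real N ^ k * (288 / real N) ^ (k - 1) / real N"
        using card_distinct_tuples_bounds(1)[of k N]
        by (intro divide_right_mono) (auto intro!: order_trans[OF mult_left_mono mult_right_mono] simp flip: of_nat_power)
      also have "\<dots> = 288 ^ (k - 1)" unfolding pk using N by (simp add: power_divide)
      finally show ?thesis .
    qed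
    have "AE \<alpha> in lborel. \<alpha> \<ge> a0 \<longrightarrow>
      (\<lambda>m. ((\<Sum>x\<in>distinct_tuples k (Suc m ^ r). \<Prod>i\<in>UNIV. bump (Suc m ^ r) ((power_diffs x \<alpha> :: real ^ 'n::{finite,linorder}) $ i)) -
         real (card (distinct_tuples k (Suc m ^ r))) * Re (\<Prod>i\<in>(UNIV :: 'n set). bump_coeff (Suc m ^ r) 0)) / real (Suc m ^ r)) \<longlonglongrightarrow> 0"
      by (rule AE_prod_trig_poly[where K = 1 and C = 288 and T = "\<lambda>_. bump" and e = "\<lambda>_. bump_coeff", OF k r]) (use tp norm_bump_coeff in auto)
    then show ?thesis
    proof (rule AE_mp, intro AE_I2 impI)
      fix \<alpha> assume *: "a0 \<le> \<alpha> \<longrightarrow> (\<lambda>m. ((\<Sum>x\<in>distinct_tuples k (Suc m ^ r). \<Prod>i\<in>UNIV. bump (Suc m ^ r) ((power_diffs x \<alpha> :: real ^ 'n::{finite,linorder}) $ i)) -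
       real (card (distinct_tuples k (Suc m ^ r))) * Re (\<Prod>i\<in>(UNIV :: 'n set). bump_coeff (Suc m ^ r) 0)) / real (Suc m ^ r)) \<longlonglongrightarrow> 0" "a0 \<le> \<alpha>"
      from convergent_imp_Bseq[OF convergentI[OF mp[OF *]]]
      obtain D where D: "\<And>m. \<bar>((\<Sum>x\<in>distinct_tuples k (Suc m ^ r). \<Prod>i\<in>UNIV. bump (Suc m ^ r) ((power_diffs x \<alpha> :: real ^ 'n::{finite,linorder}) $ i)) -
       real (card (distinct_tuples k (Suc m ^ r))) * Re (\<Prod>i\<in>(UNIV :: 'n set). bump_coeff (Suc m ^ r) 0)) / real (Suc m ^ r)\<bar> \<le> D"
        unfolding Bseq_def real_norm_def by blast
      have "(\<Sum>x\<in>distinct_tuples k (Suc m ^ r). \<Prod>i\<in>UNIV. bump (Suc m ^ r) ((power_diffs x \<alpha> :: real ^ 'n::{finite,linorder}) $ i)) / real (Suc m ^ r) \<le> D + 288 ^ (k - 1)" for m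
        using D[of m] bd[of "Suc m ^ r"] unfolding diff_divide_distrib by auto
      then show "\<exists>C. \<forall>m. (\<Sum>x\<in>distinct_tuples k (Suc m ^ r). \<Prod>i\<in>UNIV. bump (Suc m ^ r) ((power_diffs x \<alpha> :: real ^ 'n::{finite,linorder}) $ i)) / real (Suc m ^ r) \<le> C"
        by blast
    qed
  qed
  have A1: "AE \<alpha> in lborel. \<forall>l :: 'n \<Rightarrow> int. \<alpha> \<ge> a0 \<longrightarrow> (\<lambda>m. (\<Sum>x\<in>distinct_tuples k (Suc m ^ r). \<Prod>i\<in>UNIV.
       fejer (K * Suc m ^ r) ((power_diffs x \<alpha> :: real ^ 'n::{finite,linorder}) $ i - real_of_int (l i) / real (K * Suc m ^ r))) / real (Suc m ^ r))
         \<longlonglongrightarrow> 1 / real K ^ CARD('n)" if K: "K \<ge> 1" for K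
    unfolding AE_all_countable using A[OF K] by blast
  have "AE \<alpha> in lborel. \<forall>K\<in>{1..}. \<forall>l :: 'n \<Rightarrow> int. \<alpha> \<ge> a0 \<longrightarrow> (\<lambda>m. (\<Sum>x\<in>distinct_tuples k (Suc m ^ r). \<Prod>i\<in>UNIV.
       fejer (K * Suc m ^ r) ((power_diffs x \<alpha> :: real ^ 'n::{finite,linorder}) $ i - real_of_int (l i) / real (K * Suc m ^ r))) / real (Suc m ^ r))
         \<longlonglongrightarrow> 1 / real K ^ CARD('n)"
    by (subst AE_ball_countable) (use A1 in \<open>auto simp del: of_nat_power\<close>)
  with B show ?thesis
    by eventually_elim (auto simp: good_along_def)
qed

subsection \<open>From trigonometric polynomials to test functions\<close>

definition frac_centered :: "real ^ 'n::{finite,linorder} \<Rightarrow> real ^ 'n::{finite,linorder}" where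
  "frac_centered t = (\<chi> i. t $ i - real_of_int (round (t $ i)))"

lemma frac_centered_abs_le: "\<bar>frac_centered t $ i\<bar> \<le> 1 / 2"
  using of_int_round_abs_le[of "t $ i"] by (simp add: frac_centered_def abs_minus_commute)

lemma fejer_frac_centered: "fejer H (frac_centered t $ i - s) = fejer H (t $ i - s)"
  using fejer_periodic[of H "t $ i - s" "- round (t $ i)"] by (simp add: frac_centered_def algebra_simps)

lemma bump_frac_centered: "bump N (frac_centered t $ i) = bump N (t $ i)"
  using bump_periodic[of N "t $ i" "- round (t $ i)"] by (simp add: frac_centered_def)

text \<open>Every integer vector other than the rounded one is at distance at least 1 / 2 from
  \<open>t\<close> in some coordinate, and \<open>N / 2 > R\<close> puts the corresponding point
  outside the support. The periodization is thus a single term.\<close>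

lemma periodization_eq:
  fixes f :: "real ^ 'n::{finite,linorder} \<Rightarrow> real"
  assumes supp: "\<And>x i. f x \<noteq> 0 \<Longrightarrow> \<bar>x $ i\<bar> \<le> R" and N: "2 * R < real N" "N \<ge> 1"
  shows "(\<Sum>\<^sub>\<infinity>m::int ^ 'n::{finite,linorder}. f (real N *\<^sub>R (t - (\<chi> i. real_of_int (m $ i))))) = f (real N *\<^sub>R frac_centered t)"
proof -
  define m0 :: "int ^ 'n::{finite,linorder}" where "m0 = (\<chi> i. round (t $ i))"
  have z: "f (real N *\<^sub>R (t - (\<chi> i. real_of_int (m $ i)))) = 0" if "m \<noteq> m0" for m :: "int ^ 'n::{finite,linorder}"
  proof (rule ccontr)
    assume nz: "f (real N *\<^sub>R (t - (\<chi> i. real_of_int (m $ i)))) \<noteq> 0"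
    from that obtain i where i: "m $ i \<noteq> round (t $ i)" by (auto simp: m0_def vec_eq_iff)
    have "1 \<le> \<bar>m $ i - round (t $ i)\<bar>" using i by linarith
    then have "1 \<le> \<bar>real_of_int (m $ i) - real_of_int (round (t $ i))\<bar>" by linarith
    then have "1 / 2 \<le> \<bar>t $ i - real_of_int (m $ i)\<bar>" using of_int_round_abs_le[of "t $ i"] by linarith
    then have "real N * (1 / 2) \<le> real N * \<bar>t $ i - real_of_int (m $ i)\<bar>" by (intro mult_left_mono) auto
    moreover have "real N * \<bar>t $ i - real_of_int (m $ i)\<bar> \<le> R"
      using supp[OF nz, of i] by (simp add: abs_mult)
    ultimately show False using N by linarith
  qed
  have "(\<Sum>\<^sub>\<infinity>m::int ^ 'n::{finite,linorder}. f (real N *\<^sub>R (t - (\<chi> i. real_of_int (m $ i))))) = (\<Sum>\<^sub>\<infinity>m\<in>{m0}. f (real N *\<^sub>R (t - (\<chi> i. real_of_int (m $ i)))))"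
    by (rule infsum_cong_neutral) (auto simp: z)
  also have "\<dots> = f (real N *\<^sub>R frac_centered t)"
    by (simp add: m0_def frac_centered_def) (rule arg_cong[of _ _ f], simp add: vec_eq_iff)
  finally show ?thesis .
qed

definition corr_mean :: "nat \<Rightarrow> real \<Rightarrow> nat \<Rightarrow> nat \<Rightarrow> (real ^ 'n::{finite,linorder} \<Rightarrow> real) \<Rightarrow> real" where
  "corr_mean k \<alpha> N M f = (\<Sum>x\<in>distinct_tuples k N. f (real M *\<^sub>R frac_centered (power_diffs x \<alpha>))) / real N"

lemma correlation_sum_eq_corr_mean:
  fixes f :: "real ^ 'n::{finite,linorder} \<Rightarrow> real"
  assumes "\<And>x i. f x \<noteq> 0 \<Longrightarrow> \<bar>x $ i\<bar> \<le> R" "2 * R < real N" "N \<ge> 1"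
  shows "correlation_sum k f \<alpha> N = corr_mean k \<alpha> N N f"
  unfolding correlation_sum_def corr_mean_def using assms by (subst periodization_eq[of f R]) auto

section \<open>Approximation of a test function by sums of Fejer kernels\<close>

lemma fejer_tail:
  assumes N: "N \<ge> 1" and K: "K \<ge> 1" and L: "finite L" "\<And>l. l \<in> L \<Longrightarrow> \<bar>t - real_of_int l / real (K * N)\<bar> \<le> 3 / 4"
    and D: "D \<ge> 2" "\<And>l. l \<in> L \<Longrightarrow> real D \<le> \<bar>real (K * N) * t - real_of_int l\<bar>"
  shows "(\<Sum>l\<in>L. fejer (K * N) (t - real_of_int l / real (K * N))) \<le> 18 / (real D - 1)"
proof -
  define H where "H = K * N"
  have H: "real H > 0" using N K by (simp add: H_def)
  have "(\<Sum>l\<in>L. fejer H (t - real_of_int l / real H)) \<le> (\<Sum>l\<in>L. 9 * (1 / (real H * t - real_of_int l)\<^sup>2))"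
  proof (rule sum_mono)
    fix l assume l: "l \<in> L"
    have e: "real H * (t - real_of_int l / real H) = real H * t - real_of_int l" using H by (simp add: field_simps)
    have "t - real_of_int l / real H \<noteq> 0" using D(1) D(2)[OF l] e unfolding H_def by auto
    then have "fejer H (t - real_of_int l / real H) \<le> 9 / (real H * (t - real_of_int l / real H))\<^sup>2"
      using L(2)[OF l] unfolding H_def by (rule fejer_le)
    then show "fejer H (t - real_of_int l / real H) \<le> 9 * (1 / (real H * t - real_of_int l)\<^sup>2)" unfolding e by simp
  qed
  also have "\<dots> \<le> 9 * (2 / (real D - 1))"
    unfolding sum_distrib_left[symmetric] using L D by (intro mult_left_mono sum_inverse_square_tail) (auto simp: H_def)
  finally show ?thesis by (simp add: H_def)
qed

text \<open>If \<open>\<tau> = N * t\<close> is outside twice the window, each of the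
  \<open>2 * R * K + 1\<close> nodes contributes at most \<open>36 / (K * \<tau>)^2\<close>, so a
  factor \<open>1 / K\<close> is gained; \<open>1 + \<tau>^2 \<le> 2 * \<tau>^2\<close> then leads
  to \<open>216 * R\<close>. Otherwise the partition of unity bounds the sum by 1, and
  \<open>4 * R^2 + 1\<close> dominates \<open>1 + \<tau>^2\<close>.\<close>

lemma sum_fejer_window_le:
  assumes R: "R \<ge> 1" and K: "K \<ge> 1" and N: "8 * R \<le> N" and t: "\<bar>t\<bar> \<le> 1 / 2"
  defines "s \<equiv> (\<Sum>l\<in>{-int (R * K)..int (R * K)}. fejer (K * N) (t - real_of_int l / real (K * N)))"
  shows "0 \<le> s" "s \<le> (216 * real R + 4 * (real R)\<^sup>2 + 1) / (1 + (real N * t)\<^sup>2)"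
    "2 * real R < \<bar>real N * t\<bar> \<Longrightarrow> s \<le> (216 * real R + 4 * (real R)\<^sup>2 + 1) / real K / (1 + (real N * t)\<^sup>2)"
proof -
  define H where "H = K * N"
  define \<tau> where "\<tau> = real N * t"
  define C where "C = 216 * real R + 4 * (real R)\<^sup>2 + 1"
  have N1: "N \<ge> 1" using N R by linarith
  have H1: "H \<ge> 1" using K N1 by (simp add: H_def Suc_leI)
  have pos: "1 + \<tau>\<^sup>2 > 0" by (simp add: add_pos_nonneg)
  have C0: "C \<ge> 0" by (simp add: C_def)
  show s0: "0 \<le> s" unfolding s_def by (intro sum_nonneg) auto
  show far: "s \<le> (216 * real R + 4 * (real R)\<^sup>2 + 1) / real K / (1 + (real N * t)\<^sup>2)" if \<tau>: "2 * real R < \<bar>real N * t\<bar>"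
  proof -
    have \<tau>R: "2 * real R < \<bar>\<tau>\<bar>" using \<tau> by (simp add: \<tau>_def)
    have each: "fejer H (t - real_of_int l / real H) \<le> 36 / ((real K)\<^sup>2 * \<tau>\<^sup>2)" if l: "l \<in> {-int (R * K)..int (R * K)}" for l
    proof -
      have "\<bar>l\<bar> \<le> int (R * K)" using l by auto
      then have "real_of_int \<bar>l\<bar> \<le> real_of_int (int (R * K))" by (simp only: of_int_le_iff)
      then have "\<bar>real_of_int l\<bar> \<le> real R * real K" by simp
      then have "\<bar>real_of_int l\<bar> / real H \<le> real R * real K / real H" by (intro divide_right_mono) auto
      also have "\<dots> = real R / real N" using K by (simp add: H_def)
      finally have lH: "\<bar>real_of_int l / real H\<bar> \<le> real R / real N" using H1 by (simp add: abs_divide)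
      have RN: "real R / real N \<le> 1 / 8" using N N1 by (simp add: divide_le_eq)
      have Rt: "real R / real N \<le> \<bar>t\<bar> / 2" using \<tau>R N1 by (simp add: \<tau>_def abs_mult field_simps)
      define u where "u = t - real_of_int l / real H"
      have u1: "\<bar>u\<bar> \<le> 3 / 4" using lH RN t unfolding u_def by linarith
      have u2: "\<bar>t\<bar> / 2 \<le> \<bar>u\<bar>" using lH Rt unfolding u_def by linarith
      have t0: "t \<noteq> 0" using \<tau>R by (auto simp: \<tau>_def)
      then have "u \<noteq> 0" using u2 by auto
      then have "fejer H u \<le> 9 / (real H * u)\<^sup>2" using u1 by (rule fejer_le)
      also have "\<dots> \<le> 9 / (real H * (t / 2))\<^sup>2"
      proof (intro divide_left_mono)
        have "(real H * (\<bar>t\<bar> / 2))\<^sup>2 \<le> (real H * \<bar>u\<bar>)\<^sup>2" using u2 by (intro power_mono mult_left_mono) auto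
        then show "(real H * (t / 2))\<^sup>2 \<le> (real H * u)\<^sup>2" by (simp add: power_mult_distrib power_divide)
      qed (use H1 t0 \<open>u \<noteq> 0\<close> in auto)
      also have "\<dots> = 36 / ((real K)\<^sup>2 * \<tau>\<^sup>2)" by (simp add: H_def \<tau>_def power_mult_distrib power_divide mult_ac)
      finally show ?thesis by (simp add: u_def)
    qed
    have "s \<le> (\<Sum>l\<in>{-int (R * K)..int (R * K)}. 36 / ((real K)\<^sup>2 * \<tau>\<^sup>2))"
      unfolding s_def H_def[symmetric] using each by (rule sum_mono)
    also have "\<dots> = real (2 * R * K + 1) * (36 / ((real K)\<^sup>2 * \<tau>\<^sup>2))" by (simp add: mult.assoc)
    also have "\<dots> \<le> (3 * real R * real K) * (36 / ((real K)\<^sup>2 * \<tau>\<^sup>2))"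
    proof (intro mult_right_mono)
      have "1 * 1 \<le> R * K" using R K by (intro mult_mono) auto
      then have "2 * R * K + 1 \<le> 3 * R * K" by simp
      then have "real (2 * R * K + 1) \<le> real (3 * R * K)" by (simp only: of_nat_le_iff)
      then show "real (2 * R * K + 1) \<le> 3 * real R * real K" by simp
    qed auto
    also have "\<dots> = 216 * real R / real K / (2 * \<tau>\<^sup>2)" using K by (simp add: power2_eq_square)
    also have "\<dots> \<le> C / real K / (1 + \<tau>\<^sup>2)"
    proof (intro frac_le divide_right_mono)
      have "1 \<le> \<bar>\<tau>\<bar>" using \<tau>R R by linarith
      then have "1 \<le> \<bar>\<tau>\<bar>\<^sup>2" by (intro one_le_power)
      then show "1 + \<tau>\<^sup>2 \<le> 2 * \<tau>\<^sup>2" by simp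
    qed (use C0 pos K in \<open>auto simp: C_def\<close>)
    finally show ?thesis by (simp add: C_def \<tau>_def)
  qed
  show "s \<le> (216 * real R + 4 * (real R)\<^sup>2 + 1) / (1 + (real N * t)\<^sup>2)"
  proof (cases "2 * real R < \<bar>real N * t\<bar>")
    case True
    have "C * 1 \<le> C * real K" using K C0 by (intro mult_left_mono) auto
    then have "C / real K / (1 + \<tau>\<^sup>2) \<le> C / (1 + \<tau>\<^sup>2)" using K pos by (intro divide_right_mono) (auto simp: divide_le_eq)
    with far[OF True] show ?thesis by (simp add: C_def \<tau>_def)
  next
    case False
    have "s \<le> (\<Sum>l\<in>{-int (R * K)..<-int (R * K) + int H}. fejer H (t - real_of_int l / real H))"
      unfolding s_def H_def[symmetric]
    proof (rule sum_mono2)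
      have "1 * 1 \<le> R * K" using R K by (intro mult_mono) auto
      then have "2 * (R * K) + 1 \<le> 8 * (R * K)" by simp
      also have "\<dots> \<le> H" using mult_right_mono[OF N, of K] by (simp add: H_def mult_ac)
      finally have "2 * int (R * K) + 1 \<le> int H" by linarith
      then show "{-int (R * K)..int (R * K)} \<subseteq> {-int (R * K)..<-int (R * K) + int H}" by auto
    qed auto
    also have "\<dots> = 1" by (rule sum_fejer_shifts[OF H1])
    also have "1 \<le> C / (1 + \<tau>\<^sup>2)"
    proof -
      have "\<bar>\<tau>\<bar>\<^sup>2 \<le> (2 * real R)\<^sup>2" using False by (intro power_mono) (auto simp: \<tau>_def)
      then have "1 + \<tau>\<^sup>2 \<le> C" by (simp add: C_def power_mult_distrib)
      then show ?thesis using pos by simp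
    qed
    finally show ?thesis by (simp add: C_def \<tau>_def)
  qed
qed

definition grid_pt :: "nat \<Rightarrow> ('n::{finite,linorder} \<Rightarrow> int) \<Rightarrow> real ^ 'n::{finite,linorder}" where
  "grid_pt K l = (\<chi> i. real_of_int (l i) / real K)"

text \<open>
  Interpolation of the periodization of \<open>t \<mapsto> f (N t)\<close> at the points \<open>l / (K N)\<close>.
\<close>

definition fejer_interp :: "nat \<Rightarrow> nat \<Rightarrow> nat \<Rightarrow> (real ^ 'n::{finite,linorder} \<Rightarrow> real) \<Rightarrow> real ^ 'n::{finite,linorder} \<Rightarrow> real" where
  "fejer_interp R K N f t = (\<Sum>l\<in>UNIV \<rightarrow>\<^sub>E {-int (R * K)..int (R * K)}.
     f (grid_pt K l) * (\<Prod>i\<in>UNIV. fejer (K * N) (t $ i - real_of_int (l i) / real (K * N))))"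

text \<open>\<open>K0\<close> does not depend on \<open>N\<close>, and the error is measured against
  the majorant, so it can be summed over the tuples. Near the support the kernels are the weights of
  a probability distribution on the nodes, concentrated near \<open>N * t\<close>, and uniform
  continuity applies; away from it \<open>f\<close> vanishes and the interpolation is of order
  \<open>1 / K\<close> times the majorant.\<close>

lemma fejer_interp_error:
  fixes f :: "real ^ 'n::{finite,linorder} \<Rightarrow> real"
  assumes cont: "continuous_on UNIV f" and R: "R \<ge> 1" and supp: "\<And>x i. f x \<noteq> 0 \<Longrightarrow> \<bar>x $ i\<bar> \<le> real R" and \<epsilon>: "\<epsilon> > 0"
  shows "\<exists>K0\<ge>1. \<forall>K\<ge>K0. \<forall>N\<ge>8 * R. \<forall>t. (\<forall>i. \<bar>t $ i\<bar> \<le> 1 / 2) \<longrightarrow>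
    \<bar>f (real N *\<^sub>R t) - fejer_interp R K N f t\<bar> \<le> \<epsilon> * (\<Prod>i\<in>UNIV. bump N (t $ i))"
proof -
  let ?d = "CARD('n)"
  define BX :: "(real ^ 'n::{finite,linorder}) set" where "BX = cbox (\<chi> i. - (2 * real R + 1)) (\<chi> i. 2 * real R + 1)"
  have inBX: "x \<in> BX" if "\<And>i. \<bar>x $ i\<bar> \<le> 2 * real R + 1" for x
  proof -
    have "- (2 * real R + 1) \<le> x $ i \<and> x $ i \<le> 2 * real R + 1" for i using that[of i] by linarith
    then show ?thesis by (simp add: BX_def mem_box_cart)
  qed
  have comp: "compact BX" by (simp add: BX_def)
  have contB: "continuous_on BX f" using cont by (rule continuous_on_subset) auto
  obtain Mf where Mf: "Mf > 0" "\<And>x. \<bar>f x\<bar> \<le> Mf"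
  proof -
    have "bounded (f ` BX)" using comp contB by (intro compact_imp_bounded compact_continuous_image)
    then obtain B where B: "\<And>x. x \<in> BX \<Longrightarrow> \<bar>f x\<bar> \<le> B" by (auto simp: bounded_iff)
    have "\<bar>f x\<bar> \<le> \<bar>B\<bar> + 1" for x
    proof (cases "f x = 0")
      case False
      have "x \<in> BX"
      proof (intro inBX)
        fix i show "\<bar>x $ i\<bar> \<le> 2 * real R + 1" using supp[OF False, of i] by linarith
      qed
      then show ?thesis using B[of x] by linarith
    qed simp
    then show ?thesis by (intro that[of "\<bar>B\<bar> + 1"]) auto
  qed
  \<comment> \<open>In the near case \<open>1 / c1\<close> is a lower bound for the product of the
    \<open>1 / (1 + (\<tau> $ i)^2)\<close>, so an absolute error \<open>\<epsilon> / c1\<close> is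
    allowed. Half of it is given to \<omega> for the close nodes, half to \<eta> for the distant
    ones.\<close>
  define c1 where "c1 = (1 + 4 * (real R)\<^sup>2) ^ ?d"
  have c1: "c1 > 0" by (simp add: c1_def add_pos_nonneg)
  define \<omega> where "\<omega> = \<epsilon> / (2 * c1)"
  have \<omega>: "\<omega> > 0" using \<epsilon> c1 by (simp add: \<omega>_def)
  obtain \<delta>0 where \<delta>0: "\<delta>0 > 0" "\<And>x y. x \<in> BX \<Longrightarrow> y \<in> BX \<Longrightarrow> dist y x < \<delta>0 \<Longrightarrow> dist (f y) (f x) < \<omega>"
    using compact_uniformly_continuous[OF contB comp] \<omega> unfolding uniformly_continuous_on_def by metis
  define \<delta> where "\<delta> = min 1 (\<delta>0 / (real ?d + 1))"
  have \<delta>: "\<delta> > 0" "\<delta> \<le> 1" using \<delta>0 by (auto simp: \<delta>_def)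
  have close: "\<bar>f x - f y\<bar> \<le> \<omega>" if x: "\<And>i. \<bar>x $ i\<bar> \<le> 2 * real R" and xy: "\<And>i. \<bar>x $ i - y $ i\<bar> \<le> \<delta>" for x y
  proof -
    have "x \<in> BX"
    proof (intro inBX)
      fix i show "\<bar>x $ i\<bar> \<le> 2 * real R + 1" using x[of i] by linarith
    qed
    moreover have "y \<in> BX"
    proof (intro inBX)
      fix i show "\<bar>y $ i\<bar> \<le> 2 * real R + 1" using x[of i] xy[of i] \<delta> by linarith
    qed
    moreover have "dist x y < \<delta>0"
    proof -
      have "dist x y \<le> (\<Sum>i\<in>UNIV. \<bar>(x - y) $ i\<bar>)" unfolding dist_norm by (rule norm_le_l1_cart)
      also have "\<dots> \<le> (\<Sum>i\<in>(UNIV :: 'n set). \<delta>)" using xy by (intro sum_mono) auto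
      also have "\<dots> = real ?d * \<delta>" by simp
      also have "\<dots> \<le> real ?d * (\<delta>0 / (real ?d + 1))" by (intro mult_left_mono) (auto simp: \<delta>_def)
      also have "\<dots> < \<delta>0" using \<delta>0 by (simp add: field_simps)
      finally show ?thesis .
    qed
    ultimately have "dist (f x) (f y) < \<omega>" using \<delta>0(2) by blast
    then show ?thesis by (simp add: dist_real_def)
  qed
  define \<eta> where "\<eta> = \<epsilon> / (4 * c1 * Mf * real ?d)"
  have \<eta>: "\<eta> > 0" using \<epsilon> c1 Mf by (simp add: \<eta>_def)
  define C where "C = 216 * real R + 4 * (real R)\<^sup>2 + 1"
  have C1: "C \<ge> 1" by (simp add: C_def)
  \<comment> \<open>The first summand makes \<open>\<delta> * K\<close> so large that in each
    coordinate the kernel mass at distance more than \<delta> is at most \<eta>; the second makes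
    \<open>Mf * C ^ ?d / K\<close> at most \<epsilon> in the far case.\<close>
  define K0 where "K0 = nat \<lceil>(18 / \<eta> + 3) / \<delta>\<rceil> + nat \<lceil>Mf * C ^ ?d / \<epsilon>\<rceil> + 1"
  show ?thesis
  proof (intro exI[of _ K0] conjI allI impI)
    show "K0 \<ge> 1" by (simp add: K0_def)
    fix K N :: nat and t :: "real ^ 'n::{finite,linorder}" assume K: "K0 \<le> K" and N: "8 * R \<le> N" and t: "\<forall>i. \<bar>t $ i\<bar> \<le> 1 / 2"
    define H where "H = K * N"
    have K1: "K \<ge> 1" using K by (simp add: K0_def)
    have N1: "N \<ge> 1" using N R by linarith
    have H1: "H \<ge> 1" using K1 N1 by (simp add: H_def Suc_leI)
    have Kr: "(18 / \<eta> + 3) / \<delta> \<le> real K" "Mf * C ^ ?d / \<epsilon> \<le> real K" using K unfolding K0_def by linarith+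
    define \<tau> where "\<tau> = real N *\<^sub>R t"
    have \<tau>i: "\<tau> $ i = real N * t $ i" for i by (simp add: \<tau>_def)
    define w where "w = (\<lambda>i l. fejer H (t $ i - real_of_int l / real H))"
    have w0: "0 \<le> w i l" for i l by (simp add: w_def)
    define S where "S = {-int (R * K)..int (R * K)}"
    have A: "fejer_interp R K N f t = (\<Sum>l\<in>UNIV \<rightarrow>\<^sub>E S. f (grid_pt K l) * (\<Prod>i\<in>UNIV. w i (l i)))"
      by (simp add: fejer_interp_def w_def S_def H_def)
    have bumps: "(\<Prod>i\<in>UNIV. 1 / (1 + (\<tau> $ i)\<^sup>2)) \<le> (\<Prod>i\<in>UNIV. bump N (t $ i))"
      using bump_ge[OF N1] t by (intro prod_mono) (auto simp: \<tau>i)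
    have pos: "1 + (\<tau> $ i)\<^sup>2 > 0" for i by (simp add: add_pos_nonneg)
    have main: "\<bar>f \<tau> - fejer_interp R K N f t\<bar> \<le> \<epsilon> * (\<Prod>i\<in>UNIV. 1 / (1 + (\<tau> $ i)\<^sup>2))"
    proof (cases "\<forall>i. \<bar>\<tau> $ i\<bar> \<le> 2 * real R")
      case True
      \<comment> \<open>A full period of nodes around 0. At nodes outside the window
        \<open>S\<close> the function \<open>f\<close> vanishes, so the sum can be extended to
        \<open>J\<close>, where the weights add up to 1.\<close>
      define J where "J = {-int (H div 2)..<-int (H div 2) + int H}"
      have RKH: "8 * (R * K) \<le> H" using mult_right_mono[OF N, of K] by (simp add: H_def mult_ac)
      have SJ: "S \<subseteq> J"
      proof -
        have "1 * 1 \<le> R * K" using R K1 by (intro mult_mono) auto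
        with RKH have "int (R * K) \<le> int (H div 2)" "int (R * K) < - int (H div 2) + int H" by linarith+
        then show ?thesis unfolding S_def J_def by (simp add: ivl_subset del: of_nat_mult) (simp add: subset_iff del: of_nat_mult)
      qed
      have finJ: "finite J" by (simp add: J_def)
      have sumw: "(\<Sum>l\<in>J. w i l) = 1" for i unfolding w_def J_def by (rule sum_fejer_shifts[OF H1])
      have near: "\<bar>t $ i - real_of_int l / real H\<bar> \<le> 3 / 4" if l: "l \<in> J" for i l
      proof -
        have "2 * \<bar>l\<bar> \<le> int H" using l H1 unfolding J_def by auto
        then have "2 * \<bar>real_of_int l\<bar> \<le> real H" by linarith
        then have 1: "\<bar>real_of_int l / real H\<bar> \<le> 1 / 2" using H1 by (simp add: abs_divide divide_le_eq)
        have "real N * \<bar>t $ i\<bar> = \<bar>\<tau> $ i\<bar>" by (simp add: \<tau>i abs_mult)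
        moreover have "\<bar>\<tau> $ i\<bar> \<le> 2 * real R" using True by blast
        moreover have "real (8 * R) \<le> real N" using N by (simp only: of_nat_le_iff)
        ultimately have "real N * \<bar>t $ i\<bar> \<le> real N * (1 / 4)" by simp
        then have "\<bar>t $ i\<bar> \<le> 1 / 4" using N1 by (subst (asm) mult_le_cancel_left_pos) auto
        with 1 show ?thesis by linarith
      qed
      define far where "far = (\<lambda>i l. if \<delta> < \<bar>\<tau> $ i - real_of_int l / real K\<bar> then 1 else (0::real))"
      have tail: "(\<Sum>l\<in>J. w i l * far i l) \<le> \<eta>" for i
      proof -
        define D where "D = nat \<lfloor>\<delta> * real K\<rfloor>"
        have dK: "18 / \<eta> + 3 \<le> \<delta> * real K" using Kr(1) \<delta> by (simp add: field_simps)
        have \<eta>p: "18 / \<eta> > 0" using \<eta> by simp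
        have D: "D \<ge> 2" "real D \<le> \<delta> * real K" "18 / \<eta> + 2 \<le> real D"
          unfolding D_def using dK \<eta>p by linarith+
        have "(\<Sum>l\<in>J. w i l * far i l) = (\<Sum>l\<in>{l \<in> J. \<delta> < \<bar>\<tau> $ i - real_of_int l / real K\<bar>}. w i l)"
          using finJ by (intro sum.mono_neutral_cong_right) (auto simp: far_def)
        also have "\<dots> \<le> 18 / (real D - 1)"
          unfolding w_def H_def
        proof (rule fejer_tail[OF N1 K1])
          fix l assume l: "l \<in> {l \<in> J. \<delta> < \<bar>\<tau> $ i - real_of_int l / real K\<bar>}"
          show "\<bar>t $ i - real_of_int l / real (K * N)\<bar> \<le> 3 / 4" using near[of l i] l by (simp add: H_def)
          have "real (K * N) * t $ i - real_of_int l = real K * (\<tau> $ i - real_of_int l / real K)"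
            using K1 by (simp add: \<tau>i field_simps)
          then have "\<bar>real (K * N) * t $ i - real_of_int l\<bar> = real K * \<bar>\<tau> $ i - real_of_int l / real K\<bar>" by (simp add: abs_mult)
          moreover have "real K * \<delta> \<le> real K * \<bar>\<tau> $ i - real_of_int l / real K\<bar>" using l by (intro mult_left_mono) auto
          ultimately show "real D \<le> \<bar>real (K * N) * t $ i - real_of_int l\<bar>" using D by (simp add: mult.commute)
        qed (use D finJ in auto)
        also have "\<dots> \<le> 18 / (18 / \<eta>)"
        proof -
          have "18 / \<eta> \<le> real D - 1" using D by linarith
          then show ?thesis by (intro frac_le) (use \<eta>p in auto)
        qed
        also have "\<dots> = \<eta>" by simp
        finally show ?thesis .
      qed
      have A': "fejer_interp R K N f t = (\<Sum>l\<in>UNIV \<rightarrow>\<^sub>E J. f (grid_pt K l) * (\<Prod>i\<in>UNIV. w i (l i)))"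
        unfolding A
      proof (rule sum.mono_neutral_left)
        show "(UNIV :: 'n set) \<rightarrow>\<^sub>E S \<subseteq> UNIV \<rightarrow>\<^sub>E J" using SJ by (intro PiE_mono) auto
        show "finite ((UNIV :: 'n set) \<rightarrow>\<^sub>E J)" using finJ by (intro finite_PiE) auto
        show "\<forall>l\<in>(UNIV \<rightarrow>\<^sub>E J) - (UNIV \<rightarrow>\<^sub>E S). f (grid_pt K l) * (\<Prod>i\<in>UNIV. w i (l i)) = 0"
        proof
          fix l :: "'n \<Rightarrow> int" assume "l \<in> (UNIV \<rightarrow>\<^sub>E J) - (UNIV \<rightarrow>\<^sub>E S)"
          then obtain i where "l i \<notin> S" by (auto simp: PiE_iff)
          then have "int (R * K) < \<bar>l i\<bar>" by (auto simp: S_def)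
          then have "real_of_int (int (R * K)) < real_of_int \<bar>l i\<bar>" by (simp only: of_int_less_iff)
          then have "real R < \<bar>grid_pt K l $ i\<bar>" using K1 by (simp add: grid_pt_def abs_divide less_divide_eq)
          then have "f (grid_pt K l) = 0" using supp[of "grid_pt K l" i] by force
          then show "f (grid_pt K l) * (\<Prod>i\<in>UNIV. w i (l i)) = 0" by simp
        qed
      qed
      have one: "(\<Sum>l\<in>UNIV \<rightarrow>\<^sub>E J. \<Prod>i\<in>(UNIV :: 'n set). w i (l i)) = 1"
        using prod_sum_PiE[of "UNIV :: 'n set" "\<lambda>_. J" w] finJ by (simp add: sumw)
      \<comment> \<open>Only the factor of coordinate \<open>i\<close> carries the restriction to
        distant nodes; the weights in the other coordinates sum to 1.\<close>
      have far_sum: "(\<Sum>l\<in>UNIV \<rightarrow>\<^sub>E J. far i (l i) * (\<Prod>j\<in>(UNIV :: 'n set). w j (l j))) \<le> \<eta>" for i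
      proof -
        have "(\<Sum>l\<in>UNIV \<rightarrow>\<^sub>E J. far i (l i) * (\<Prod>j\<in>(UNIV :: 'n set). w j (l j))) =
          (\<Sum>l\<in>UNIV \<rightarrow>\<^sub>E J. \<Prod>j\<in>(UNIV :: 'n set). w j (l j) * (if j = i then far i (l j) else 1))"
          by (intro sum.cong refl) (simp add: prod.distrib mult.commute)
        also have "\<dots> = (\<Prod>j\<in>(UNIV :: 'n set). \<Sum>l\<in>J. w j l * (if j = i then far i l else 1))"
          using finJ by (subst prod_sum_PiE) auto
        also have "\<dots> = (\<Prod>j\<in>(UNIV :: 'n set). if j = i then (\<Sum>l\<in>J. w i l * far i l) else 1)"
          by (intro prod.cong) (auto simp: sumw)
        also have "\<dots> = (\<Sum>l\<in>J. w i l * far i l)" by simp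
        finally show ?thesis using tail[of i] by simp
      qed
      have pt: "\<bar>f \<tau> - f (grid_pt K l)\<bar> \<le> \<omega> + 2 * Mf * (\<Sum>i\<in>UNIV. far i (l i))" for l
      proof (cases "\<forall>i. \<bar>\<tau> $ i - grid_pt K l $ i\<bar> \<le> \<delta>")
        case True': True
        have "0 \<le> 2 * Mf * (\<Sum>i\<in>UNIV. far i (l i))" using Mf by (intro mult_nonneg_nonneg sum_nonneg) (auto simp: far_def)
        moreover have "\<bar>f \<tau> - f (grid_pt K l)\<bar> \<le> \<omega>" using True True' by (intro close) auto
        ultimately show ?thesis by linarith
      next
        case False
        then obtain i where "\<delta> < \<bar>\<tau> $ i - grid_pt K l $ i\<bar>" by (auto simp: not_le)
        then have "1 = far i (l i)" by (simp add: far_def grid_pt_def)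
        also have "\<dots> \<le> (\<Sum>i\<in>UNIV. far i (l i))" by (rule member_le_sum) (auto simp: far_def)
        finally have "2 * Mf * 1 \<le> 2 * Mf * (\<Sum>i\<in>UNIV. far i (l i))" using Mf by (intro mult_left_mono) auto
        moreover have "\<bar>f \<tau> - f (grid_pt K l)\<bar> \<le> 2 * Mf" using Mf(2)[of \<tau>] Mf(2)[of "grid_pt K l"] by linarith
        ultimately show ?thesis using \<omega> by linarith
      qed
      have "f \<tau> - fejer_interp R K N f t = (\<Sum>l\<in>UNIV \<rightarrow>\<^sub>E J. (f \<tau> - f (grid_pt K l)) * (\<Prod>i\<in>UNIV. w i (l i)))"
        unfolding A' left_diff_distrib sum_subtractf sum_distrib_left[symmetric] one by simp
      also have "\<bar>\<dots>\<bar> \<le> (\<Sum>l\<in>UNIV \<rightarrow>\<^sub>E J. \<bar>(f \<tau> - f (grid_pt K l)) * (\<Prod>i\<in>UNIV. w i (l i))\<bar>)" by (rule sum_abs)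
      also have "\<dots> \<le> (\<Sum>l\<in>UNIV \<rightarrow>\<^sub>E J. (\<omega> + 2 * Mf * (\<Sum>i\<in>UNIV. far i (l i))) * (\<Prod>i\<in>UNIV. w i (l i)))"
      proof (rule sum_mono)
        fix l
        have "0 \<le> (\<Prod>i\<in>UNIV. w i (l i))" using w0 by (intro prod_nonneg) auto
        then show "\<bar>(f \<tau> - f (grid_pt K l)) * (\<Prod>i\<in>UNIV. w i (l i))\<bar> \<le> (\<omega> + 2 * Mf * (\<Sum>i\<in>UNIV. far i (l i))) * (\<Prod>i\<in>UNIV. w i (l i))"
          using pt[of l] by (simp add: abs_mult mult_right_mono)
      qed
      also have "\<dots> = \<omega> + 2 * Mf * (\<Sum>i\<in>UNIV. \<Sum>l\<in>UNIV \<rightarrow>\<^sub>E J. far i (l i) * (\<Prod>j\<in>UNIV. w j (l j)))"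
        unfolding distrib_right sum.distrib sum_distrib_left[symmetric] one
        by (subst sum.swap) (simp add: sum_distrib_left sum_distrib_right mult.assoc)
      also have "\<dots> \<le> \<omega> + 2 * Mf * (\<Sum>i\<in>(UNIV :: 'n set). \<eta>)"
        using Mf far_sum by (intro add_left_mono mult_left_mono sum_mono) auto
      also have "\<dots> = \<epsilon> / c1" using Mf c1 by (simp add: \<omega>_def \<eta>_def field_simps)
      also have "\<dots> \<le> \<epsilon> * (\<Prod>i\<in>UNIV. 1 / (1 + (\<tau> $ i)\<^sup>2))"
      proof -
        have "1 / c1 = (\<Prod>i\<in>(UNIV :: 'n set). 1 / (1 + 4 * (real R)\<^sup>2))" by (simp add: c1_def power_one_over)
        also have "\<dots> \<le> (\<Prod>i\<in>UNIV. 1 / (1 + (\<tau> $ i)\<^sup>2))"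
        proof (intro prod_mono conjI divide_left_mono)
          fix i
          have "\<bar>\<tau> $ i\<bar>\<^sup>2 \<le> (2 * real R)\<^sup>2" using True by (intro power_mono) auto
          then show "1 + (\<tau> $ i)\<^sup>2 \<le> 1 + 4 * (real R)\<^sup>2" by (simp add: power_mult_distrib)
        qed (auto intro!: mult_pos_pos simp: add_pos_nonneg)
        finally have "\<epsilon> * (1 / c1) \<le> \<epsilon> * (\<Prod>i\<in>UNIV. 1 / (1 + (\<tau> $ i)\<^sup>2))" using \<epsilon> by (intro mult_left_mono) auto
        then show ?thesis by simp
      qed
      finally show ?thesis .
    next
      case False
      then obtain i0 where i0: "2 * real R < \<bar>\<tau> $ i0\<bar>" by (auto simp: not_le)
      have "f \<tau> = 0" using supp[of \<tau> i0] i0 R by force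
      define s where "s = (\<lambda>i. \<Sum>l\<in>S. w i l)"
      have s: "0 \<le> s i" "s i \<le> C * (1 / (1 + (\<tau> $ i)\<^sup>2))" "2 * real R < \<bar>\<tau> $ i\<bar> \<Longrightarrow> s i \<le> C * (1 / (1 + (\<tau> $ i)\<^sup>2)) / real K" for i
      proof -
        have ti: "\<bar>t $ i\<bar> \<le> 1 / 2" using t by blast
        have si: "s i = (\<Sum>l\<in>{-int (R * K)..int (R * K)}. fejer (K * N) (t $ i - real_of_int l / real (K * N)))"
          by (simp only: s_def S_def w_def H_def)
        show "0 \<le> s i" unfolding si by (rule sum_fejer_window_le(1)[OF R K1 N ti])
        have "s i \<le> C / (1 + (\<tau> $ i)\<^sup>2)" unfolding si C_def \<tau>i by (rule sum_fejer_window_le(2)[OF R K1 N ti])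
        then show "s i \<le> C * (1 / (1 + (\<tau> $ i)\<^sup>2))" by simp
        assume "2 * real R < \<bar>\<tau> $ i\<bar>"
        then have "s i \<le> C / real K / (1 + (\<tau> $ i)\<^sup>2)" unfolding si C_def \<tau>i by (rule sum_fejer_window_le(3)[OF R K1 N ti])
        moreover have "x / y / z = x * (1 / z) / y" for x y z :: real by simp
        ultimately show "s i \<le> C * (1 / (1 + (\<tau> $ i)\<^sup>2)) / real K" by metis
      qed
      have "\<bar>fejer_interp R K N f t\<bar> \<le> (\<Sum>l\<in>UNIV \<rightarrow>\<^sub>E S. \<bar>f (grid_pt K l) * (\<Prod>i\<in>UNIV. w i (l i))\<bar>)"
        unfolding A by (rule sum_abs)
      also have "\<dots> \<le> (\<Sum>l\<in>UNIV \<rightarrow>\<^sub>E S. Mf * (\<Prod>i\<in>UNIV. w i (l i)))"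
      proof (rule sum_mono)
        fix l
        have "0 \<le> (\<Prod>i\<in>UNIV. w i (l i))" using w0 by (intro prod_nonneg) auto
        then show "\<bar>f (grid_pt K l) * (\<Prod>i\<in>UNIV. w i (l i))\<bar> \<le> Mf * (\<Prod>i\<in>UNIV. w i (l i))"
          using Mf(2) by (simp add: abs_mult mult_right_mono)
      qed
      also have "\<dots> = Mf * (\<Prod>i\<in>UNIV. s i)"
        unfolding sum_distrib_left[symmetric] s_def by (subst prod_sum_PiE) (auto simp: S_def)
      \<comment> \<open>One coordinate outside twice the window is enough to gain
        \<open>1 / K\<close>; the others contribute the constant \<open>C\<close> and the
        decay.\<close>
      also have "(\<Prod>i\<in>UNIV. s i) = s i0 * (\<Prod>i\<in>UNIV - {i0}. s i)" by (simp add: prod.remove[of UNIV i0])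
      also have "\<dots> \<le> (C * (1 / (1 + (\<tau> $ i0)\<^sup>2)) / real K) * (\<Prod>i\<in>UNIV - {i0}. C * (1 / (1 + (\<tau> $ i)\<^sup>2)))"
        using s i0 C1 by (intro mult_mono prod_mono prod_nonneg) (auto intro: order_trans)
      also have "\<dots> = (\<Prod>i\<in>UNIV. C * (1 / (1 + (\<tau> $ i)\<^sup>2))) / real K"
        by (simp add: prod.remove[of UNIV i0])
      also have "\<dots> = C ^ ?d / real K * (\<Prod>i\<in>UNIV. 1 / (1 + (\<tau> $ i)\<^sup>2))"
        unfolding prod.distrib by simp
      finally have "\<bar>fejer_interp R K N f t\<bar> \<le> (Mf * C ^ ?d / real K) * (\<Prod>i\<in>UNIV. 1 / (1 + (\<tau> $ i)\<^sup>2))"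
        using Mf by (simp add: mult_left_mono mult.assoc)
      also have "\<dots> \<le> \<epsilon> * (\<Prod>i\<in>UNIV. 1 / (1 + (\<tau> $ i)\<^sup>2))"
      proof (intro mult_right_mono prod_nonneg)
        have "Mf * C ^ ?d \<le> real K * \<epsilon>" using Kr(2) \<epsilon> by (simp add: divide_le_eq)
        then show "Mf * C ^ ?d / real K \<le> \<epsilon>" using K1 by (simp add: divide_le_eq mult.commute)
      qed (use pos in \<open>auto intro: less_imp_le\<close>)
      finally show ?thesis using \<open>f \<tau> = 0\<close> by simp
    qed
    also have "\<dots> \<le> \<epsilon> * (\<Prod>i\<in>UNIV. bump N (t $ i))" using bumps \<epsilon> by (intro mult_left_mono) auto
    finally show "\<bar>f (real N *\<^sub>R t) - fejer_interp R K N f t\<bar> \<le> \<epsilon> * (\<Prod>i\<in>UNIV. bump N (t $ i))" by (simp add: \<tau>_def)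
  qed
qed

section \<open>Riemann sums and the limit along the sequence of N\<close>

lemma continuous_support_bounded:
  fixes f :: "real ^ 'n::{finite,linorder} \<Rightarrow> real"
  assumes "continuous_on UNIV f" and supp: "\<And>x i. f x \<noteq> 0 \<Longrightarrow> \<bar>x $ i\<bar> \<le> R"
  obtains B where "B > 0" "\<And>x. \<bar>f x\<bar> \<le> B"
proof -
  define S :: "(real ^ 'n::{finite,linorder}) set" where "S = cbox (\<chi> i. - R) (\<chi> i. R)"
  have "bounded (f ` S)"
    unfolding S_def using assms(1) by (intro compact_imp_bounded compact_continuous_image) (auto intro: continuous_on_subset)
  then obtain B where B: "\<And>x. x \<in> S \<Longrightarrow> \<bar>f x\<bar> \<le> B" by (auto simp: bounded_iff)
  have "\<bar>f x\<bar> \<le> \<bar>B\<bar> + 1" for x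
  proof (cases "f x = 0")
    case False
    have "- R \<le> x $ i \<and> x $ i \<le> R" for i using supp[OF False, of i] by linarith
    then have "x \<in> S" by (simp add: S_def mem_box_cart)
    then show ?thesis using B[of x] by linarith
  qed simp
  then show ?thesis by (intro that[of "\<bar>B\<bar> + 1"]) auto
qed

text \<open>The cells are half-open, so that every point lies in exactly one of them.\<close>

definition grid_cell :: "nat \<Rightarrow> ('n::{finite,linorder} \<Rightarrow> int) \<Rightarrow> (real ^ 'n::{finite,linorder}) set" where
  "grid_cell K l = {x. \<forall>i. \<lfloor>real K * x $ i\<rfloor> = l i}"

lemma grid_cell:
  fixes l :: "'n::{finite,linorder} \<Rightarrow> int"
  assumes K: "K \<ge> 1"
  shows "grid_cell K l \<in> sets lborel" "emeasure lborel (grid_cell K l) = ennreal (1 / real K ^ CARD('n))"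
proof -
  define a :: "real ^ 'n::{finite,linorder}" where "a = (\<chi> i. real_of_int (l i) / real K)"
  define b :: "real ^ 'n::{finite,linorder}" where "b = (\<chi> i. (real_of_int (l i) + 1) / real K)"
  have iff: "x \<in> grid_cell K l \<longleftrightarrow> (\<forall>i. a $ i \<le> x $ i \<and> x $ i < b $ i)" for x
    using K by (auto simp: grid_cell_def a_def b_def floor_eq_iff field_simps)
  have eq: "grid_cell K l = (\<Inter>i. {x. a $ i \<le> x $ i} \<inter> {x. x $ i < b $ i})" by (auto simp: iff)
  have "{x. a $ i \<le> x $ i} \<inter> {x. x $ i < b $ i} \<in> sets borel" for i
    by (intro sets.Int borel_closed borel_open closed_halfspace_component_ge_cart open_halfspace_component_lt_cart)
  then show meas: "grid_cell K l \<in> sets lborel" unfolding eq by (auto intro!: sets.finite_INT)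
  have "emeasure lborel (cbox a b) = ennreal (1 / real K ^ CARD('n))"
  proof -
    have "emeasure lborel (cbox a b) = ennreal (measure lborel (cbox a b))"
      by (intro emeasure_eq_ennreal_measure) (simp add: emeasure_lborel_cbox_eq)
    also have "measure lborel (cbox a b) = (\<Prod>i\<in>UNIV. b $ i - a $ i)"
    proof (rule content_cbox_cart)
      have "a \<in> cbox a b" by (auto simp: mem_box_cart a_def b_def divide_right_mono)
      then show "cbox a b \<noteq> {}" by blast
    qed
    also have "\<dots> = (\<Prod>i\<in>(UNIV :: 'n set). 1 / real K)"
      by (intro prod.cong) (auto simp: a_def b_def diff_divide_distrib[symmetric])
    finally show ?thesis by (simp add: power_one_over)
  qed
  moreover have "emeasure lborel (box a b) = emeasure lborel (cbox a b)"
    by (simp add: emeasure_lborel_box_eq emeasure_lborel_cbox_eq)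
  moreover have "box a b \<subseteq> grid_cell K l" "grid_cell K l \<subseteq> cbox a b"
    by (auto simp: iff mem_box_cart less_imp_le)
  ultimately show "emeasure lborel (grid_cell K l) = ennreal (1 / real K ^ CARD('n))"
    using meas emeasure_mono[of "box a b" "grid_cell K l" lborel] emeasure_mono[of "grid_cell K l" "cbox a b" lborel]
    by (intro antisym) auto
qed

text \<open>\<open>fK\<close> is the step function that takes on each cell the value of
  \<open>f\<close> at the lower corner, so its integral is the Riemann sum. It converges pointwise
  by continuity and is dominated by a multiple of the indicator of \<open>W\<close>, the box of the
  support enlarged by 1 since a grid point is at most \<open>1 / K \<le> 1\<close> away in each
  coordinate.\<close>

lemma riemann_sums_tendsto:
  fixes f :: "real ^ 'n::{finite,linorder} \<Rightarrow> real"
  assumes cont: "continuous_on UNIV f" and supp: "\<And>x i. f x \<noteq> 0 \<Longrightarrow> \<bar>x $ i\<bar> \<le> real R"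
  shows "(\<lambda>n. (\<Sum>l\<in>UNIV \<rightarrow>\<^sub>E {-int (R * Suc n)..int (R * Suc n)}. f (grid_pt (Suc n) l)) / real (Suc n) ^ CARD('n::{finite,linorder}))
    \<longlonglongrightarrow> (\<integral>x. f x \<partial>lborel)"
proof -
  obtain B where B: "B > 0" "\<And>x. \<bar>f x\<bar> \<le> B" using continuous_support_bounded[OF cont supp] by blast
  define S where "S = (\<lambda>K. (UNIV :: 'n set) \<rightarrow>\<^sub>E {-int (R * K)..int (R * K)})"
  define fK where "fK = (\<lambda>K x. \<Sum>l\<in>S K. f (grid_pt K l) * indicator (grid_cell K l) x)"
  have finS: "finite (S K)" for K unfolding S_def by (intro finite_PiE) auto
  have fK: "fK K x = f (grid_pt K (\<lambda>i. \<lfloor>real K * x $ i\<rfloor>))" if K: "K \<ge> 1" for K x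
  proof -
    define l0 where "l0 = (\<lambda>i. \<lfloor>real K * x $ i\<rfloor>)"
    have ind: "indicator (grid_cell K l) x = (if l = l0 then 1 else (0::real))" for l
      by (auto simp: grid_cell_def l0_def indicator_def)
    have "fK K x = (\<Sum>l\<in>S K. if l = l0 then f (grid_pt K l0) else 0)"
      unfolding fK_def ind by (intro sum.cong) auto
    also have "\<dots> = (if l0 \<in> S K then f (grid_pt K l0) else 0)" using finS by simp
    also have "\<dots> = f (grid_pt K l0)"
    proof (cases "l0 \<in> S K")
      case False
      then obtain i where "l0 i \<notin> {-int (R * K)..int (R * K)}" by (auto simp: S_def PiE_iff)
      then have "int (R * K) < \<bar>l0 i\<bar>" by auto
      then have "real_of_int (int (R * K)) < real_of_int \<bar>l0 i\<bar>" by (simp only: of_int_less_iff)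
      then have "real R < \<bar>grid_pt K l0 $ i\<bar>" using K by (simp add: grid_pt_def abs_divide less_divide_eq)
      then have "f (grid_pt K l0) = 0" using supp[of "grid_pt K l0" i] by force
      then show ?thesis using False by simp
    qed simp
    finally show ?thesis by (simp add: l0_def)
  qed
  have near: "\<bar>grid_pt K (\<lambda>i. \<lfloor>real K * x $ i\<rfloor>) $ i - x $ i\<bar> \<le> 1 / real K" if K: "K \<ge> 1" for K and x :: "real ^ 'n::{finite,linorder}" and i
  proof -
    have "\<bar>real_of_int \<lfloor>real K * x $ i\<rfloor> - real K * x $ i\<bar> \<le> 1" by linarith
    then have "\<bar>real_of_int \<lfloor>real K * x $ i\<rfloor> - real K * x $ i\<bar> / real K \<le> 1 / real K" by (intro divide_right_mono) auto
    moreover have "grid_pt K (\<lambda>i. \<lfloor>real K * x $ i\<rfloor>) $ i - x $ i = (real_of_int \<lfloor>real K * x $ i\<rfloor> - real K * x $ i) / real K"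
      using K by (simp add: grid_pt_def field_simps)
    ultimately show ?thesis by (simp add: abs_divide)
  qed
  have int: "(\<integral>x. fK K x \<partial>lborel) = (\<Sum>l\<in>S K. f (grid_pt K l)) / real K ^ CARD('n)" if K: "K \<ge> 1" for K
  proof -
    have i: "integrable lborel (\<lambda>x. f (grid_pt K l) * indicator (grid_cell K l) x)" for l
      using grid_cell[OF K, of l] by (intro integrable_mult_right integrable_real_indicator) auto
    have m: "(\<integral>x. f (grid_pt K l) * indicator (grid_cell K l) x \<partial>lborel) = f (grid_pt K l) * (1 / real K ^ CARD('n))" for l
      using grid_cell[OF K, of l] by (simp add: measure_def)
    have "(\<integral>x. fK K x \<partial>lborel) = (\<Sum>l\<in>S K. \<integral>x. f (grid_pt K l) * indicator (grid_cell K l) x \<partial>lborel)"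
      unfolding fK_def by (rule Bochner_Integration.integral_sum) (rule i)
    then show ?thesis unfolding m by (simp add: sum_divide_distrib)
  qed
  have lim: "(\<lambda>n. fK (Suc n) x) \<longlonglongrightarrow> f x" for x
  proof -
    have inv: "(\<lambda>n. 1 / real (Suc n)) \<longlonglongrightarrow> 0" using LIMSEQ_inverse_real_of_nat by (simp add: divide_inverse)
    have "(\<lambda>n. grid_pt (Suc n) (\<lambda>i. \<lfloor>real (Suc n) * x $ i\<rfloor>)) \<longlonglongrightarrow> x"
    proof (rule vec_tendstoI)
      fix i
      have "(\<lambda>n. grid_pt (Suc n) (\<lambda>i. \<lfloor>real (Suc n) * x $ i\<rfloor>) $ i - x $ i) \<longlonglongrightarrow> 0"
      proof (rule Lim_null_comparison[OF always_eventually inv], rule allI)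
        fix n show "norm (grid_pt (Suc n) (\<lambda>i. \<lfloor>real (Suc n) * x $ i\<rfloor>) $ i - x $ i) \<le> 1 / real (Suc n)"
          unfolding real_norm_def by (rule near) simp
      qed
      then show "(\<lambda>n. grid_pt (Suc n) (\<lambda>i. \<lfloor>real (Suc n) * x $ i\<rfloor>) $ i) \<longlonglongrightarrow> x $ i" by (rule LIM_zero_cancel)
    qed
    then have "(\<lambda>n. f (grid_pt (Suc n) (\<lambda>i. \<lfloor>real (Suc n) * x $ i\<rfloor>))) \<longlonglongrightarrow> f x"
      using cont by (intro isCont_tendsto_compose[of x f]) (auto simp: continuous_on_eq_continuous_at)
    then show ?thesis by (simp add: fK del: of_nat_Suc)
  qed
  define W :: "(real ^ 'n::{finite,linorder}) set" where "W = cbox (\<chi> i. - (real R + 1)) (\<chi> i. real R + 1)"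
  have "(\<lambda>n. \<integral>x. fK (Suc n) x \<partial>lborel) \<longlonglongrightarrow> (\<integral>x. f x \<partial>lborel)"
  proof (rule integral_dominated_convergence[where w = "\<lambda>x. B * indicator W x"])
    show "f \<in> borel_measurable lborel" using cont by (simp add: borel_measurable_continuous_onI)
    show "fK (Suc n) \<in> borel_measurable lborel" for n
      unfolding fK_def using grid_cell(1)[of "Suc n"] by (intro borel_measurable_sum borel_measurable_times borel_measurable_indicator) auto
    show "integrable lborel (\<lambda>x. B * indicator W x)"
      by (intro integrable_mult_right integrable_real_indicator) (auto simp: W_def emeasure_lborel_cbox_eq)
    show "AE x in lborel. (\<lambda>n. fK (Suc n) x) \<longlonglongrightarrow> f x" using lim by auto
    show "AE x in lborel. norm (fK (Suc n) x) \<le> B * indicator W x" for n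
    proof (intro AE_I2)
      fix x :: "real ^ 'n::{finite,linorder}"
      define y where "y = grid_pt (Suc n) (\<lambda>i. \<lfloor>real (Suc n) * x $ i\<rfloor>)"
      have fy: "fK (Suc n) x = f y" unfolding y_def by (rule fK) simp
      show "norm (fK (Suc n) x) \<le> B * indicator W x"
      proof (cases "f y = 0")
        case False
        have "- (real R + 1) \<le> x $ i \<and> x $ i \<le> real R + 1" for i
        proof -
          have "\<bar>y $ i - x $ i\<bar> \<le> 1 / real (Suc n)" unfolding y_def by (rule near) simp
          moreover have "1 / real (Suc n) \<le> 1" by simp
          ultimately have "\<bar>y $ i - x $ i\<bar> \<le> 1" by linarith
          moreover have "\<bar>y $ i\<bar> \<le> real R" using supp[OF False] .
          ultimately show ?thesis by linarith
        qed
        then have "x \<in> W" by (simp add: W_def mem_box_cart)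
        then show ?thesis using B(2)[of y] by (simp add: fy)
      qed (use B(1) in \<open>simp add: fy\<close>)
    qed
  qed
  moreover have "(\<integral>x. fK (Suc n) x \<partial>lborel) = (\<Sum>l\<in>S (Suc n). f (grid_pt (Suc n) l)) / real (Suc n) ^ CARD('n)" for n
    by (rule int) simp
  ultimately show ?thesis unfolding S_def by (simp only:)
qed

text \<open>Three errors of size \<open>\<epsilon> / 3\<close>. Two of them fix \<open>K\<close>:
  the Riemann sum, and the interpolation, which is uniform in \<open>N\<close> because the mean of
  the majorant is bounded by \<open>C\<close>. For this \<open>K\<close> finitely many Fejer
  averages converge as \<open>m\<close> grows. Periodicity lets the kernels be evaluated at a point
  in place of its centred representative.\<close>

lemma good_along_tendsto:
  fixes f :: "real ^ 'n::{finite,linorder} \<Rightarrow> real"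
  assumes good: "good_along k TYPE('n::{finite,linorder}) r \<alpha>" and r: "r \<ge> 1"
    and cont: "continuous_on UNIV f" and R: "R \<ge> 1" and supp: "\<And>x i. f x \<noteq> 0 \<Longrightarrow> \<bar>x $ i\<bar> \<le> real R"
  shows "(\<lambda>m. corr_mean k \<alpha> (Suc m ^ r) (Suc m ^ r) f) \<longlonglongrightarrow> (\<integral>x. f x \<partial>lborel)"
proof (rule LIMSEQ_I)
  fix \<epsilon> :: real assume \<epsilon>: "\<epsilon> > 0"
  let ?d = "CARD('n)"
  define Dl where "Dl = (\<lambda>x. power_diffs x \<alpha> :: real ^ 'n::{finite,linorder})"
  obtain C0 where C0: "\<And>m. (\<Sum>x\<in>distinct_tuples k (Suc m ^ r). \<Prod>i\<in>UNIV. bump (Suc m ^ r) (Dl x $ i)) / real (Suc m ^ r) \<le> C0"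
    using good unfolding good_along_def Dl_def by blast
  define C where "C = \<bar>C0\<bar> + 1"
  have C: "C > 0" by (simp add: C_def)
  define \<epsilon>1 where "\<epsilon>1 = \<epsilon> / (3 * C)"
  have \<epsilon>1: "\<epsilon>1 > 0" using \<epsilon> C by (simp add: \<epsilon>1_def)
  obtain K0 where K0: "\<And>K N t. K0 \<le> K \<Longrightarrow> 8 * R \<le> N \<Longrightarrow> (\<And>i. \<bar>t $ i\<bar> \<le> 1 / 2) \<Longrightarrow>
      \<bar>f (real N *\<^sub>R t) - fejer_interp R K N f t\<bar> \<le> \<epsilon>1 * (\<Prod>i\<in>UNIV. bump N (t $ i))"
    using fejer_interp_error[OF cont R supp \<epsilon>1] by blast
  define I where "I = (\<integral>x. f x \<partial>lborel)"
  define S where "S = (\<lambda>K. (UNIV :: 'n set) \<rightarrow>\<^sub>E {-int (R * K)..int (R * K)})"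
  obtain n0 where n0: "\<And>n. n \<ge> n0 \<Longrightarrow> \<bar>(\<Sum>l\<in>S (Suc n). f (grid_pt (Suc n) l)) / real (Suc n) ^ ?d - I\<bar> < \<epsilon> / 3"
    using LIMSEQ_D[OF riemann_sums_tendsto[OF cont supp], of "\<epsilon> / 3"] \<epsilon> unfolding S_def I_def real_norm_def by auto
  define K where "K = Suc (max K0 n0)"
  have K: "K0 \<le> K" "K \<ge> 1" by (auto simp: K_def)
  define A where "A = (\<Sum>l\<in>S K. f (grid_pt K l)) / real K ^ ?d"
  have A: "\<bar>A - I\<bar> < \<epsilon> / 3" unfolding A_def K_def by (rule n0) simp
  define P where "P = (\<lambda>m. (\<Sum>x\<in>distinct_tuples k (Suc m ^ r). fejer_interp R K (Suc m ^ r) f (Dl x)) / real (Suc m ^ r))"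
  have "P \<longlonglongrightarrow> A"
  proof -
    have p1: "P m = (\<Sum>l\<in>S K. f (grid_pt K l) * ((\<Sum>x\<in>distinct_tuples k (Suc m ^ r). \<Prod>i\<in>UNIV.
       fejer (K * Suc m ^ r) (Dl x $ i - real_of_int (l i) / real (K * Suc m ^ r))) / real (Suc m ^ r)))" for m
      unfolding P_def fejer_interp_def S_def
      by (subst sum.swap) (simp only: sum_divide_distrib[symmetric] sum_distrib_left[symmetric] times_divide_eq_right)
    have p2: "(\<lambda>m. \<Sum>l\<in>S K. f (grid_pt K l) * ((\<Sum>x\<in>distinct_tuples k (Suc m ^ r). \<Prod>i\<in>UNIV.
       fejer (K * Suc m ^ r) (Dl x $ i - real_of_int (l i) / real (K * Suc m ^ r))) / real (Suc m ^ r))) \<longlonglongrightarrow>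
       (\<Sum>l\<in>S K. f (grid_pt K l) * (1 / real K ^ ?d))"
    proof (intro tendsto_sum tendsto_mult tendsto_const)
      fix l :: "'n \<Rightarrow> int"
      show "(\<lambda>m. (\<Sum>x\<in>distinct_tuples k (Suc m ^ r). \<Prod>i\<in>UNIV.
       fejer (K * Suc m ^ r) (Dl x $ i - real_of_int (l i) / real (K * Suc m ^ r))) / real (Suc m ^ r)) \<longlonglongrightarrow> 1 / real K ^ ?d"
        using good K(2) unfolding good_along_def Dl_def by blast
    qed
    have p3: "(\<Sum>l\<in>S K. f (grid_pt K l) * (1 / real K ^ ?d)) = A" by (simp add: A_def sum_divide_distrib)
    show ?thesis using p2 unfolding p3 p1[symmetric] .
  qed
  then obtain m0 where m0: "\<And>m. m \<ge> m0 \<Longrightarrow> \<bar>P m - A\<bar> < \<epsilon> / 3"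
    using LIMSEQ_D[of P A "\<epsilon> / 3"] \<epsilon> unfolding real_norm_def by auto
  show "\<exists>no. \<forall>m\<ge>no. norm (corr_mean k \<alpha> (Suc m ^ r) (Suc m ^ r) f - (\<integral>x. f x \<partial>lborel)) < \<epsilon>"
  proof (intro exI[of _ "max m0 (8 * R)"] allI impI)
    fix m assume m: "max m0 (8 * R) \<le> m"
    define N where "N = Suc m ^ r"
    have N: "8 * R \<le> N"
    proof -
      have "Suc m \<le> Suc m ^ r" using r by (intro self_le_power) auto
      then show ?thesis using m by (simp add: N_def)
    qed
    have eqi: "fejer_interp R K N f (frac_centered t) = fejer_interp R K N f t" for t :: "real ^ 'n::{finite,linorder}"
      unfolding fejer_interp_def by (simp only: fejer_frac_centered)
    have "corr_mean k \<alpha> N N f - P m = (\<Sum>x\<in>distinct_tuples k N. f (real N *\<^sub>R frac_centered (Dl x)) - fejer_interp R K N f (frac_centered (Dl x))) / real N"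
      unfolding eqi by (simp add: corr_mean_def P_def N_def Dl_def sum_subtractf diff_divide_distrib)
    also have "\<bar>\<dots>\<bar> \<le> (\<Sum>x\<in>distinct_tuples k N. \<epsilon>1 * (\<Prod>i\<in>UNIV. bump N (Dl x $ i))) / real N"
    proof -
      have "\<bar>\<Sum>x\<in>distinct_tuples k N. f (real N *\<^sub>R frac_centered (Dl x)) - fejer_interp R K N f (frac_centered (Dl x))\<bar>
        \<le> (\<Sum>x\<in>distinct_tuples k N. \<bar>f (real N *\<^sub>R frac_centered (Dl x)) - fejer_interp R K N f (frac_centered (Dl x))\<bar>)" by (rule sum_abs)
      also have "\<dots> \<le> (\<Sum>x\<in>distinct_tuples k N. \<epsilon>1 * (\<Prod>i\<in>UNIV. bump N (Dl x $ i)))"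
      proof (rule sum_mono)
        fix x
        show "\<bar>f (real N *\<^sub>R frac_centered (Dl x)) - fejer_interp R K N f (frac_centered (Dl x))\<bar> \<le> \<epsilon>1 * (\<Prod>i\<in>UNIV. bump N (Dl x $ i))"
          using K0[OF K(1) N frac_centered_abs_le, of "Dl x"] by (simp add: bump_frac_centered)
      qed
      finally show ?thesis by (simp add: abs_divide divide_right_mono)
    qed
    also have "\<dots> = \<epsilon>1 * ((\<Sum>x\<in>distinct_tuples k N. \<Prod>i\<in>UNIV. bump N (Dl x $ i)) / real N)" by (simp add: sum_distrib_left)
    also have "\<dots> \<le> \<epsilon>1 * C"
    proof (intro mult_left_mono)
      show "(\<Sum>x\<in>distinct_tuples k N. \<Prod>i\<in>UNIV. bump N (Dl x $ i)) / real N \<le> C"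
        using C0[of m] unfolding N_def C_def by linarith
    qed (use \<epsilon>1 in auto)
    also have "\<dots> = \<epsilon> / 3" using C by (simp add: \<epsilon>1_def)
    finally have "\<bar>corr_mean k \<alpha> N N f - P m\<bar> \<le> \<epsilon> / 3" .
    moreover have "\<bar>P m - A\<bar> < \<epsilon> / 3" using m by (intro m0) auto
    ultimately have "\<bar>corr_mean k \<alpha> N N f - I\<bar> < \<epsilon>" using A by linarith
    then show "norm (corr_mean k \<alpha> (Suc m ^ r) (Suc m ^ r) f - (\<integral>x. f x \<partial>lborel)) < \<epsilon>"
      by (simp add: N_def I_def)
  qed
qed

section \<open>Passage from the sequence to all N\<close>

text \<open>Uniform continuity handles \<open>x\<close> in the box of radius \<open>2 * R\<close>.
  Outside it both values vanish, since \<open>\<eta> \<le> 1 / 2\<close> gives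
  \<open>\<rho> \<ge> 1 / 2\<close>. The error is thus small relative to the indicator of a fixed
  box, which a continuous function of bounded support can majorize.\<close>

lemma dilation_error:
  fixes f :: "real ^ 'n::{finite,linorder} \<Rightarrow> real"
  assumes cont: "continuous_on UNIV f" and R: "R \<ge> (1::real)" and supp: "\<And>x i. f x \<noteq> 0 \<Longrightarrow> \<bar>x $ i\<bar> \<le> R" and \<epsilon>: "\<epsilon> > 0"
  obtains \<eta> where "\<eta> > 0" "\<And>\<rho> x. \<bar>\<rho> - 1\<bar> \<le> \<eta> \<Longrightarrow> \<bar>f (\<rho> *\<^sub>R x) - f x\<bar> \<le> \<epsilon> * (if \<forall>i. \<bar>x $ i\<bar> \<le> 2 * R then 1 else 0)"
proof -
  let ?d = "CARD('n)"
  define BX :: "(real ^ 'n::{finite,linorder}) set" where "BX = cbox (\<chi> i. - (3 * R)) (\<chi> i. 3 * R)"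
  have inBX: "x \<in> BX" if "\<And>i. \<bar>x $ i\<bar> \<le> 3 * R" for x
  proof -
    have "- (3 * R) \<le> x $ i \<and> x $ i \<le> 3 * R" for i using that[of i] by linarith
    then show ?thesis by (simp add: BX_def mem_box_cart)
  qed
  have "uniformly_continuous_on BX f"
    unfolding BX_def using cont by (intro compact_uniformly_continuous) (auto intro: continuous_on_subset)
  then obtain \<delta> where \<delta>: "\<delta> > 0" "\<And>x y. x \<in> BX \<Longrightarrow> y \<in> BX \<Longrightarrow> dist y x < \<delta> \<Longrightarrow> dist (f y) (f x) < \<epsilon>"
    using \<epsilon> unfolding uniformly_continuous_on_def by metis
  define \<eta> where "\<eta> = min (1 / 2) (\<delta> / (2 * R * real ?d + 1))"
  have den: "2 * R * real ?d + 1 > 0" using R by (simp add: add_nonneg_pos)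
  have \<eta>: "\<eta> > 0" "\<eta> \<le> 1 / 2" "\<eta> \<le> \<delta> / (2 * R * real ?d + 1)" 
  proof -
    show "\<eta> > 0" using \<delta>(1) den by (simp add: \<eta>_def)
    show "\<eta> \<le> 1 / 2" unfolding \<eta>_def by (rule min.cobounded1)
    show "\<eta> \<le> \<delta> / (2 * R * real ?d + 1)" unfolding \<eta>_def by (rule min.cobounded2)
  qed
  show ?thesis
  proof (rule that[OF \<eta>(1)])
    fix \<rho> :: real and x :: "real ^ 'n::{finite,linorder}" assume \<rho>: "\<bar>\<rho> - 1\<bar> \<le> \<eta>"
    have \<rho>r: "1 / 2 \<le> \<rho>" "\<rho> \<le> 3 / 2" using \<rho> \<eta> by linarith+
    show "\<bar>f (\<rho> *\<^sub>R x) - f x\<bar> \<le> \<epsilon> * (if \<forall>i. \<bar>x $ i\<bar> \<le> 2 * R then 1 else 0)"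
    proof (cases "\<forall>i. \<bar>x $ i\<bar> \<le> 2 * R")
      case True
      have 1: "x \<in> BX"
      proof (rule inBX)
        fix i show "\<bar>x $ i\<bar> \<le> 3 * R" using True[rule_format, of i] R by linarith
      qed
      have 2: "\<rho> *\<^sub>R x \<in> BX"
      proof (rule inBX)
        fix i
        have "\<rho> * \<bar>x $ i\<bar> \<le> (3 / 2) * (2 * R)" using \<rho>r True by (intro mult_mono) auto
        then show "\<bar>(\<rho> *\<^sub>R x) $ i\<bar> \<le> 3 * R" using \<rho>r by (simp add: abs_mult)
      qed
      have "dist (\<rho> *\<^sub>R x) x \<le> (\<Sum>i\<in>UNIV. \<bar>(\<rho> *\<^sub>R x - x) $ i\<bar>)" unfolding dist_norm by (rule norm_le_l1_cart)
      also have "\<dots> \<le> (\<Sum>i\<in>(UNIV :: 'n set). \<eta> * (2 * R))"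
      proof (rule sum_mono)
        fix i
        have "(\<rho> *\<^sub>R x - x) $ i = (\<rho> - 1) * x $ i" by (simp add: left_diff_distrib)
        then show "\<bar>(\<rho> *\<^sub>R x - x) $ i\<bar> \<le> \<eta> * (2 * R)" using True \<rho> \<eta> by (simp add: abs_mult mult_mono)
      qed
      also have "\<dots> = \<eta> * (2 * R * real ?d)" by simp
      also have "\<dots> < \<eta> * (2 * R * real ?d + 1)" using \<eta> by (intro mult_strict_left_mono) auto
      also have "\<dots> \<le> \<delta> / (2 * R * real ?d + 1) * (2 * R * real ?d + 1)" using \<eta> den by (intro mult_right_mono) auto
      also have "\<dots> = \<delta>" using den by simp
      finally have "dist (f (\<rho> *\<^sub>R x)) (f x) < \<epsilon>" using \<delta>(2)[OF 1 2] by simp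
      then show ?thesis using True by (simp add: dist_real_def)
    next
      case False
      then obtain i where i: "2 * R < \<bar>x $ i\<bar>" by (auto simp: not_le)
      have "f x = 0" using supp[of x i] i R by force
      moreover have "f (\<rho> *\<^sub>R x) = 0"
      proof (rule ccontr)
        assume "f (\<rho> *\<^sub>R x) \<noteq> 0"
        from supp[OF this, of i] have "\<rho> * \<bar>x $ i\<bar> \<le> R" using \<rho>r by (simp add: abs_mult)
        moreover have "(1 / 2) * \<bar>x $ i\<bar> \<le> \<rho> * \<bar>x $ i\<bar>" using \<rho>r by (intro mult_right_mono) auto
        ultimately show False using i by linarith
      qed
      ultimately show ?thesis using \<epsilon> by simp
    qed
  qed
qed

lemma distinct_tuples_mono: "N \<le> N' \<Longrightarrow> distinct_tuples k N \<subseteq> distinct_tuples k N'"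
  unfolding distinct_tuples_def using PiE_mono[of "{1..k}" "\<lambda>_. {1..N}" "\<lambda>_. {1..N'}"] by auto

text \<open>For a nonnegative \<open>f\<close> the sum over tuples increases with the range of the
  entries, which permits comparison with the two neighbouring members of the sequence. The changes
  of the dilation factor and of \<open>1 / N\<close> are governed by the quotient
  \<open>q m\<close>.\<close>

lemma corr_mean_tendsto_nonneg:
  fixes f :: "real ^ 'n::{finite,linorder} \<Rightarrow> real"
  assumes good: "good_along k TYPE('n::{finite,linorder}) r \<alpha>" and r: "r \<ge> 1"
    and cont: "continuous_on UNIV f" and R: "R \<ge> 1" and supp: "\<And>x i. f x \<noteq> 0 \<Longrightarrow> \<bar>x $ i\<bar> \<le> real R"
    and f0: "\<And>x. f x \<ge> 0"
  shows "(\<lambda>N. corr_mean k \<alpha> N N f) \<longlonglongrightarrow> (\<integral>x. f x \<partial>lborel)"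
proof -
  define Nm where "Nm = (\<lambda>m. Suc m ^ r)"
  have Nm1: "Nm m \<ge> 1" for m by (simp add: Nm_def)
  have Nmm: "m < Nm m" for m
  proof -
    have "Suc m \<le> Suc m ^ r" using r by (intro self_le_power) auto
    then show ?thesis by (simp add: Nm_def)
  qed
  have Nmono: "Nm m \<le> Nm m'" if "m \<le> m'" for m m' using that by (simp add: Nm_def power_mono)
  \<comment> \<open>A continuous cutoff equal to 1 on the box in which dilation errors occur. It is
    itself a test function for \<open>good_along_tendsto\<close>, so the mean of the errors is
    controlled along the sequence.\<close>
  define g where "g = (\<lambda>x :: real ^ 'n::{finite,linorder}. \<Prod>i\<in>UNIV. max 0 (min 1 (2 * real R + 1 - \<bar>x $ i\<bar>)))"
  have contg: "continuous_on UNIV g" unfolding g_def by (intro continuous_intros)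
  have suppg: "\<bar>x $ i\<bar> \<le> real (2 * R + 1)" if "g x \<noteq> 0" for x i
  proof (rule ccontr)
    assume "\<not> ?thesis"
    then have "max 0 (min 1 (2 * real R + 1 - \<bar>x $ i\<bar>)) = 0" by auto
    then have "g x = 0" unfolding g_def by (intro prod_zero) auto
    then show False using that by simp
  qed
  have g0: "g x \<ge> 0" for x unfolding g_def by (intro prod_nonneg) auto
  have g1: "g x = 1" if "\<forall>i. \<bar>x $ i\<bar> \<le> 2 * real R" for x
  proof -
    have "max 0 (min 1 (2 * real R + 1 - \<bar>x $ i\<bar>)) = 1" for i using that[rule_format, of i] by auto
    then show ?thesis by (simp add: g_def)
  qed
  define F where "F = (\<lambda>m. corr_mean k \<alpha> (Nm m) (Nm m) f)"
  define Gs where "Gs = (\<lambda>m. corr_mean k \<alpha> (Nm m) (Nm m) g)"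
  define I where "I = (\<integral>x. f x \<partial>lborel)"
  define Ig where "Ig = (\<integral>x. g x \<partial>lborel)"
  have Flim: "F \<longlonglongrightarrow> I" unfolding F_def I_def Nm_def by (rule good_along_tendsto[OF good r cont R supp])
  have Glim: "Gs \<longlonglongrightarrow> Ig" unfolding Gs_def Ig_def Nm_def by (rule good_along_tendsto[OF good r contg _ suppg]) simp
  have F0: "F m \<ge> 0" "Gs m \<ge> 0" for m
    unfolding F_def Gs_def corr_mean_def by (intro divide_nonneg_nonneg sum_nonneg; simp add: f0 g0)+
  have Ig0: "Ig \<ge> 0" unfolding Ig_def using g0 by (intro integral_nonneg_AE) auto
  define q where "q = (\<lambda>m. real (Nm (Suc m)) / real (Nm m))"
  have qlim: "q \<longlonglongrightarrow> 1"
  proof -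
    have "(\<lambda>m. 1 / real (Suc m)) \<longlonglongrightarrow> 0" using LIMSEQ_inverse_real_of_nat by (simp add: divide_inverse)
    then have "(\<lambda>m. (1 + 1 / real (Suc m)) ^ r) \<longlonglongrightarrow> (1 + 0) ^ r" by (intro tendsto_intros)
    moreover have "q = (\<lambda>m. (1 + 1 / real (Suc m)) ^ r)"
    proof
      fix m
      have "q m = (real (Suc (Suc m)) / real (Suc m)) ^ r" by (simp add: q_def Nm_def power_divide)
      also have "real (Suc (Suc m)) / real (Suc m) = 1 + 1 / real (Suc m)" by (simp add: field_simps)
      finally show "q m = (1 + 1 / real (Suc m)) ^ r" .
    qed
    ultimately show ?thesis by simp
  qed
  \<comment> \<open>For \<open>N \<ge> 1\<close> this locates \<open>N\<close> between neighbours: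
    \<open>Nm (mm N) \<le> N < Nm (Suc (mm N))\<close>.\<close>
  define mm where "mm = (\<lambda>N. LEAST m. N < Nm (Suc m))"
  have mm1: "N < Nm (Suc (mm N))" for N
  proof -
    have "N < Nm (Suc N)" using Nmm[of "Suc N"] by simp
    then show ?thesis unfolding mm_def by (rule LeastI)
  qed
  have mm2: "Nm (mm N) \<le> N" if "N \<ge> 1" for N
  proof (cases "mm N")
    case 0 then show ?thesis using that by (simp add: Nm_def)
  next
    case (Suc j)
    then have "\<not> N < Nm (Suc j)" using not_less_Least[of j "\<lambda>m. N < Nm (Suc m)"] by (simp add: mm_def)
    then show ?thesis using Suc by simp
  qed
  have mminf: "filterlim mm at_top sequentially"
    unfolding filterlim_at_top
  proof
    fix M
    show "\<forall>\<^sub>F N in sequentially. M \<le> mm N"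
    proof (rule eventually_sequentiallyI[of "Nm M"])
      fix N assume "Nm M \<le> N"
      then have "Nm M < Nm (Suc (mm N))" using mm1[of N] by linarith
      then have "\<not> Suc (mm N) \<le> M" using Nmono[of "Suc (mm N)" M] by linarith
      then show "M \<le> mm N" by simp
    qed
  qed
  show ?thesis
  proof (rule LIMSEQ_I)
    fix e :: real assume e: "e > 0"
    \<comment> \<open>The dilation error has the limit \<open>\<epsilon> * Ig \<le> e / 2\<close>;
      the summand 1 in the denominator covers the case \<open>Ig = 0\<close>.\<close>
    define \<epsilon> where "\<epsilon> = e / (2 * (Ig + 1))"
    have \<epsilon>: "\<epsilon> > 0" using e Ig0 by (simp add: \<epsilon>_def)
    have \<epsilon>I: "\<epsilon> * Ig < e / 2 + e / 2" "\<epsilon> * Ig \<le> e / 2"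
    proof -
      have "\<epsilon> * Ig \<le> \<epsilon> * (Ig + 1)" using \<epsilon> by simp
      also have "\<dots> = e / 2"
      proof -
        have "Ig + 1 \<noteq> 0" using Ig0 by linarith
        moreover have "e / (2 * y) * y = e / 2" if "y \<noteq> 0" for y using that by simp
        ultimately show ?thesis unfolding \<epsilon>_def by blast
      qed
      finally show "\<epsilon> * Ig \<le> e / 2" .
      then show "\<epsilon> * Ig < e / 2 + e / 2" using e by linarith
    qed
    obtain \<eta> where \<eta>: "\<eta> > 0" "\<And>\<rho> x. \<bar>\<rho> - 1\<bar> \<le> \<eta> \<Longrightarrow> \<bar>f (\<rho> *\<^sub>R x) - f x\<bar> \<le> \<epsilon> * (if \<forall>i. \<bar>x $ i\<bar> \<le> 2 * real R then 1 else 0)"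
      using dilation_error[OF cont _ supp \<epsilon>] R by (metis of_nat_1 of_nat_le_iff)
    have dil: "\<bar>f (\<rho> *\<^sub>R x) - f x\<bar> \<le> \<epsilon> * g x" if "\<bar>\<rho> - 1\<bar> \<le> \<eta>" for \<rho> x
    proof -
      have "(if \<forall>i. \<bar>x $ i\<bar> \<le> 2 * real R then 1 else 0) \<le> g x" using g0[of x] g1[of x] by auto
      then have "\<epsilon> * (if \<forall>i. \<bar>x $ i\<bar> \<le> 2 * real R then 1 else 0) \<le> \<epsilon> * g x" using \<epsilon> by (intro mult_left_mono) auto
      then show ?thesis using \<eta>(2)[OF that, of x] by linarith
    qed
    have ev1: "\<forall>\<^sub>F m in sequentially. q m * (F (Suc m) + \<epsilon> * Gs (Suc m)) < I + e"
    proof -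
      have "(\<lambda>m. q m * (F (Suc m) + \<epsilon> * Gs (Suc m))) \<longlonglongrightarrow> 1 * (I + \<epsilon> * Ig)"
        by (intro tendsto_intros qlim LIMSEQ_Suc Flim Glim)
      then show ?thesis using \<epsilon>I e by (intro order_tendstoD) auto
    qed
    have ev2: "\<forall>\<^sub>F m in sequentially. I - e < (1 / q m) * F m - \<epsilon> * Gs m"
    proof -
      have "(\<lambda>m. (1 / q m) * F m - \<epsilon> * Gs m) \<longlonglongrightarrow> (1 / 1) * I - \<epsilon> * Ig"
        by (intro tendsto_intros qlim Flim Glim) auto
      then show ?thesis using \<epsilon>I e by (intro order_tendstoD) auto
    qed
    have ev3: "\<forall>\<^sub>F m in sequentially. q m < 1 + min \<eta> 1" using qlim \<eta>(1) by (intro order_tendstoD) auto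
    have ev: "\<forall>\<^sub>F N in sequentially. q (mm N) * (F (Suc (mm N)) + \<epsilon> * Gs (Suc (mm N))) < I + e \<and>
       I - e < (1 / q (mm N)) * F (mm N) - \<epsilon> * Gs (mm N) \<and> q (mm N) < 1 + min \<eta> 1 \<and> N \<ge> 1"
      using eventually_compose_filterlim[OF ev1 mminf] eventually_compose_filterlim[OF ev2 mminf]
        eventually_compose_filterlim[OF ev3 mminf] eventually_ge_at_top[of 1]
      by eventually_elim auto
    have "\<forall>\<^sub>F N in sequentially. norm (corr_mean k \<alpha> N N f - I) < e"
      using ev
    proof eventually_elim
      case (elim N)
      define m where "m = mm N"
      define y where "y = (\<lambda>x. frac_centered (power_diffs x \<alpha> :: real ^ 'n::{finite,linorder}))"
      have N: "N \<ge> 1" "Nm m \<le> N" "N \<le> Nm (Suc m)" using elim mm1[of N] mm2[of N] by (auto simp: m_def)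
      have pos: "real N > 0" "real (Nm m) > 0" "real (Nm (Suc m)) > 0" using N Nm1[of m] Nm1[of "Suc m"] by simp_all
      have q1: "q m \<ge> 1" using Nmono[of m "Suc m"] pos by (simp add: q_def)
      have up: "corr_mean k \<alpha> N N f \<le> q m * (F (Suc m) + \<epsilon> * Gs (Suc m))"
      proof -
        define N' where "N' = Nm (Suc m)"
        define \<rho> where "\<rho> = real N / real N'"
        have "1 / q m \<le> \<rho>" unfolding q_def \<rho>_def N'_def using N pos by (simp add: divide_right_mono)
        moreover have "1 - \<eta> \<le> 1 / q m"
        proof -
          have "(1 - \<eta>) * q m \<le> 1"
          proof (cases "\<eta> \<le> 1")
            case True
            have "(1 - \<eta>) * q m \<le> (1 - \<eta>) * (1 + \<eta>)" using elim True by (intro mult_left_mono) (auto simp: m_def)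
            also have "\<dots> = 1 - \<eta> * \<eta>" by (simp add: algebra_simps)
            also have "\<dots> \<le> 1" by simp
            finally show ?thesis .
          next
            case False
            then have "(1 - \<eta>) * q m \<le> 0" using q1 by (intro mult_nonpos_nonneg) auto
            then show ?thesis by simp
          qed
          then show ?thesis using q1 by (simp add: le_divide_eq)
        qed
        moreover have "\<rho> \<le> 1" using N pos by (simp add: \<rho>_def N'_def)
        ultimately have \<rho>: "\<bar>\<rho> - 1\<bar> \<le> \<eta>" using \<eta>(1) by linarith
        have sc: "real N *\<^sub>R y x = \<rho> *\<^sub>R (real N' *\<^sub>R y x)" for x using pos by (simp add: \<rho>_def N'_def)
        have "(\<Sum>x\<in>distinct_tuples k N. f (real N *\<^sub>R y x)) \<le> (\<Sum>x\<in>distinct_tuples k N'. f (real N *\<^sub>R y x))"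
          using N distinct_tuples_mono[of N N' k] f0 by (intro sum_mono2) (auto simp: N'_def)
        also have "\<dots> \<le> (\<Sum>x\<in>distinct_tuples k N'. f (real N' *\<^sub>R y x) + \<epsilon> * g (real N' *\<^sub>R y x))"
        proof (rule sum_mono)
          fix x show "f (real N *\<^sub>R y x) \<le> f (real N' *\<^sub>R y x) + \<epsilon> * g (real N' *\<^sub>R y x)"
            using dil[OF \<rho>, of "real N' *\<^sub>R y x"] unfolding sc[symmetric] by linarith
        qed
        also have "\<dots> = real N' * (F (Suc m) + \<epsilon> * Gs (Suc m))"
          using pos by (simp add: F_def Gs_def corr_mean_def N'_def y_def sum.distrib sum_distrib_left field_simps)
        finally have "corr_mean k \<alpha> N N f \<le> real N' * (F (Suc m) + \<epsilon> * Gs (Suc m)) / real N"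
          unfolding corr_mean_def y_def by (intro divide_right_mono) auto
        also have "\<dots> \<le> real N' * (F (Suc m) + \<epsilon> * Gs (Suc m)) / real (Nm m)"
          using N pos F0 \<epsilon> by (intro divide_left_mono mult_nonneg_nonneg add_nonneg_nonneg mult_pos_pos) auto
        finally show ?thesis by (simp add: q_def N'_def)
      qed
      have low: "(1 / q m) * F m - \<epsilon> * Gs m \<le> corr_mean k \<alpha> N N f"
      proof -
        define N' where "N' = Nm m"
        define \<rho> where "\<rho> = real N / real N'"
        have "\<rho> \<le> q m" unfolding q_def \<rho>_def N'_def using N pos by (simp add: divide_right_mono)
        moreover have "1 \<le> \<rho>" using N pos by (simp add: \<rho>_def N'_def)
        moreover have "q m < 1 + min \<eta> 1" using elim by (simp add: m_def)
        then have "q m < 1 + \<eta>" using min.cobounded1[of \<eta> 1] by linarith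
        ultimately have \<rho>: "\<bar>\<rho> - 1\<bar> \<le> \<eta>" by linarith
        have sc: "real N *\<^sub>R y x = \<rho> *\<^sub>R (real N' *\<^sub>R y x)" for x using pos by (simp add: \<rho>_def N'_def)
        have "real N' * (F m - \<epsilon> * Gs m) = (\<Sum>x\<in>distinct_tuples k N'. f (real N' *\<^sub>R y x) - \<epsilon> * g (real N' *\<^sub>R y x))"
          using pos by (simp add: F_def Gs_def corr_mean_def N'_def y_def sum_subtractf sum_distrib_left field_simps)
        also have "\<dots> \<le> (\<Sum>x\<in>distinct_tuples k N'. f (real N *\<^sub>R y x))"
        proof (rule sum_mono)
          fix x show "f (real N' *\<^sub>R y x) - \<epsilon> * g (real N' *\<^sub>R y x) \<le> f (real N *\<^sub>R y x)"
            using dil[OF \<rho>, of "real N' *\<^sub>R y x"] unfolding sc[symmetric] by linarith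
        qed
        also have "\<dots> \<le> (\<Sum>x\<in>distinct_tuples k N. f (real N *\<^sub>R y x))"
          using N distinct_tuples_mono[of N' N k] f0 by (intro sum_mono2) (auto simp: N'_def)
        finally have "real N' * (F m - \<epsilon> * Gs m) / real N \<le> corr_mean k \<alpha> N N f"
          unfolding corr_mean_def y_def by (intro divide_right_mono) auto
        moreover have "(1 / q m) * F m \<le> (real N' / real N) * F m"
        proof (intro mult_right_mono F0)
          show "1 / q m \<le> real N' / real N" unfolding q_def N'_def using N pos by (simp add: divide_left_mono)
        qed
        moreover have "(real N' / real N) * (\<epsilon> * Gs m) \<le> 1 * (\<epsilon> * Gs m)"
          using N pos F0 \<epsilon> by (intro mult_right_mono) (auto simp: N'_def)
        ultimately show ?thesis by (simp add: right_diff_distrib diff_divide_distrib)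
      qed
      show ?case using up low elim by (auto simp: m_def abs_less_iff)
    qed
    then show "\<exists>no. \<forall>N\<ge>no. norm (corr_mean k \<alpha> N N f - (\<integral>x. f x \<partial>lborel)) < e"
      by (simp add: eventually_sequentially I_def)
  qed
qed

lemma integrable_continuous_supported:
  fixes f :: "real ^ 'n::{finite,linorder} \<Rightarrow> real"
  assumes cont: "continuous_on UNIV f" and supp: "\<And>x i. f x \<noteq> 0 \<Longrightarrow> \<bar>x $ i\<bar> \<le> R"
  shows "integrable lborel f"
proof -
  define S :: "(real ^ 'n::{finite,linorder}) set" where "S = cbox (\<chi> i. - R) (\<chi> i. R)"
  have "integrable lborel (\<lambda>x. indicator S x *\<^sub>R f x)"
    unfolding S_def using cont by (intro borel_integrable_compact) (auto intro: continuous_on_subset)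
  moreover have "(\<lambda>x. indicator S x *\<^sub>R f x) = f"
  proof
    fix x show "indicator S x *\<^sub>R f x = f x"
    proof (cases "f x = 0")
      case False
      have "- R \<le> x $ i \<and> x $ i \<le> R" for i using supp[OF False, of i] by linarith
      then have "x \<in> S" by (simp add: S_def mem_box_cart)
      then show ?thesis by simp
    qed simp
  qed
  ultimately show ?thesis by simp
qed

section \<open>Signed test functions and the union over the exponents r\<close>

text \<open>The squeezing works for nonnegative functions, so \<open>f\<close> is split into its
  positive and negative parts. These are continuous with bounded support but in general not smooth,
  which is the generality of the preceding limits.\<close>

lemma good_along_imp_poissonian:
  fixes f :: "real ^ 'n::{finite,linorder} \<Rightarrow> real"
  assumes good: "good_along k TYPE('n::{finite,linorder}) r \<alpha>" and r: "r \<ge> 1" and f: "smooth_compact_support f"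
  shows "(\<lambda>N. correlation_sum k f \<alpha> N) \<longlonglongrightarrow> (\<integral>x. f x \<partial>lborel)"
proof -
  have cont: "continuous_on UNIV f" using f unfolding smooth_compact_support_def by (metis class_C.simps(1))
  have "bounded {x. f x \<noteq> 0}"
    using f unfolding smooth_compact_support_def by (meson bounded_subset closure_subset compact_imp_bounded)
  then obtain B where B: "\<And>x. f x \<noteq> 0 \<Longrightarrow> norm x \<le> B" by (auto simp: bounded_iff)
  define R where "R = nat \<lceil>\<bar>B\<bar>\<rceil> + 1"
  have R: "R \<ge> 1" "B \<le> real R" unfolding R_def by linarith+
  have supp: "\<bar>x $ i\<bar> \<le> real R" if "f x \<noteq> 0" for x i
    using B[OF that] R(2) component_le_norm_cart[of x i] by linarith
  define fp where "fp = (\<lambda>x. max (f x) 0)"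
  define fm where "fm = (\<lambda>x. max (- f x) 0)"
  have fpm: "f x = fp x - fm x" for x by (auto simp: fp_def fm_def)
  have contp: "continuous_on UNIV fp" "continuous_on UNIV fm" unfolding fp_def fm_def by (intro continuous_intros cont)+
  have suppp: "\<bar>x $ i\<bar> \<le> real R" if "fp x \<noteq> 0" for x i using that supp[of x i] by (auto simp: fp_def max_def split: if_splits)
  have suppm: "\<bar>x $ i\<bar> \<le> real R" if "fm x \<noteq> 0" for x i using that supp[of x i] by (auto simp: fm_def max_def split: if_splits)
  have "(\<lambda>N. corr_mean k \<alpha> N N fp - corr_mean k \<alpha> N N fm) \<longlonglongrightarrow> (\<integral>x. fp x \<partial>lborel) - (\<integral>x. fm x \<partial>lborel)"
    by (intro tendsto_diff corr_mean_tendsto_nonneg[OF good r contp(1) R(1) suppp] corr_mean_tendsto_nonneg[OF good r contp(2) R(1) suppm])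
       (auto simp: fp_def fm_def)
  moreover have "(\<integral>x. fp x \<partial>lborel) - (\<integral>x. fm x \<partial>lborel) = (\<integral>x. f x \<partial>lborel)"
    unfolding fpm
    by (rule Bochner_Integration.integral_diff[symmetric])
       (use integrable_continuous_supported[OF contp(1) suppp] integrable_continuous_supported[OF contp(2) suppm] in auto)
  moreover have "corr_mean k \<alpha> N N fp - corr_mean k \<alpha> N N fm = corr_mean k \<alpha> N N f" for N
    unfolding corr_mean_def by (simp add: fpm[of "_ *\<^sub>R _"] sum_subtractf diff_divide_distrib)
  ultimately have "(\<lambda>N. corr_mean k \<alpha> N N f) \<longlonglongrightarrow> (\<integral>x. f x \<partial>lborel)" by simp
  moreover have "\<forall>\<^sub>F N in sequentially. corr_mean k \<alpha> N N f = correlation_sum k f \<alpha> N"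
  proof (rule eventually_sequentiallyI[of "2 * R + 1"])
    fix N assume N: "2 * R + 1 \<le> N"
    then have "2 * real R < real N" "N \<ge> 1" by linarith+
    then show "corr_mean k \<alpha> N N f = correlation_sum k f \<alpha> N"
      using correlation_sum_eq_corr_mean[of f "real R" N k \<alpha>] supp by simp
  qed
  ultimately show ?thesis by (rule Lim_transform_eventually)
qed

text \<open>The exponent \<open>r\<close> depends on the distance from the threshold, so the
  half-line is exhausted by the countably many sets
  \<open>\<alpha> \<ge> \<theta> + 1 / (j + 1)\<close>, each with its own \<open>r\<close>. An
  \<alpha> that is good for one \<open>r\<close> serves every test function, so the null set does
  not depend on \<open>f\<close>.\<close>

lemma AE_poissonian:
  fixes k :: nat
  assumes k: "k \<ge> 2" "CARD('n::{finite,linorder}) = k - 1"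
  shows "AE \<alpha> in lebesgue. \<alpha> > 4 * (real k)\<^sup>2 - 4 * real k - 1 \<longrightarrow>
            (\<forall>f :: real ^ 'n::{finite,linorder} \<Rightarrow> real. smooth_compact_support f \<longrightarrow>
               (\<lambda>N. correlation_sum k f \<alpha> N) \<longlonglongrightarrow> (\<integral>x. f x \<partial>lborel))"
proof -
  define \<theta> where "\<theta> = 4 * (real k)\<^sup>2 - 4 * real k - 1"
  have "AE \<alpha> in lborel. \<theta> + 1 / real (Suc j) \<le> \<alpha> \<longrightarrow> (\<exists>r\<ge>1. good_along k TYPE('n) r \<alpha>)" for j
  proof -
    have "\<theta> + 1 / real (Suc j) > 4 * (real k)\<^sup>2 - 4 * real k - 1" by (simp add: \<theta>_def)
    then obtain r where r: "admissible_exponent k (\<theta> + 1 / real (Suc j)) r"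
      using admissible_exponent_exists[OF k(1)] by blast
    then have "r \<ge> 1" by (simp add: admissible_exponent_def)
    from AE_good_along[OF k r] show ?thesis by (rule AE_mp) (use \<open>r \<ge> 1\<close> in auto)
  qed
  then have "AE \<alpha> in lborel. \<forall>j. \<theta> + 1 / real (Suc j) \<le> \<alpha> \<longrightarrow> (\<exists>r\<ge>1. good_along k TYPE('n) r \<alpha>)"
    unfolding AE_all_countable by blast
  then have "AE \<alpha> in lborel. \<alpha> > 4 * (real k)\<^sup>2 - 4 * real k - 1 \<longrightarrow>
            (\<forall>f :: real ^ 'n::{finite,linorder} \<Rightarrow> real. smooth_compact_support f \<longrightarrow>
               (\<lambda>N. correlation_sum k f \<alpha> N) \<longlonglongrightarrow> (\<integral>x. f x \<partial>lborel))"
  proof (rule AE_mp, intro AE_I2 impI allI)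
    fix \<alpha> :: real and f :: "real ^ 'n::{finite,linorder} \<Rightarrow> real"
    assume *: "\<forall>j. \<theta> + 1 / real (Suc j) \<le> \<alpha> \<longrightarrow> (\<exists>r\<ge>1. good_along k TYPE('n) r \<alpha>)"
      and \<alpha>: "4 * (real k)\<^sup>2 - 4 * real k - 1 < \<alpha>" and f: "smooth_compact_support f"
    have "0 < \<alpha> - \<theta>" using \<alpha> by (simp add: \<theta>_def)
    then obtain j where "inverse (real (Suc j)) < \<alpha> - \<theta>" using reals_Archimedean by blast
    then have "\<theta> + 1 / real (Suc j) \<le> \<alpha>" by (simp add: divide_inverse)
    then obtain r where "r \<ge> 1" "good_along k TYPE('n) r \<alpha>" using * by blast
    then show "(\<lambda>N. correlation_sum k f \<alpha> N) \<longlonglongrightarrow> (\<integral>x. f x \<partial>lborel)" using f by (intro good_along_imp_poissonian)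
  qed
  then show ?thesis by (rule AE_completion)
qed

theorem theorem1p2:
  fixes k :: nat
  assumes "k \<ge> 2" and "CARD('n::{finite,linorder}) = k - 1"
  shows "(AE \<alpha> in lebesgue. \<alpha> > 4 * (real k)\<^sup>2 - 4 * real k - 1 \<longrightarrow>
            (\<forall>f :: real ^ 'n::{finite,linorder} \<Rightarrow> real. smooth_compact_support f \<longrightarrow>
               (\<lambda>N. correlation_sum k f \<alpha> N) \<longlonglongrightarrow> (\<integral>x. f x \<partial>lborel)))
       \<and> (AE \<alpha> in lebesgue. \<alpha> > 7 \<longrightarrow>
            (\<forall>f :: real ^ 1 \<Rightarrow> real. smooth_compact_support f \<longrightarrow>
               (\<lambda>N. correlation_sum 2 f \<alpha> N) \<longlonglongrightarrow> (\<integral>x. f x \<partial>lborel)))"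
  \<comment> \<open>For \<open>k = 2\<close> the threshold \<open>4 * k^2 - 4 * k - 1\<close> is 7,
    and the index type \<open>1\<close> has \<open>k - 1\<close> elements.\<close>
  using AE_poissonian[OF assms] AE_poissonian[of 2, where 'n = 1] by simp

end
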